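(* Let $M$ be a closed smooth manifold and let $\{D_x\}_{x\in M}$ be a family of unbounded self-adjoint Fredholm operators with compact resolvent on $\mathcal{H}$. Let $\mathcal{G}(\{D_x\})\in H^3(M,\mathbb{Z})$ be the class obtained from the Čech cocycle $g$ of intertwiners between quasi-free representations of $CAR(\mathcal{H})$ defined in the context. Then $\mathcal{G}(\{D_x\})$ is equal to the Dixmier–Douady invariant of the index gerbe of the family $\{D_x\}$ (as defined by Lott).
   Context: $\mathcal{H}$ is a separable infinite-dimensional complex Hilbert space. A family $\{D_x\}$ consists of unbounded self-adjoint Fredholm operators on $\mathcal{H}$ with compact resolvent, each with infinitely many positive and infinitely many negative eigenvalues, such that $x\mapsto D_x(1+D_x^2)^{-1/2}$ is norm continuous. Fix a finite open cover $\{U_i\}_{i=1}^N$ of $M$, all of whose nonempty finite intersections are contractible, and $\lambda_i\in\mathbb{R}$ with $\lambda_i\notin\mathrm{sp}(D_x)$ for $x\in U_i$. For $x\in U_i$ let $P_i(x)=P_{U_i}(x)$ be the orthogonal projection onto the closed span of the eigenspaces of $D_x$ for eigenvalues $>\lambda_i$. Each $P_i$ is continuous, and $P_i(x)-P_j(x)$ has finite rank on $U_i\cap U_j$. Write $i\prec j$ if $\lambda_i<\lambda_j$, or $\lambda_i=\lambda_j$ and $i<j$. Then $P_i\ge P_j$ on $U_i\cap U_j$ when $i\prec j$, and one sets $W_{ij}(x)=(P_i(x)-P_j(x))\mathcal{H}$, a finite-rank vector bundle over $U_i\cap U_j$. Definition of $\mathcal{G}(\{D_x\})$. For a Hilbert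 space $K$, $\overline{K}$ is the conjugate space and $\mathcal{F}(K)$ the antisymmetric Fock space. For a projection $P$, $\mathcal{F}_P(\mathcal{H})=\mathcal{F}(P\mathcal{H})\otimes\mathcal{F}(\overline{(I-P)\mathcal{H}})$ with vacuum $\Omega_P=1\otimes 1$. It carries the irreducible quasi-free representation of $CAR(\mathcal{H})$ sending the creation generator of $f$ to $a^*(Pf)\otimes1+(-1)^{\mathrm{deg}}\otimes a(\overline{(I-P)f})$, where $a^*,a$ are creation and annihilation operators and $\mathrm{deg}$ is the degree operator on $\mathcal{F}(P\mathcal{H})$. For $i\prec j$ choose unit volume elements $\omega_{ij}(x)\in\Lambda^{\mathrm{top}}W_{ij}(x)$ depending continuously on $x\in U_i\cap U_j$. Let $S_{ji}(x):\mathcal{F}_{P_i(x)}(\mathcal{H})\to\mathcal{F}_{P_j(x)}(\mathcal{H})$ be the unique unitary intertwining the two quasi-free representations with $S_{ji}(x)(\omega_{ij}(x)\otimes1)=\Omega_{P_j(x)}$, and put $S_{ij}=S_{ji}^{-1}$, $S_{ii}=I$. On $U_i\cap U_j\cap U_k$ define $g(U_i,U_j,U_k)(x)\in S^1$ by $S_{ji}(x)S_{ik}(x)S_{kj}(x)=g(U_i,U_j,U_k)(x)I$. This is a Čech $2$-cocycle with values in the sheaf $\underline{S}^1$ of continuous $S^1$-valued functions, and $\mathcal{G}(\{D_x\})$ is the image of $[g]$ under the connecting isomorphism $H^2(\{U_i\},\underline{S}^1)\to H^3(M,\mathbb{Z})$ of the exponential sequence $0\to\underline{\mathbb{Z}}\to\underline{\mathbb{R}}\to\underline{S}^1\to0$.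 Index gerbe (in the sense of Hitchin). It is given by the line bundles $\mathcal{L}_{ij}$ over $U_i\cap U_j$ defined by $\mathcal{L}_{ji}=\Lambda^{\mathrm{top}}W_{ij}$ and $\mathcal{L}_{ij}=(\Lambda^{\mathrm{top}}W_{ij})^{*}$ for $i\prec j$, together with the canonical nowhere-zero sections $\theta_{ijk}$ of $\mathcal{L}_{ij}\otimes\mathcal{L}_{jk}\otimes\mathcal{L}_{ki}$ over $U_i\cap U_j\cap U_k$ coming from the isomorphisms $\Lambda^{\mathrm{top}}W_{ik}\cong\Lambda^{\mathrm{top}}W_{jk}\otimes\Lambda^{\mathrm{top}}W_{ij}$ ($i\prec j\prec k$, since $W_{ik}=W_{ij}\oplus W_{jk}$) given by exterior multiplication, and from duality. Its Dixmier–Douady invariant is obtained as follows: choose unit sections $s_{ij}$ of $\mathcal{L}_{ij}$ with $s_{ji}=s_{ij}^{-1}$, and write $s_{ij}\otimes s_{jk}\otimes s_{ki}=h_{ijk}\,\theta_{ijk}$ with $h_{ijk}$ an $S^1$-valued function. The invariant is the image of $[h]\in H^2(\{U_i\},\underline{S}^1)$ in $H^3(M,\mathbb{Z})$ under the same connecting map. *)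

theory Defs
  imports "HOL-Analysis.Analysis"
begin

section \<open>Complex Hilbert spaces\<close>

text \<open>The inner product is antilinear in the first and linear in the second argument. A complex
  Hilbert space is a type of sort \<open>{complex_inner, complete_space}\<close>; separability is the class
  \<open>second_countable_topology\<close>.\<close>

class complex_inner = real_inner +
  fixes scaleC :: "complex \<Rightarrow> 'a \<Rightarrow> 'a" (infixr "*c" 75)
    and cinner :: "'a \<Rightarrow> 'a \<Rightarrow> complex"
  assumes scaleC_add_right: "a *c (x + y) = a *c x + a *c y"
    and scaleC_add_left: "(a + b) *c x = a *c x + b *c x"
    and scaleC_scaleC: "a *c (b *c x) = (a * b) *c x"
    and scaleR_scaleC: "r *\<^sub>R x = complex_of_real r *c x"
    and cinner_commute: "cinner x y = cnj (cinner y x)"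
    and cinner_add_right: "cinner x (y + z) = cinner x y + cinner x z"
    and cinner_scaleC_right: "cinner x (a *c y) = a * cinner x y"
    and inner_eq_Re_cinner: "inner x y = Re (cinner x y)"

definition csubspace :: "'h::complex_inner set \<Rightarrow> bool" where
  "csubspace V \<longleftrightarrow>
     0 \<in> V \<and> (\<forall>x\<in>V. \<forall>y\<in>V. x + y \<in> V) \<and> (\<forall>a. \<forall>x\<in>V. a *c x \<in> V)"

definition cspan :: "'h::complex_inner set \<Rightarrow> 'h set" where
  "cspan B = csubspace hull B"

definition orthonormal :: "'h::complex_inner set \<Rightarrow> bool" where
  "orthonormal E \<longleftrightarrow> (\<forall>e\<in>E. \<forall>f\<in>E. cinner e f = (if e = f then 1 else 0))"

definition has_cdim :: "'h::complex_inner set \<Rightarrow> nat \<Rightarrow> bool" where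
  "has_cdim V n \<longleftrightarrow> (\<exists>E. finite E \<and> card E = n \<and> orthonormal E \<and> cspan E = V)"

definition finite_cdim :: "'h::complex_inner set \<Rightarrow> bool" where
  "finite_cdim V \<longleftrightarrow> (\<exists>n. has_cdim V n)"

text \<open>Orthogonal projection onto a closed subspace.\<close>

definition ortho_proj :: "'h::complex_inner set \<Rightarrow> 'h \<Rightarrow> 'h" where
  "ortho_proj K v = (THE u. u \<in> K \<and> (\<forall>w\<in>K. cinner w (v - u) = 0))"

text \<open>The conjugate space of \<open>K\<close> is \<open>K\<close> itself with the following operations.\<close>

definition scaleC_bar :: "complex \<Rightarrow> 'h::complex_inner \<Rightarrow> 'h" where
  "scaleC_bar a x = cnj a *c x"

definition cinner_bar :: "'h::complex_inner \<Rightarrow> 'h \<Rightarrow> complex" where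
  "cinner_bar x y = cinner y x"


section \<open>Unbounded operators\<close>

text \<open>An operator is a pair of its domain and a function whose values off the domain are
  irrelevant.\<close>

type_synonym 'h unb_op = "'h set \<times> ('h \<Rightarrow> 'h)"

abbreviation op_dom :: "'h unb_op \<Rightarrow> 'h set" where "op_dom \<equiv> fst"
abbreviation op_app :: "'h unb_op \<Rightarrow> 'h \<Rightarrow> 'h" where "op_app \<equiv> snd"

definition linear_op :: "'h::complex_inner unb_op \<Rightarrow> bool" where
  "linear_op D \<longleftrightarrow> csubspace (op_dom D) \<and>
     (\<forall>x\<in>op_dom D. \<forall>y\<in>op_dom D. op_app D (x + y) = op_app D x + op_app D y) \<and>
     (\<forall>a. \<forall>x\<in>op_dom D. op_app D (a *c x) = a *c op_app D x)"

text \<open>Densely defined and equal to its adjoint, whose graph consists of the pairs \<open>(y, z)\<close> with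
  \<open>\<langle>D v, y\<rangle> = \<langle>v, z\<rangle>\<close> for all \<open>v\<close> in the domain.\<close>

definition self_adjoint :: "'h::complex_inner unb_op \<Rightarrow> bool" where
  "self_adjoint D \<longleftrightarrow> linear_op D \<and> closure (op_dom D) = UNIV \<and>
     (\<forall>y z. (\<forall>v\<in>op_dom D. cinner (op_app D v) y = cinner v z) \<longleftrightarrow>
            (y \<in> op_dom D \<and> z = op_app D y))"

definition is_resolvent :: "'h::complex_inner unb_op \<Rightarrow> complex \<Rightarrow> ('h \<Rightarrow> 'h) \<Rightarrow> bool" where
  "is_resolvent D \<mu> R \<longleftrightarrow> bounded_linear R \<and>
     (\<forall>v. R v \<in> op_dom D \<and> op_app D (R v) - \<mu> *c R v = v) \<and>
     (\<forall>v\<in>op_dom D. R (op_app D v - \<mu> *c v) = v)"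

definition spectrum :: "'h::complex_inner unb_op \<Rightarrow> complex set" where
  "spectrum D = {\<mu>. \<not> (\<exists>R. is_resolvent D \<mu> R)}"

definition compact_resolvent :: "'h::complex_inner unb_op \<Rightarrow> bool" where
  "compact_resolvent D \<longleftrightarrow>
     (\<exists>\<mu> R. is_resolvent D \<mu> R \<and> compact (closure (R ` cball 0 1)))"

text \<open>The orthogonal complement of the (closed) range represents the cokernel.\<close>

definition fredholm :: "'h::complex_inner unb_op \<Rightarrow> bool" where
  "fredholm D \<longleftrightarrow> finite_cdim {v \<in> op_dom D. op_app D v = 0} \<and>
     closed (op_app D ` op_dom D) \<and>
     finite_cdim {y. \<forall>v\<in>op_dom D. cinner (op_app D v) y = 0}"

definition eigenspace :: "'h::complex_inner unb_op \<Rightarrow> real \<Rightarrow> 'h set" where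
  "eigenspace D r = {v \<in> op_dom D. op_app D v = r *\<^sub>R v}"

definition eigenvalues :: "'h::complex_inner unb_op \<Rightarrow> real set" where
  "eigenvalues D = {r. \<exists>v\<in>eigenspace D r. v \<noteq> 0}"

definition spectral_proj :: "'h::complex_inner unb_op \<Rightarrow> real \<Rightarrow> 'h \<Rightarrow> 'h" where
  "spectral_proj D l = ortho_proj (closure (cspan (\<Union>r\<in>{l<..}. eigenspace D r)))"

text \<open>\<open>(1 + D\<^sup>2)\<^sup>-\<^sup>1\<^sup>/\<^sup>2\<close> is the bounded positive operator \<open>R\<close> with \<open>R\<^sup>2 = (1 + D\<^sup>2)\<^sup>-\<^sup>1\<close>.\<close>

definition inv_sqrt_1_plus_sq :: "'h::complex_inner unb_op \<Rightarrow> 'h \<Rightarrow> 'h" where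
  "inv_sqrt_1_plus_sq D = (THE R. bounded_linear R \<and> (\<forall>a v. R (a *c v) = a *c R v) \<and>
     (\<forall>v. cinner v (R v) \<in> \<real> \<and> 0 \<le> Re (cinner v (R v))) \<and>
     (\<forall>v. R (R v) \<in> op_dom D \<and> op_app D (R (R v)) \<in> op_dom D \<and>
          R (R v) + op_app D (op_app D (R (R v))) = v))"

definition bounded_transform :: "'h::complex_inner unb_op \<Rightarrow> 'h \<Rightarrow> 'h" where
  "bounded_transform D v = op_app D (inv_sqrt_1_plus_sq D v)"

definition fredholm_family :: "'m topology \<Rightarrow> ('m \<Rightarrow> 'h::complex_inner unb_op) \<Rightarrow> bool" where
  "fredholm_family M D \<longleftrightarrow>
     (\<forall>x\<in>topspace M. self_adjoint (D x) \<and> fredholm (D x) \<and> compact_resolvent (D x) \<and>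
        infinite (eigenvalues (D x) \<inter> {0<..}) \<and> infinite (eigenvalues (D x) \<inter> {..<0})) \<and>
     continuous_map M euclidean (\<lambda>x. Blinfun (bounded_transform (D x)))"


section \<open>Closed smooth manifolds\<close>

text \<open>\<open>C_k n k V f\<close>: on the open subset \<open>V\<close> of \<open>\<real>\<^sup>n\<close>, all partial derivatives of \<open>f\<close> of order at
  most \<open>k\<close> exist and are continuous.\<close>

primrec C_k :: "nat \<Rightarrow> nat \<Rightarrow> (nat \<Rightarrow> real) set \<Rightarrow> ((nat \<Rightarrow> real) \<Rightarrow> real) \<Rightarrow> bool" where
  "C_k n 0 V f \<longleftrightarrow> continuous_map (subtopology (Euclidean_space n) V) euclideanreal f"
| "C_k n (Suc k) V f \<longleftrightarrow>
     continuous_map (subtopology (Euclidean_space n) V) euclideanreal f \<and>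
     (\<forall>i<n. \<exists>f'. (\<forall>z\<in>V. ((\<lambda>t. f (z(i := t))) has_real_derivative f' z) (at (z i))) \<and> C_k n k V f')"

definition closed_smooth_manifold ::
    "nat \<Rightarrow> 'm topology \<Rightarrow> ('m set \<times> ('m \<Rightarrow> nat \<Rightarrow> real)) set \<Rightarrow> bool" where
  "closed_smooth_manifold n M \<A> \<longleftrightarrow>
     compact_space M \<and> Hausdorff_space M \<and> second_countable M \<and>
     (\<Union>(V, \<phi>)\<in>\<A>. V) = topspace M \<and>
     (\<forall>(V, \<phi>)\<in>\<A>. openin M V \<and> openin (Euclidean_space n) (\<phi> ` V) \<and>
        homeomorphic_map (subtopology M V) (subtopology (Euclidean_space n) (\<phi> ` V)) \<phi>) \<and>
     (\<forall>(V, \<phi>)\<in>\<A>. \<forall>(V', \<phi>')\<in>\<A>. \<forall>k. \<forall>l<n.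
        C_k n k (\<phi> ` (V \<inter> V')) (\<lambda>z. \<phi>' (the_inv_into V \<phi> z) l))"


section \<open>Cech cohomology\<close>

text \<open>A cover consists of the sets \<open>U i\<close> for \<open>i < N\<close>. A \<open>p\<close>-cochain assigns to every list of
  \<open>p + 1\<close> indices a function whose values off the intersection are irrelevant.\<close>

definition finite_open_cover :: "'m topology \<Rightarrow> nat \<Rightarrow> (nat \<Rightarrow> 'm set) \<Rightarrow> bool" where
  "finite_open_cover M N U \<longleftrightarrow> (\<forall>i<N. openin M (U i)) \<and> (\<Union>i<N. U i) = topspace M"

definition good_cover :: "'m topology \<Rightarrow> nat \<Rightarrow> (nat \<Rightarrow> 'm set) \<Rightarrow> bool" where
  "good_cover M N U \<longleftrightarrow> finite_open_cover M N U \<and>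
     (\<forall>I. I \<subseteq> {..<N} \<longrightarrow> I \<noteq> {} \<longrightarrow> (\<Inter>i\<in>I. U i) \<noteq> {} \<longrightarrow>
        contractible_space (subtopology M (\<Inter>i\<in>I. U i)))"

definition simplices :: "nat \<Rightarrow> nat \<Rightarrow> nat list set" where
  "simplices N p = {s. length s = Suc p \<and> set s \<subseteq> {..<N}}"

definition cap :: "(nat \<Rightarrow> 'm set) \<Rightarrow> nat list \<Rightarrow> 'm set" where
  "cap U s = (\<Inter>i\<in>set s. U i)"

definition remove_nth :: "nat \<Rightarrow> 'a list \<Rightarrow> 'a list" where
  "remove_nth k xs = take k xs @ drop (Suc k) xs"

type_synonym ('m, 'a) cochain = "nat list \<Rightarrow> 'm \<Rightarrow> 'a"

definition cech_d :: "('m, 'a::comm_ring_1) cochain \<Rightarrow> ('m, 'a) cochain" where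
  "cech_d c s x = (\<Sum>k<length s. (- 1) ^ k * c (remove_nth k s) x)"

definition cech_d_mult :: "('m, complex) cochain \<Rightarrow> ('m, complex) cochain" where
  "cech_d_mult g s x = (\<Prod>k<length s.
     if even k then g (remove_nth k s) x else inverse (g (remove_nth k s) x))"

definition S1_cochain ::
    "'m topology \<Rightarrow> nat \<Rightarrow> (nat \<Rightarrow> 'm set) \<Rightarrow> nat \<Rightarrow> ('m, complex) cochain \<Rightarrow> bool" where
  "S1_cochain M N U p g \<longleftrightarrow> (\<forall>s\<in>simplices N p.
     continuous_map (subtopology M (cap U s)) euclidean (g s) \<and> (\<forall>x\<in>cap U s. cmod (g s x) = 1))"

definition S1_cocycle ::
    "'m topology \<Rightarrow> nat \<Rightarrow> (nat \<Rightarrow> 'm set) \<Rightarrow> nat \<Rightarrow> ('m, complex) cochain \<Rightarrow> bool" where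
  "S1_cocycle M N U p g \<longleftrightarrow> S1_cochain M N U p g \<and>
     (\<forall>s\<in>simplices N (Suc p). \<forall>x\<in>cap U s. cech_d_mult g s x = 1)"

text \<open>The class of \<open>g\<close> in \<open>H\<^sup>p\<^sup>+\<^sup>1({U\<^sub>i}, S\<^sup>1)\<close>.\<close>

definition S1_class ::
    "'m topology \<Rightarrow> nat \<Rightarrow> (nat \<Rightarrow> 'm set) \<Rightarrow> nat \<Rightarrow> ('m, complex) cochain \<Rightarrow>
     ('m, complex) cochain set" where
  "S1_class M N U p g = {g'. S1_cocycle M N U (Suc p) g' \<and>
     (\<exists>u. S1_cochain M N U p u \<and>
        (\<forall>s\<in>simplices N (Suc p). \<forall>x\<in>cap U s. g' s x = g s x * cech_d_mult u s x))}"

definition real_cochain ::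
    "'m topology \<Rightarrow> nat \<Rightarrow> (nat \<Rightarrow> 'm set) \<Rightarrow> nat \<Rightarrow> ('m, real) cochain \<Rightarrow> bool" where
  "real_cochain M N U p f \<longleftrightarrow>
     (\<forall>s\<in>simplices N p. continuous_map (subtopology M (cap U s)) euclideanreal (f s))"

definition int_cochain ::
    "'m topology \<Rightarrow> nat \<Rightarrow> (nat \<Rightarrow> 'm set) \<Rightarrow> nat \<Rightarrow> ('m, int) cochain \<Rightarrow> bool" where
  "int_cochain M N U p c \<longleftrightarrow> (\<forall>s\<in>simplices N p.
     continuous_map (subtopology M (cap U s)) (discrete_topology UNIV) (c s))"

definition int_cocycle ::
    "'m topology \<Rightarrow> nat \<Rightarrow> (nat \<Rightarrow> 'm set) \<Rightarrow> nat \<Rightarrow> ('m, int) cochain \<Rightarrow> bool" where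
  "int_cocycle M N U p c \<longleftrightarrow> int_cochain M N U p c \<and>
     (\<forall>s\<in>simplices N (Suc p). \<forall>x\<in>cap U s. cech_d c s x = 0)"

text \<open>\<open>H\<^sup>p(M, \<int>)\<close> is the direct limit of the cohomology groups of the open covers of \<open>M\<close>. As \<open>M\<close> is
  compact, the finite covers are cofinal and suffice. An element is an equivalence class of
  triples (number of sets, cover, cocycle), two triples being equivalent if they become
  cohomologous on a common refinement.\<close>

type_synonym 'm cech_datum = "nat \<times> (nat \<Rightarrow> 'm set) \<times> ('m, int) cochain"

definition refines ::
    "nat \<Rightarrow> (nat \<Rightarrow> 'm set) \<Rightarrow> nat \<Rightarrow> (nat \<Rightarrow> 'm set) \<Rightarrow> (nat \<Rightarrow> nat) \<Rightarrow> bool" where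
  "refines N' V N U r \<longleftrightarrow> (\<forall>i<N'. r i < N \<and> V i \<subseteq> U (r i))"

fun cech_equiv :: "'m topology \<Rightarrow> nat \<Rightarrow> 'm cech_datum \<Rightarrow> 'm cech_datum \<Rightarrow> bool" where
  "cech_equiv M p (N, U, c) (N', U', c') \<longleftrightarrow>
     (\<exists>K V r r' b. finite_open_cover M K V \<and> refines K V N U r \<and> refines K V N' U' r' \<and>
        int_cochain M K V p b \<and>
        (\<forall>s\<in>simplices K (Suc p). \<forall>x\<in>cap V s.
           c (map r s) x - c' (map r' s) x = cech_d b s x))"

definition integral_class ::
    "'m topology \<Rightarrow> nat \<Rightarrow> 'm cech_datum \<Rightarrow> 'm cech_datum set" where
  "integral_class M p d = {(N', U', c').
     finite_open_cover M N' U' \<and> int_cocycle M N' U' (Suc p) c' \<and>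
     cech_equiv M p d (N', U', c')}"

text \<open>The connecting map \<open>H\<^sup>2({U\<^sub>i}, S\<^sup>1) \<rightarrow> H\<^sup>3(M, \<int>)\<close> of the exponential sequence: lift a
  representative to a real cochain and take its coboundary. On a good cover lifts exist and the
  result depends on the class only.\<close>

definition connecting_map ::
    "'m topology \<Rightarrow> nat \<Rightarrow> (nat \<Rightarrow> 'm set) \<Rightarrow> ('m, complex) cochain set \<Rightarrow> 'm cech_datum set" where
  "connecting_map M N U \<alpha> = (THE \<beta>. \<exists>g\<in>\<alpha>. \<exists>f c.
     real_cochain M N U 2 f \<and>
     (\<forall>s\<in>simplices N 2. \<forall>x\<in>cap U s. g s x = exp (2 * of_real pi * \<i> * of_real (f s x))) \<and>
     int_cocycle M N U 3 c \<and>
     (\<forall>s\<in>simplices N 3. \<forall>x\<in>cap U s. of_int (c s x) = cech_d f s x) \<and>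
     \<beta> = integral_class M 2 (N, U, c))"


section \<open>Antisymmetric Fock spaces\<close>

text \<open>For a Hilbert space \<open>K\<close>, the \<open>n\<close>-particle space \<open>\<Lambda>\<^sup>n K\<close> is realised as the space of
  Hilbert-Schmidt alternating forms of degree \<open>n\<close> on \<open>K\<close>, antilinear in each argument: a vector
  \<open>\<phi>\<close> is the form \<open>(g\<^sub>1, \<dots>, g\<^sub>n) \<mapsto> \<langle>g\<^sub>1 \<and> \<dots> \<and> g\<^sub>n, \<phi>\<rangle>\<close>, so that \<open>f\<^sub>1 \<and> \<dots> \<and> f\<^sub>n\<close> is the form
  \<open>det \<langle>g\<^sub>i, f\<^sub>j\<rangle>\<close>. An element of \<open>\<F>(K)\<close> is a function on lists, its restriction to the lists of
  length \<open>n\<close> being the component in \<open>\<Lambda>\<^sup>n K\<close>. The space \<open>K\<close> is given as the range of an orthogonal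
  projection \<open>Q\<close>, and forms on \<open>K\<close> are extended to the whole space along \<open>Q\<close>, which realises the
  inclusion of the Fock space of \<open>K\<close> into that of the whole space. The parameter \<open>sm\<close> is the
  scalar multiplication of \<open>K\<close>: \<open>scaleC\<close>, or \<open>scaleC_bar\<close> for the conjugate space.\<close>

type_synonym 'h form = "'h list \<Rightarrow> complex"

definition alt_form :: "(complex \<Rightarrow> 'h \<Rightarrow> 'h) \<Rightarrow> ('h \<Rightarrow> 'h) \<Rightarrow> 'h::complex_inner form \<Rightarrow> bool" where
  "alt_form sm Q \<phi> \<longleftrightarrow>
     (\<forall>gs. \<phi> gs = \<phi> (map Q gs)) \<and>
     (\<forall>as bs g g'. \<phi> (as @ (g + g') # bs) = \<phi> (as @ g # bs) + \<phi> (as @ g' # bs)) \<and>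
     (\<forall>as bs g z. \<phi> (as @ sm z g # bs) = cnj z * \<phi> (as @ g # bs)) \<and>
     (\<forall>as bs cs g. \<phi> (as @ g # bs @ g # cs) = 0)"

definition distinct_lists :: "'a set \<Rightarrow> 'a list set" where
  "distinct_lists E = {gs. distinct gs \<and> set gs \<subseteq> E}"

text \<open>Every subset of \<open>E\<close> with \<open>n\<close> elements occurs as \<open>n!\<close> distinct lists, so for a complete
  orthonormal \<open>E\<close> this is the sum of the squared coefficients with respect to the orthonormal basis
  \<open>e\<^sub>1 \<and> \<dots> \<and> e\<^sub>n\<close>. The Hilbert-Schmidt norm is the supremum over all finite orthonormal \<open>E\<close>.\<close>

definition fock_sum :: "'h form \<Rightarrow> 'h set \<Rightarrow> real" where
  "fock_sum \<phi> E = (\<Sum>gs\<in>distinct_lists E. (cmod (\<phi> gs))\<^sup>2 / fact (length gs))"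

definition fock_norm :: "'h::complex_inner form \<Rightarrow> real" where
  "fock_norm \<phi> = sqrt (SUP E\<in>{E. finite E \<and> orthonormal E}. fock_sum \<phi> E)"

definition fock_space :: "(complex \<Rightarrow> 'h \<Rightarrow> 'h) \<Rightarrow> ('h \<Rightarrow> 'h) \<Rightarrow> 'h::complex_inner form set" where
  "fock_space sm Q =
     {\<phi>. alt_form sm Q \<phi> \<and> bdd_above (fock_sum \<phi> ` {E. finite E \<and> orthonormal E})}"

definition vacuum :: "'h form" where
  "vacuum gs = (if gs = [] then 1 else 0)"

definition wedge :: "'h form \<Rightarrow> 'h form \<Rightarrow> 'h form" where
  "wedge \<phi> \<eta> gs = (\<Sum>I\<in>Pow {..<length gs}.
     (- 1) ^ card {(p, q). p < q \<and> q < length gs \<and> p \<notin> I \<and> q \<in> I} *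
     \<phi> (nths gs I) * \<eta> (nths gs (- I)))"

text \<open>Creation and annihilation operators; \<open>ip\<close> is the inner product of \<open>K\<close>: \<open>cinner\<close>, or
  \<open>cinner_bar\<close> for the conjugate space.\<close>

definition creation :: "('h \<Rightarrow> 'h \<Rightarrow> complex) \<Rightarrow> 'h \<Rightarrow> 'h form \<Rightarrow> 'h form" where
  "creation ip f \<phi> gs = (\<Sum>k<length gs. (- 1) ^ k * ip (gs ! k) f * \<phi> (remove_nth k gs))"

definition annihilation :: "'h \<Rightarrow> 'h form \<Rightarrow> 'h form" where
  "annihilation f \<phi> gs = \<phi> (f # gs)"

text \<open>The top exterior power of the finite-dimensional space \<open>range Q\<close>.\<close>

definition top_power :: "('h \<Rightarrow> 'h) \<Rightarrow> 'h::complex_inner form set" where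
  "top_power Q = {\<phi> \<in> fock_space scaleC Q.
     \<exists>n. has_cdim (range Q) n \<and> (\<forall>gs. length gs \<noteq> n \<longrightarrow> \<phi> gs = 0)}"

definition fock_continuous ::
    "'m topology \<Rightarrow> 'm set \<Rightarrow> ('m \<Rightarrow> 'h::complex_inner form) \<Rightarrow> bool" where
  "fock_continuous M A w \<longleftrightarrow> (\<forall>x\<in>A. \<forall>e>0. \<exists>V. openin M V \<and> x \<in> V \<and>
     (\<forall>y\<in>V \<inter> A. fock_norm (\<lambda>gs. w y gs - w x gs) < e))"


section \<open>Quasi-free representations\<close>

text \<open>The Hilbert tensor product \<open>\<F>(P H) \<otimes> \<F>(conjugate of (1 - P) H)\<close> is realised as the space of
  Hilbert-Schmidt functions of two lists which in each list are forms as above.\<close>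

type_synonym 'h biform = "'h list \<Rightarrow> 'h list \<Rightarrow> complex"

definition fock2_sum :: "'h biform \<Rightarrow> 'h set \<Rightarrow> real" where
  "fock2_sum \<psi> E = (\<Sum>gs\<in>distinct_lists E. \<Sum>hs\<in>distinct_lists E.
     (cmod (\<psi> gs hs))\<^sup>2 / (fact (length gs) * fact (length hs)))"

definition fock2_norm :: "'h::complex_inner biform \<Rightarrow> real" where
  "fock2_norm \<psi> = sqrt (SUP E\<in>{E. finite E \<and> orthonormal E}. fock2_sum \<psi> E)"

definition fock2 :: "('h \<Rightarrow> 'h) \<Rightarrow> 'h::complex_inner biform set" where
  "fock2 P = {\<psi>. (\<forall>hs. alt_form scaleC P (\<lambda>gs. \<psi> gs hs)) \<and>
     (\<forall>gs. alt_form scaleC_bar (\<lambda>h. h - P h) (\<psi> gs)) \<and>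
     bdd_above (fock2_sum \<psi> ` {E. finite E \<and> orthonormal E})}"

definition tensor :: "'h form \<Rightarrow> 'h form \<Rightarrow> 'h biform" where
  "tensor \<phi> \<eta> gs hs = \<phi> gs * \<eta> hs"

text \<open>\<open>A \<otimes> 1\<close>, \<open>1 \<otimes> B\<close> and \<open>(-1)\<^sup>d\<^sup>e\<^sup>g \<otimes> 1\<close>.\<close>

definition on_left :: "('h form \<Rightarrow> 'h form) \<Rightarrow> 'h biform \<Rightarrow> 'h biform" where
  "on_left A \<psi> gs hs = A (\<lambda>gs'. \<psi> gs' hs) gs"

definition on_right :: "('h form \<Rightarrow> 'h form) \<Rightarrow> 'h biform \<Rightarrow> 'h biform" where
  "on_right B \<psi> gs = B (\<psi> gs)"

definition parity :: "'h biform \<Rightarrow> 'h biform" where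
  "parity \<psi> gs hs = (- 1) ^ length gs * \<psi> gs hs"

text \<open>The images of the creation generator of \<open>f\<close> and of its adjoint, which together generate
  \<open>CAR(H)\<close>; intertwiners are therefore characterised by commuting with these.\<close>

definition qf_creation ::
    "('h \<Rightarrow> 'h) \<Rightarrow> 'h \<Rightarrow> 'h::complex_inner biform \<Rightarrow> 'h biform" where
  "qf_creation P f \<psi> gs hs =
     on_left (creation cinner (P f)) \<psi> gs hs +
     parity (on_right (annihilation (f - P f)) \<psi>) gs hs"

definition qf_annihilation ::
    "('h \<Rightarrow> 'h) \<Rightarrow> 'h \<Rightarrow> 'h::complex_inner biform \<Rightarrow> 'h biform" where
  "qf_annihilation P f \<psi> gs hs =
     on_left (annihilation (P f)) \<psi> gs hs +
     parity (on_right (creation cinner_bar (f - P f)) \<psi>) gs hs"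

definition fock2_unitary ::
    "('h \<Rightarrow> 'h) \<Rightarrow> ('h \<Rightarrow> 'h) \<Rightarrow> ('h::complex_inner biform \<Rightarrow> 'h biform) \<Rightarrow> bool" where
  "fock2_unitary P Q T \<longleftrightarrow> bij_betw T (fock2 P) (fock2 Q) \<and>
     (\<forall>\<psi>\<in>fock2 P. \<forall>\<eta>\<in>fock2 P. \<forall>a b.
        T (\<lambda>gs hs. a * \<psi> gs hs + b * \<eta> gs hs) = (\<lambda>gs hs. a * T \<psi> gs hs + b * T \<eta> gs hs)) \<and>
     (\<forall>\<psi>\<in>fock2 P. fock2_norm (T \<psi>) = fock2_norm \<psi>)"

definition intertwines ::
    "('h \<Rightarrow> 'h) \<Rightarrow> ('h \<Rightarrow> 'h) \<Rightarrow> ('h::complex_inner biform \<Rightarrow> 'h biform) \<Rightarrow> bool" where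
  "intertwines P Q T \<longleftrightarrow> (\<forall>f. \<forall>\<psi>\<in>fock2 P.
     T (qf_creation P f \<psi>) = qf_creation Q f (T \<psi>) \<and>
     T (qf_annihilation P f \<psi>) = qf_annihilation Q f (T \<psi>))"

text \<open>Extensionality pins down the irrelevant values off \<open>fock2 P\<close>, as required for uniqueness.\<close>

definition vacuum_intertwiner ::
    "('h \<Rightarrow> 'h) \<Rightarrow> ('h \<Rightarrow> 'h) \<Rightarrow> 'h::complex_inner form \<Rightarrow> 'h biform \<Rightarrow> 'h biform" where
  "vacuum_intertwiner P Q w = (THE T. T \<in> extensional (fock2 P) \<and>
     fock2_unitary P Q T \<and> intertwines P Q T \<and> T (tensor w vacuum) = tensor vacuum vacuum)"


section \<open>The gerbe of the quasi-free representations\<close>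

text \<open>The order \<open>\<prec>\<close> on the indices.\<close>

definition prec :: "(nat \<Rightarrow> real) \<Rightarrow> nat \<Rightarrow> nat \<Rightarrow> bool" where
  "prec lam i j \<longleftrightarrow> lam i < lam j \<or> lam i = lam j \<and> i < j"

definition gap_power ::
    "('m \<Rightarrow> 'h::complex_inner unb_op) \<Rightarrow> (nat \<Rightarrow> real) \<Rightarrow> nat \<Rightarrow> nat \<Rightarrow> 'm \<Rightarrow> 'h form set" where
  "gap_power D lam i j x =
     top_power (\<lambda>v. spectral_proj (D x) (lam i) v - spectral_proj (D x) (lam j) v)"

definition volume_elements ::
    "'m topology \<Rightarrow> nat \<Rightarrow> (nat \<Rightarrow> 'm set) \<Rightarrow> ('m \<Rightarrow> 'h::complex_inner unb_op) \<Rightarrow> (nat \<Rightarrow> real) \<Rightarrow>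
     (nat \<Rightarrow> nat \<Rightarrow> 'm \<Rightarrow> 'h form) \<Rightarrow> bool" where
  "volume_elements M N U D lam \<omega> \<longleftrightarrow> (\<forall>i<N. \<forall>j<N. prec lam i j \<longrightarrow>
     (\<forall>x\<in>U i \<inter> U j. \<omega> i j x \<in> gap_power D lam i j x \<and> fock_norm (\<omega> i j x) = 1) \<and>
     fock_continuous M (U i \<inter> U j) (\<omega> i j))"

text \<open>\<open>qf_S D lam \<omega> j i x\<close> is the operator \<open>S\<^sub>j\<^sub>i(x)\<close> from the Fock space of \<open>P\<^sub>i(x)\<close> to that of
  \<open>P\<^sub>j(x)\<close>.\<close>

definition qf_S ::
    "('m \<Rightarrow> 'h::complex_inner unb_op) \<Rightarrow> (nat \<Rightarrow> real) \<Rightarrow> (nat \<Rightarrow> nat \<Rightarrow> 'm \<Rightarrow> 'h form) \<Rightarrow>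
     nat \<Rightarrow> nat \<Rightarrow> 'm \<Rightarrow> 'h biform \<Rightarrow> 'h biform" where
  "qf_S D lam \<omega> j i x =
     (let P = (\<lambda>k. spectral_proj (D x) (lam k));
          T = (\<lambda>a b. vacuum_intertwiner (P a) (P b) (\<omega> a b x))
      in if prec lam i j then T i j
         else if prec lam j i then the_inv_into (fock2 (P j)) (T j i)
         else id)"

definition qf_cochain ::
    "('m \<Rightarrow> 'h::complex_inner unb_op) \<Rightarrow> (nat \<Rightarrow> real) \<Rightarrow> (nat \<Rightarrow> nat \<Rightarrow> 'm \<Rightarrow> 'h form) \<Rightarrow>
     ('m, complex) cochain" where
  "qf_cochain D lam \<omega> s x =
     (let i = s ! 0; j = s ! 1; k = s ! 2 in
      THE z. \<forall>\<psi>\<in>fock2 (spectral_proj (D x) (lam j)).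
        qf_S D lam \<omega> j i x (qf_S D lam \<omega> i k x (qf_S D lam \<omega> k j x \<psi>)) =
        (\<lambda>gs hs. z * \<psi> gs hs))"

definition quasifree_gerbe ::
    "'m topology \<Rightarrow> nat \<Rightarrow> (nat \<Rightarrow> 'm set) \<Rightarrow> ('m \<Rightarrow> 'h::complex_inner unb_op) \<Rightarrow> (nat \<Rightarrow> real) \<Rightarrow>
     (nat \<Rightarrow> nat \<Rightarrow> 'm \<Rightarrow> 'h form) \<Rightarrow> 'm cech_datum set" where
  "quasifree_gerbe M N U D lam \<omega> =
     connecting_map M N U (S1_class M N U 1 (qf_cochain D lam \<omega>))"


section \<open>The index gerbe\<close>

text \<open>Elements of the fibres of the line bundles: scalars for the trivial bundles \<open>\<L>\<^sub>i\<^sub>i\<close>, elements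
  of a top exterior power, or linear functionals on a top exterior power.\<close>

datatype 'v line_elt = Scal complex | Vec 'v | Covec "'v \<Rightarrow> complex"

definition dual_space :: "'h form set \<Rightarrow> ('h form \<Rightarrow> complex) set" where
  "dual_space L = {\<phi> \<in> extensional L. \<forall>v\<in>L. \<forall>w\<in>L. \<forall>a b.
     \<phi> (\<lambda>gs. a * v gs + b * w gs) = a * \<phi> v + b * \<phi> w}"

definition index_line ::
    "('m \<Rightarrow> 'h::complex_inner unb_op) \<Rightarrow> (nat \<Rightarrow> real) \<Rightarrow> nat \<Rightarrow> nat \<Rightarrow> 'm \<Rightarrow> 'h form line_elt set" where
  "index_line D lam i j x =
     (if prec lam i j then Covec ` dual_space (gap_power D lam i j x)
      else if prec lam j i then Vec ` gap_power D lam j i x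
      else range Scal)"

text \<open>The duality between \<open>\<L>\<^sub>i\<^sub>j\<close> and \<open>\<L>\<^sub>j\<^sub>i\<close>.\<close>

fun pair :: "'v line_elt \<Rightarrow> 'v line_elt \<Rightarrow> complex" where
  "pair (Scal a) (Scal b) = a * b"
| "pair (Vec v) (Covec \<phi>) = \<phi> v"
| "pair (Covec \<phi>) (Vec v) = \<phi> v"
| "pair _ _ = 0"

fun scalar_of :: "'v line_elt \<Rightarrow> complex" where
  "scalar_of (Scal a) = a"
| "scalar_of _ = 0"

text \<open>Elements of \<open>\<L>\<^sub>i\<^sub>j \<otimes> \<L>\<^sub>j\<^sub>k \<otimes> \<L>\<^sub>k\<^sub>i\<close> are the trilinear functionals of \<open>(p, q, r)\<close> in the product of
  the dual lines \<open>\<L>\<^sub>j\<^sub>i\<close>, \<open>\<L>\<^sub>k\<^sub>j\<close>, \<open>\<L>\<^sub>i\<^sub>k\<close>.\<close>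

type_synonym 'v trilinear = "'v line_elt \<Rightarrow> 'v line_elt \<Rightarrow> 'v line_elt \<Rightarrow> complex"

definition tensor3 :: "'v line_elt \<Rightarrow> 'v line_elt \<Rightarrow> 'v line_elt \<Rightarrow> 'v trilinear" where
  "tensor3 s t u p q r = pair s p * pair t q * pair u r"

text \<open>For \<open>a \<prec> b \<prec> c\<close>, the element of \<open>\<L>\<^sub>a\<^sub>b \<otimes> \<L>\<^sub>b\<^sub>c \<otimes> \<L>\<^sub>c\<^sub>a\<close> given by exterior multiplication
  \<open>\<Lambda> W\<^sub>b\<^sub>c \<otimes> \<Lambda> W\<^sub>a\<^sub>b \<rightarrow> \<Lambda> W\<^sub>a\<^sub>c\<close>: here \<open>e \<in> \<Lambda> W\<^sub>a\<^sub>b\<close>, \<open>f \<in> \<Lambda> W\<^sub>b\<^sub>c\<close> and \<open>\<phi>\<close> is a functional on \<open>\<Lambda> W\<^sub>a\<^sub>c\<close>.\<close>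

fun theta_up :: "'h form trilinear" where
  "theta_up (Vec e) (Vec f) (Covec \<phi>) = \<phi> (wedge f e)"
| "theta_up _ _ _ = 0"

text \<open>The inverse isomorphism \<open>\<Lambda> W\<^sub>a\<^sub>c \<rightarrow> \<Lambda> W\<^sub>b\<^sub>c \<otimes> \<Lambda> W\<^sub>a\<^sub>b\<close>, evaluated on \<open>v \<in> \<Lambda> W\<^sub>a\<^sub>c\<close> and on functionals
  \<open>\<beta>\<close> on \<open>Lbc = \<Lambda> W\<^sub>b\<^sub>c\<close> and \<open>\<alpha>\<close> on \<open>Lab = \<Lambda> W\<^sub>a\<^sub>b\<close>.\<close>

fun theta_down :: "'h form set \<Rightarrow> 'h form set \<Rightarrow> 'h form trilinear" where
  "theta_down Lab Lbc (Vec v) (Covec \<beta>) (Covec \<alpha>) =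
     (THE z. \<exists>e\<in>Lab. \<exists>f\<in>Lbc. v = wedge f e \<and> z = \<beta> f * \<alpha> e)"
| "theta_down _ _ _ _ _ = 0"

text \<open>The section \<open>\<theta>\<^sub>i\<^sub>j\<^sub>k\<close>. Permuting the indices permutes the tensor factors, an odd permutation
  moreover replaces all factors by their duals and the section by its inverse. If two indices
  agree, the section is given by the duality pairing.\<close>

definition theta ::
    "('m \<Rightarrow> 'h::complex_inner unb_op) \<Rightarrow> (nat \<Rightarrow> real) \<Rightarrow> nat \<Rightarrow> nat \<Rightarrow> nat \<Rightarrow> 'm \<Rightarrow>
     'h form trilinear" where
  "theta D lam i j k x p q r =
     (let L = (\<lambda>a b. gap_power D lam a b x); lt = prec lam in
      if i = j then scalar_of p * pair q r
      else if j = k then scalar_of q * pair p r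
      else if k = i then scalar_of r * pair p q
      else if lt i j \<and> lt j k then theta_up p q r
      else if lt j k \<and> lt k i then theta_up q r p
      else if lt k i \<and> lt i j then theta_up r p q
      else if lt k j \<and> lt j i then theta_down (L k j) (L j i) r p q
      else if lt i k \<and> lt k j then theta_down (L i k) (L k j) p q r
      else theta_down (L j i) (L i k) q r p)"

text \<open>Continuity of \<open>s\<^sub>i\<^sub>j\<close> for \<open>i \<prec> j\<close> follows from that of the dual section \<open>s\<^sub>j\<^sub>i\<close>, and similarly for
  its norm.\<close>

definition unit_sections ::
    "'m topology \<Rightarrow> nat \<Rightarrow> (nat \<Rightarrow> 'm set) \<Rightarrow> ('m \<Rightarrow> 'h::complex_inner unb_op) \<Rightarrow> (nat \<Rightarrow> real) \<Rightarrow>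
     (nat \<Rightarrow> nat \<Rightarrow> 'm \<Rightarrow> 'h form line_elt) \<Rightarrow> bool" where
  "unit_sections M N U D lam s \<longleftrightarrow>
     (\<forall>i<N. \<forall>j<N. \<forall>x\<in>U i \<inter> U j.
        s i j x \<in> index_line D lam i j x \<and> pair (s i j x) (s j i x) = 1) \<and>
     (\<forall>i<N. \<forall>j<N. prec lam i j \<longrightarrow>
        (\<exists>v. (\<forall>x\<in>U i \<inter> U j. s j i x = Vec (v x) \<and> fock_norm (v x) = 1) \<and>
             fock_continuous M (U i \<inter> U j) v)) \<and>
     (\<forall>i<N. continuous_map (subtopology M (U i)) euclidean (\<lambda>x. scalar_of (s i i x)) \<and>
        (\<forall>x\<in>U i. cmod (scalar_of (s i i x)) = 1))"

definition index_cochain ::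
    "('m \<Rightarrow> 'h::complex_inner unb_op) \<Rightarrow> (nat \<Rightarrow> real) \<Rightarrow>
     (nat \<Rightarrow> nat \<Rightarrow> 'm \<Rightarrow> 'h form line_elt) \<Rightarrow> ('m, complex) cochain" where
  "index_cochain D lam s t x =
     (let i = t ! 0; j = t ! 1; k = t ! 2 in
      THE z. \<forall>p\<in>index_line D lam j i x. \<forall>q\<in>index_line D lam k j x. \<forall>r\<in>index_line D lam i k x.
        tensor3 (s i j x) (s j k x) (s k i x) p q r = z * theta D lam i j k x p q r)"

definition dixmier_douady ::
    "'m topology \<Rightarrow> nat \<Rightarrow> (nat \<Rightarrow> 'm set) \<Rightarrow> ('m \<Rightarrow> 'h::complex_inner unb_op) \<Rightarrow> (nat \<Rightarrow> real) \<Rightarrow>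
     (nat \<Rightarrow> nat \<Rightarrow> 'm \<Rightarrow> 'h form line_elt) \<Rightarrow> 'm cech_datum set" where
  "dixmier_douady M N U D lam s =
     connecting_map M N U (S1_class M N U 1 (index_cochain D lam s))"

end

theory Submission
  imports Defs
begin

text \<open>Both cocycles compare unit elements of the lines \<open>\<Lambda> W\<^sub>i\<^sub>j\<close>. An intertwiner is determined up to a scalar by
  irreducibility, and \<open>S\<^sub>j\<^sub>i\<close> maps \<open>f\<^sub>1 \<and> \<dots> \<and> f\<^sub>n \<and> \<omega>\<^sub>i\<^sub>j\<close> to \<open>f\<^sub>1 \<and> \<dots> \<and> f\<^sub>n\<close> when the \<open>f\<^sub>k\<close> lie in the range of \<open>P\<^sub>j\<close>,
  because it intertwines the creation operators. Hence for \<open>i \<prec> j \<prec> k\<close> the value of \<open>g\<close> is the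
  constant in \<open>\<omega>\<^sub>i\<^sub>k = g \<omega>\<^sub>j\<^sub>k \<and> \<omega>\<^sub>i\<^sub>j\<close>, while \<open>h\<close> is the same constant for the sections \<open>s\<close>. The unit
  elements \<open>\<omega>\<^sub>i\<^sub>j\<close> and \<open>s\<^sub>j\<^sub>i\<close> differ by a continuous unitary function, and these functions form a
  \<open>1\<close>-cochain whose coboundary is \<open>g / h\<close>. The intertwiner itself is built by moving
  the vectors of a basis of \<open>W\<^sub>i\<^sub>j\<close> one at a time from the particles to the antiparticles.\<close>


section \<open>Complex inner product spaces\<close>

text \<open>The Fock spaces carry a norm, the supremum of finite sums over orthonormal sets, but
  neither an inner product nor a basis. Two devices take their place. The finite sums only grow with
  the span of the orthonormal set, so every estimate may be made on sets containing a prescribed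
  unit vector \<open>e\<close>, where a form splits into an \<open>e\<close>-occupied and an
  \<open>e\<close>-free part. And the norm of \<psi> + t \<Omega> for varying t reveals the
  component of \<psi> along the vacuum \<Omega>, so a norm-preserving linear map that keeps the
  vacuum line multiplies vacuum components by a phase; this is how unitarity enters irreducibility.
  Triples with repeated indices need care. There \<open>g\<close> is 1, while \<open>h\<close> is a
  diagonal section \<open>s i i\<close>, which self-duality forces to be a sign. The gauge cochain
  must carry this sign on its diagonal. The comparison takes place entirely among circle-valued
  classes; both invariants are then images of one class under the same connecting map.\<close>

lemma scaleC_zero_left [simp]: "0 *c (x::'h::complex_inner) = 0"
  using scaleC_add_left[of 0 0 x] by simp

lemma scaleC_zero_right [simp]: "a *c (0::'h::complex_inner) = 0"
  using scaleC_add_right[of a 0 "0::'h"] by simp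

lemma scaleC_one [simp]: "1 *c (x::'h::complex_inner) = x"
  using scaleR_scaleC[of 1 x] by simp

lemma scaleC_minus_right: "a *c (- (x::'h::complex_inner)) = - (a *c x)"
  using scaleC_add_right[of a x "- x"] by (simp add: eq_neg_iff_add_eq_0 add.commute)

lemma scaleC_diff_right: "a *c ((x::'h::complex_inner) - y) = a *c x - a *c y"
  using scaleC_add_right[of a x "- y"] by (simp add: scaleC_minus_right)

lemma scaleC_minus_left: "(- a) *c (x::'h::complex_inner) = - (a *c x)"
  using scaleC_add_left[of a "- a" x] by (simp add: eq_neg_iff_add_eq_0 add.commute)

lemma scaleC_sum_right: "a *c (\<Sum>i\<in>I. f i) = (\<Sum>i\<in>I. a *c (f i :: 'h::complex_inner))"
  by (induction I rule: infinite_finite_induct) (auto simp: scaleC_add_right)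

lemma cinner_add_left: "cinner (x + y) (z::'h::complex_inner) = cinner x z + cinner y z"
  by (metis cinner_add_right cinner_commute complex_cnj_add)

lemma cinner_scaleC_left: "cinner (a *c x) (y::'h::complex_inner) = cnj a * cinner x y"
  by (metis cinner_scaleC_right cinner_commute complex_cnj_mult)

lemma cinner_zero_right [simp]: "cinner x (0::'h::complex_inner) = 0"
  using cinner_add_right[of x 0 0] by simp

lemma cinner_zero_left [simp]: "cinner (0::'h::complex_inner) x = 0"
  using cinner_add_left[of 0 0 x] by simp

lemma cinner_minus_right: "cinner x (- (y::'h::complex_inner)) = - cinner x y"
  using cinner_add_right[of x y "- y"] by (simp add: eq_neg_iff_add_eq_0 add.commute)

lemma cinner_diff_right: "cinner x ((y::'h::complex_inner) - z) = cinner x y - cinner x z"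
  using cinner_add_right[of x y "- z"] by (simp add: cinner_minus_right)

lemma cinner_minus_left: "cinner (- (y::'h::complex_inner)) x = - cinner y x"
  using cinner_add_left[of y "- y" x] by (simp add: eq_neg_iff_add_eq_0 add.commute)

lemma cinner_diff_left: "cinner ((y::'h::complex_inner) - z) x = cinner y x - cinner z x"
  using cinner_add_left[of y "- z" x] by (simp add: cinner_minus_left)

lemma cinner_sum_right: "cinner x (\<Sum>i\<in>I. f i) = (\<Sum>i\<in>I. cinner x (f i :: 'h::complex_inner))"
  by (induction I rule: infinite_finite_induct) (auto simp: cinner_add_right)

lemma cinner_sum_left: "cinner (\<Sum>i\<in>I. f i) x = (\<Sum>i\<in>I. cinner (f i :: 'h::complex_inner) x)"
  by (induction I rule: infinite_finite_induct) (auto simp: cinner_add_left)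

lemma cinner_self: "cinner x (x::'h::complex_inner) = of_real ((norm x)\<^sup>2)"
proof -
  have "Im (cinner x x) = 0"
    using arg_cong[OF cinner_commute[of x x], of Im] by simp
  then show ?thesis
    by (simp add: complex_eq_iff inner_eq_Re_cinner[symmetric] power2_norm_eq_inner)
qed

lemma cinner_self_eq_0_iff: "cinner x x = 0 \<longleftrightarrow> x = (0::'h::complex_inner)"
  by (simp add: cinner_self)

lemma cinner_eqI: "(\<And>w. cinner w x = cinner w (y::'h::complex_inner)) \<Longrightarrow> x = y"
  using cinner_self_eq_0_iff[of "x - y"] by (simp add: cinner_diff_right)

lemma cinner_eq_0_commute: "cinner x y = 0 \<longleftrightarrow> cinner y (x::'h::complex_inner) = 0"
  by (metis cinner_commute complex_cnj_zero)

lemma norm_scaleC: "norm (a *c (x::'h::complex_inner)) = cmod a * norm x"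
proof -
  have "complex_of_real ((norm (a *c x))\<^sup>2) = of_real ((cmod a * norm x)\<^sup>2)"
    by (simp only: cinner_self[symmetric] cinner_scaleC_left cinner_scaleC_right)
       (simp add: cinner_self power_mult_distrib complex_norm_square[symmetric] flip: mult.assoc)
  then have "(norm (a *c x))\<^sup>2 = (cmod a * norm x)\<^sup>2"
    using of_real_eq_iff by blast
  then show ?thesis by (simp add: power2_eq_iff_nonneg)
qed

text \<open>The imaginary part of \<open>cinner x y\<close> is the real part of
  \<open>cinner (\<i> *c x) y\<close>. Hence real orthogonality to a complex subspace is already
  complex orthogonality.\<close>

lemma cinner_eq_inner: "cinner x y = Complex (inner x y) (inner (\<i> *c x) (y::'h::complex_inner))"
  by (simp add: complex_eq_iff inner_eq_Re_cinner cinner_scaleC_left)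

lemma continuous_on_scaleC: "continuous_on S (\<lambda>y. a *c (y::'h::complex_inner))"
proof (rule continuous_onI)
  fix x :: 'h and e :: real assume "e > 0"
  \<comment> \<open>Adding 1 to \<open>cmod a\<close> keeps the denominator positive when
    \<open>a = 0\<close>.\<close>
  show "\<exists>d>0. \<forall>x'\<in>S. dist x' x < d \<longrightarrow> dist (a *c x') (a *c x) \<le> e"
  proof (intro exI[of _ "e / (cmod a + 1)"] conjI ballI impI)
    show "0 < e / (cmod a + 1)" using \<open>e > 0\<close> by (simp add: add_nonneg_pos)
    fix x' assume "dist x' x < e / (cmod a + 1)"
    then have "norm (x' - x) * (cmod a + 1) < e"
      using add_nonneg_pos[OF norm_ge_zero[of a] zero_less_one]
      by (simp only: dist_norm pos_less_divide_eq)
    then have "(cmod a + 1) * norm (x' - x) \<le> e" by (simp only: mult.commute)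
    then have "cmod a * norm (x' - x) \<le> e"
      using norm_ge_zero[of "x' - x"] unfolding distrib_right mult_1 by linarith
    then show "dist (a *c x') (a *c x) \<le> e"
      by (simp add: dist_norm norm_scaleC flip: scaleC_diff_right)
  qed
qed

section \<open>Complex subspaces, spans and closures\<close>

lemma csubspaceD:
  assumes "csubspace V"
  shows csubspace_0: "0 \<in> V"
    and csubspace_add: "x \<in> V \<Longrightarrow> y \<in> V \<Longrightarrow> x + y \<in> V"
    and csubspace_scale: "x \<in> V \<Longrightarrow> a *c x \<in> V"
  using assms by (auto simp: csubspace_def)

lemma csubspace_diff: "csubspace V \<Longrightarrow> x \<in> V \<Longrightarrow> y \<in> V \<Longrightarrow> x - y \<in> V"
  using csubspace_add[of V x "(- 1) *c y"] csubspace_scale[of V y "- 1"]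
  by (simp add: scaleC_minus_left)

lemma csubspace_sum: "csubspace V \<Longrightarrow> (\<And>i. i \<in> I \<Longrightarrow> f i \<in> V) \<Longrightarrow> (\<Sum>i\<in>I. f i) \<in> V"
  by (induction I rule: infinite_finite_induct) (auto simp: csubspaceD)

lemma csubspace_cspan: "csubspace (cspan B)"
  unfolding cspan_def by (rule hull_in) (auto simp: csubspace_def)

lemma cspan_superset: "B \<subseteq> cspan B"
  unfolding cspan_def by (rule hull_subset)

lemma cspan_minimal: "B \<subseteq> V \<Longrightarrow> csubspace V \<Longrightarrow> cspan B \<subseteq> V"
  unfolding cspan_def by (rule hull_minimal)

lemma cspan_mono: "B \<subseteq> C \<Longrightarrow> cspan B \<subseteq> cspan C"
  unfolding cspan_def by (rule hull_mono)

lemma csubspace_closure: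
  assumes "csubspace V" shows "csubspace (closure V)"
  unfolding csubspace_def
proof (intro conjI ballI allI)
  show "0 \<in> closure V" using closure_subset csubspace_0[OF assms] by blast
next
  fix x y assume "x \<in> closure V" "y \<in> closure V"
  then obtain f g where "\<And>n. f n \<in> V" "f \<longlonglongrightarrow> x" "\<And>n. g n \<in> V" "g \<longlonglongrightarrow> y"
    by (auto simp: closure_sequential)
  then have "\<forall>n. f n + g n \<in> V" "(\<lambda>n. f n + g n) \<longlonglongrightarrow> x + y"
    using csubspace_add[OF assms] by (auto intro: tendsto_add)
  then show "x + y \<in> closure V"
    unfolding closure_sequential by (intro exI[of _ "\<lambda>n. f n + g n"] conjI)
next
  fix a x assume "x \<in> closure V"
  have "(\<lambda>y. a *c y) ` closure V \<subseteq> closure V"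
    using csubspace_scale[OF assms] closure_subset[of V]
    by (intro image_closure_subset continuous_on_scaleC) auto
  with \<open>x \<in> closure V\<close> show "a *c x \<in> closure V" by blast
qed

section \<open>Finite orthonormal sets and dimension\<close>

lemma orthonormalD:
  assumes "orthonormal E" "e \<in> E" "f \<in> E"
  shows "cinner e f = (if e = f then 1 else 0)"
  using assms by (auto simp: orthonormal_def)

lemma orthonormal_norm: "orthonormal E \<Longrightarrow> e \<in> E \<Longrightarrow> norm e = 1"
  using orthonormalD[of E e e] cinner_self[of e]
  by (metis of_real_eq_1_iff norm_ge_zero power2_eq_1_iff abs_norm_cancel abs_1 abs_neg_one)

text \<open>The vectors equal to their own expansion form a complex subspace that contains
  \<open>E\<close>, hence its span.\<close>

lemma orthonormal_expand:
  assumes E: "finite E" "orthonormal E" and u: "u \<in> cspan E"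
  shows "u = (\<Sum>e\<in>E. cinner e u *c e)"
proof -
  have "cspan E \<subseteq> {u. u = (\<Sum>e\<in>E. cinner e u *c e)}"
  proof (rule cspan_minimal)
    show "E \<subseteq> {u. u = (\<Sum>e\<in>E. cinner e u *c e)}"
    proof (intro subsetI CollectI)
      fix f assume f: "f \<in> E"
      have "(\<Sum>e\<in>E. cinner e f *c e) = (\<Sum>e\<in>E. if e = f then f else 0)"
        using f by (intro sum.cong refl) (auto simp: orthonormalD[OF E(2)])
      then show "f = (\<Sum>e\<in>E. cinner e f *c e)" using f E by simp
    qed
    show "csubspace {u. u = (\<Sum>e\<in>E. cinner e u *c e)}"
      unfolding csubspace_def
      by (auto simp: cinner_add_right scaleC_add_left sum.distrib cinner_scaleC_right
           scaleC_scaleC[symmetric] scaleC_sum_right[symmetric])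
  qed
  with u show ?thesis by blast
qed

lemma orthonormal_residual:
  assumes "finite E" "orthonormal E" "f \<in> E"
  shows "cinner f (u - (\<Sum>e\<in>E. cinner e u *c e)) = 0"
proof -
  have "(\<Sum>e\<in>E. cinner e u * cinner f e) = (\<Sum>e\<in>E. if e = f then cinner f u else 0)"
    using assms by (intro sum.cong) (auto simp: orthonormalD)
  then show ?thesis
    using assms by (simp add: cinner_diff_right cinner_sum_right cinner_scaleC_right)
qed

lemma orthonormal_insert:
  assumes "orthonormal E" "cinner e e = 1" "\<And>f. f \<in> E \<Longrightarrow> cinner f e = 0"
  shows "orthonormal (insert e E)"
  using assms cinner_eq_0_commute unfolding orthonormal_def by (metis insert_iff)

lemma normalize_cinner: "x \<noteq> 0 \<Longrightarrow>
  cinner (of_real (1 / norm x) *c x) (of_real (1 / norm x) *c (x::'h::complex_inner)) = 1"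
  by (simp only: cinner_scaleC_left cinner_scaleC_right) (simp add: cinner_self power2_eq_square)

text \<open>The given set \<open>E\<close> is kept while the span absorbs \<open>B\<close>; this is
  how a prescribed unit vector becomes a member of the enlarged set.\<close>

lemma gram_schmidt:
  assumes "finite E" "orthonormal E" "finite B"
  shows "\<exists>E'. finite E' \<and> orthonormal E' \<and> E \<subseteq> E' \<and> B \<subseteq> cspan E'"
  using assms(3)
proof (induction B)
  case empty
  then show ?case using assms by auto
next
  case (insert b B)
  then obtain E' where E': "finite E'" "orthonormal E'" "E \<subseteq> E'" "B \<subseteq> cspan E'" by auto
  define p where "p = (\<Sum>e\<in>E'. cinner e b *c e)"
  define r where "r = b - p"
  have p: "p \<in> cspan E'"
    unfolding p_def using cspan_superset
    by (intro csubspace_sum csubspace_cspan csubspace_scale[OF csubspace_cspan]) auto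
  show ?case
  proof (cases "r = 0")
    case True
    then show ?thesis using E' p by (auto simp: r_def)
  next
    case False
    define e where "e = of_real (1 / norm r) *c r"
    have "cinner f e = 0" if "f \<in> E'" for f
      using orthonormal_residual[OF E'(1,2) that, of b]
      by (simp add: e_def r_def p_def cinner_scaleC_right)
    then have o: "orthonormal (insert e E')"
      using normalize_cinner[OF False] by (intro orthonormal_insert E') (auto simp: e_def)
    have "r = of_real (norm r) *c e" using False by (simp add: e_def scaleC_scaleC)
    then have "b = p + of_real (norm r) *c e" by (simp add: r_def)
    moreover have "p \<in> cspan (insert e E')" "e \<in> cspan (insert e E')"
      using p cspan_mono[of E' "insert e E'"] cspan_superset[of "insert e E'"] by auto
    ultimately have "b \<in> cspan (insert e E')"
      by (simp only:) (intro csubspaceD(2,3) csubspace_cspan)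
    then show ?thesis
      using E' o cspan_mono[of E' "insert e E'"] by (intro exI[of _ "insert e E'"]) auto
  qed
qed

lemma parseval_sum:
  assumes "finite E" "orthonormal E"
  shows "(norm (\<Sum>e\<in>E. c e *c e))\<^sup>2 = (\<Sum>e\<in>E. (cmod (c e))\<^sup>2)"
proof -
  have "cinner f (\<Sum>e\<in>E. c e *c e) = c f" if "f \<in> E" for f
  proof -
    have "(\<Sum>e\<in>E. c e * cinner f e) = (\<Sum>e\<in>E. if e = f then c f else 0)"
      using assms that by (intro sum.cong) (auto simp: orthonormalD)
    then show ?thesis using that assms by (simp add: cinner_sum_right cinner_scaleC_right)
  qed
  then have "cinner (\<Sum>e\<in>E. c e *c e) (\<Sum>e\<in>E. c e *c e) = (\<Sum>e\<in>E. cnj (c e) * c e)"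
    by (subst cinner_sum_left) (simp add: cinner_scaleC_left)
  also have "\<dots> = of_real (\<Sum>e\<in>E. (cmod (c e))\<^sup>2)"
    by (simp add: complex_norm_square[symmetric] mult.commute)
  finally show ?thesis unfolding cinner_self of_real_eq_iff .
qed

lemma bessel:
  assumes "finite E" "orthonormal E"
  shows "(\<Sum>e\<in>E. (cmod (cinner e v))\<^sup>2) \<le> (norm v)\<^sup>2"
proof -
  let ?p = "\<Sum>e\<in>E. cinner e v *c e"
  have "inner (v - ?p) ?p = 0"
  proof -
    have "cinner ?p (v - ?p) = 0"
      by (subst cinner_sum_left) (simp add: cinner_scaleC_left orthonormal_residual[OF assms])
    then show ?thesis by (subst inner_commute) (simp only: inner_eq_Re_cinner zero_complex.sel)
  qed
  then have "(norm v)\<^sup>2 = (norm (v - ?p))\<^sup>2 + (norm ?p)\<^sup>2"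
    using norm_add_Pythagorean[of "v - ?p" ?p] by (simp add: orthogonal_def)
  then show ?thesis by (simp add: parseval_sum[OF assms])
qed

text \<open>Riesz representation in finite dimension: on \<open>cspan E'\<close> the functional
  \<open>l\<close> is the inner product against the sum of the \<open>l e *c e\<close>. Bessel
  bounds the left side by the squared norm of that vector, and Parseval identifies this norm with
  the right side.\<close>

lemma antilinear_bessel:
  assumes "finite E" "orthonormal E" "finite E'" "orthonormal E'" "E \<subseteq> cspan E'"
    and add: "\<And>x y. l (x + y) = l x + l y" and scale: "\<And>z x. l (z *c x) = cnj z * l x"
  shows "(\<Sum>e\<in>E. (cmod (l e))\<^sup>2) \<le> (\<Sum>e\<in>E'. (cmod (l e))\<^sup>2)"
proof -
  have l0: "l 0 = 0" using scale[of 0 0] by simp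
  have lsum: "l (\<Sum>i\<in>I. f i) = (\<Sum>i\<in>I. l (f i))" for I f
    by (induction I rule: infinite_finite_induct) (auto simp: add l0)
  define v where "v = (\<Sum>e\<in>E'. l e *c e)"
  have "l u = cinner u v" if "u \<in> cspan E'" for u
  proof -
    have "l u = l (\<Sum>e\<in>E'. cinner e u *c e)" using orthonormal_expand[OF assms(3,4) that] by simp
    also have "\<dots> = cinner u v"
      by (simp add: lsum scale v_def cinner_sum_right cinner_scaleC_right mult.commute
          flip: cinner_commute[of u])
    finally show ?thesis .
  qed
  then have "(\<Sum>e\<in>E. (cmod (l e))\<^sup>2) = (\<Sum>e\<in>E. (cmod (cinner e v))\<^sup>2)"
    using assms(5) by (intro sum.cong) auto
  also have "\<dots> \<le> (norm v)\<^sup>2" by (rule bessel[OF assms(1,2)])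
  also have "\<dots> = (\<Sum>e\<in>E'. (cmod (l e))\<^sup>2)" unfolding v_def by (rule parseval_sum[OF assms(3,4)])
  finally show ?thesis .
qed

text \<open>Double counting of the squared moduli of all \<open>cinner e e'\<close>: each
  \<open>e\<close> contributes exactly 1 by Parseval, each \<open>e'\<close> at most 1 by
  Bessel.\<close>

lemma has_cdim_unique:
  assumes "has_cdim V m" "has_cdim V n" shows "m = n"
proof -
  have *: "card E \<le> card E'" if "finite E" "orthonormal E" "finite E'" "orthonormal E'" "E \<subseteq> cspan E'"
    for E E' :: "'a set"
  proof -
    have E: "(\<Sum>e'\<in>E'. (cmod (cinner e e'))\<^sup>2) = 1" if "e \<in> E" for e
    proof -
      have "1 = (norm (\<Sum>e'\<in>E'. cinner e' e *c e'))\<^sup>2"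
        using orthonormal_expand[of E' e] orthonormal_norm[of E e] that \<open>finite E'\<close> \<open>orthonormal E'\<close>
          \<open>orthonormal E\<close> \<open>E \<subseteq> cspan E'\<close> by (metis power_one subsetD)
      also have "\<dots> = (\<Sum>e'\<in>E'. (cmod (cinner e' e))\<^sup>2)"
        using \<open>finite E'\<close> \<open>orthonormal E'\<close> by (rule parseval_sum)
      also have "\<dots> = (\<Sum>e'\<in>E'. (cmod (cinner e e'))\<^sup>2)"
        by (metis cinner_commute complex_mod_cnj)
      finally show ?thesis by simp
    qed
    have "real (card E) = (\<Sum>e\<in>E. \<Sum>e'\<in>E'. (cmod (cinner e e'))\<^sup>2)" by (simp add: E)
    also have "\<dots> = (\<Sum>e'\<in>E'. \<Sum>e\<in>E. (cmod (cinner e e'))\<^sup>2)" by (rule sum.swap)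
    also have "\<dots> \<le> (\<Sum>e'\<in>E'. 1)"
    proof (rule sum_mono)
      fix e' assume "e' \<in> E'"
      then show "(\<Sum>e\<in>E. (cmod (cinner e e'))\<^sup>2) \<le> 1"
        using bessel[of E e'] orthonormal_norm[of E' e'] that by simp
    qed
    finally show ?thesis by simp
  qed
  obtain E F where "finite E" "card E = m" "orthonormal E" "cspan E = V"
      "finite F" "card F = n" "orthonormal F" "cspan F = V"
    using assms unfolding has_cdim_def by blast
  with *[of E F] *[of F E] cspan_superset[of E] cspan_superset[of F] show ?thesis by simp
qed


section \<open>Orthogonal projections\<close>

text \<open>A minimising sequence for the distance from \<open>v\<close> is Cauchy by the
  parallelogram law. Its limit leaves an orthogonal remainder, because moving along \<open>w\<close>
  cannot bring it closer to \<open>v\<close>.\<close>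

lemma closed_csubspace_projection:
  fixes K :: "'h::{complex_inner, complete_space} set"
  assumes K: "csubspace K" "closed K"
  shows "\<exists>u\<in>K. \<forall>w\<in>K. cinner w (v - u) = 0"
proof -
  define d where "d = (INF y\<in>K. norm (v - y))"
  have bdd: "bdd_below ((\<lambda>y. norm (v - y)) ` K)" by (rule bdd_belowI[of _ 0]) auto
  have ne: "K \<noteq> {}" using csubspace_0[OF K(1)] by blast
  have d: "d \<le> norm (v - y)" if "y \<in> K" for y
    unfolding d_def using bdd that by (rule cINF_lower)
  have d0: "0 \<le> d" unfolding d_def using ne by (intro cINF_greatest) auto
  have "\<exists>y\<in>K. norm (v - y) < d + inverse (real (Suc n))" for n
  proof -
    have "d < d + inverse (real (Suc n))" by simp
    then show ?thesis unfolding d_def cINF_less_iff[OF ne bdd] .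
  qed
  then obtain y where y: "\<And>n. y n \<in> K" "\<And>n. norm (v - y n) < d + inverse (real (Suc n))"
    by metis
  \<comment> \<open>The midpoint of two points of \<open>K\<close> lies in \<open>K\<close>, so its
    distance from \<open>v\<close> is at least \<open>d\<close>.\<close>
  have par: "(norm (a - b))\<^sup>2 \<le> 2 * (norm (v - a))\<^sup>2 + 2 * (norm (v - b))\<^sup>2 - 4 * d\<^sup>2"
    if "a \<in> K" "b \<in> K" for a b
  proof -
    let ?m = "of_real (1/2) *c (a + b)"
    have "?m \<in> K" using that K by (intro csubspace_scale csubspace_add)
    then have "d\<^sup>2 \<le> (norm (v - ?m))\<^sup>2" using d d0 by (intro power_mono) auto
    also have "4 * (norm (v - ?m))\<^sup>2 = (norm ((v - a) + (v - b)))\<^sup>2"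
    proof -
      have "(v - a) + (v - b) = 2 *\<^sub>R (v - ?m)"
        by (simp only: scaleR_scaleC[symmetric]) (simp add: algebra_simps scaleR_2)
      then show ?thesis by (simp only: norm_scaleR) (simp add: power_mult_distrib)
    qed
    ultimately have "4 * d\<^sup>2 \<le> (norm ((v - a) + (v - b)))\<^sup>2" by linarith
    moreover have "(norm ((v - a) + (v - b)))\<^sup>2 + (norm ((v - b) - (v - a)))\<^sup>2 =
        2 * (norm (v - a))\<^sup>2 + 2 * (norm (v - b))\<^sup>2"
      by (simp add: power2_norm_eq_inner inner_add_left inner_add_right inner_diff_left
          inner_diff_right inner_commute)
    ultimately show ?thesis by simp
  qed
  have "Cauchy y"
  proof (rule CauchyI)
    fix e :: real assume e: "0 < e"
    have "(\<lambda>n. 4 * (d + inverse (real (Suc n)))\<^sup>2) \<longlonglongrightarrow> 4 * (d + 0)\<^sup>2"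
      by (intro tendsto_intros LIMSEQ_inverse_real_of_nat)
    moreover have "4 * (d + 0)\<^sup>2 < 4 * d\<^sup>2 + e\<^sup>2" using e by simp
    ultimately have "\<forall>\<^sub>F n in sequentially. 4 * (d + inverse (real (Suc n)))\<^sup>2 < 4 * d\<^sup>2 + e\<^sup>2"
      by (rule order_tendstoD)
    then obtain n0 where n0: "\<And>n. n \<ge> n0 \<Longrightarrow> 4 * (d + inverse (real (Suc n)))\<^sup>2 < 4 * d\<^sup>2 + e\<^sup>2"
      by (auto simp: eventually_sequentially)
    have sq: "(norm (v - y n))\<^sup>2 \<le> (d + inverse (real (Suc n)))\<^sup>2" for n
      using y(2)[of n] by (intro power_mono) auto
    show "\<exists>n0. \<forall>m\<ge>n0. \<forall>n\<ge>n0. norm (y m - y n) < e"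
    proof (intro exI allI impI)
      fix m n assume "n0 \<le> m" "n0 \<le> n"
      then have "(norm (y m - y n))\<^sup>2 < e\<^sup>2"
        using par[OF y(1)[of m] y(1)[of n]] sq[of m] sq[of n] n0[of m] n0[of n] by linarith
      then show "norm (y m - y n) < e" using e by (simp add: power_less_imp_less_base)
    qed
  qed
  then obtain u where u: "y \<longlonglongrightarrow> u" using Cauchy_convergent_iff convergent_def by blast
  have uK: "u \<in> K" using u y(1) K(2) closed_sequential_limits by blast
  have "(\<lambda>n. norm (v - y n)) \<longlonglongrightarrow> norm (v - u)" by (intro tendsto_intros u)
  moreover have "(\<lambda>n. d + inverse (real (Suc n))) \<longlonglongrightarrow> d + 0"
    by (intro tendsto_intros LIMSEQ_inverse_real_of_nat)
  ultimately have ud: "norm (v - u) \<le> d"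
    using y(2) by (intro LIMSEQ_le[of "\<lambda>n. norm (v - y n)" _ _ d]) (auto intro: less_imp_le)
  have orth: "inner w (v - u) = 0" if w: "w \<in> K" for w
  proof (cases "w = 0")
    case False
    let ?r = "v - u"
    \<comment> \<open>The coefficient that minimises the distance from \<open>v\<close> along the
      line through \<open>u\<close> in direction \<open>w\<close>.\<close>
    define t where "t = inner w ?r / (norm w)\<^sup>2"
    have "u + t *\<^sub>R w \<in> K"
      unfolding scaleR_scaleC using uK w K by (intro csubspace_scale csubspace_add)
    then have "norm ?r \<le> norm (v - (u + t *\<^sub>R w))" using d ud by (meson order_trans)
    then have "(norm ?r)\<^sup>2 \<le> (norm (?r - t *\<^sub>R w))\<^sup>2" by (simp add: power_mono algebra_simps)
    also have "\<dots> = (norm ?r)\<^sup>2 - 2 * t * inner w ?r + t\<^sup>2 * (norm w)\<^sup>2"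
      unfolding power2_norm_eq_inner
      by (simp add: inner_diff_left inner_diff_right inner_commute power2_eq_square algebra_simps)
    also have "t\<^sup>2 * (norm w)\<^sup>2 = t * inner w ?r"
      using False by (simp add: t_def power2_eq_square)
    finally have "t * inner w ?r \<le> 0" by simp
    then have "(inner w ?r)\<^sup>2 / (norm w)\<^sup>2 \<le> 0" by (simp add: t_def power2_eq_square)
    then show ?thesis using False by (simp add: divide_le_0_iff zero_less_power not_less)
  qed simp
  \<comment> \<open>Real orthogonality to both \<open>w\<close> and \<open>\<i> *c w\<close> is
    complex orthogonality to \<open>w\<close>.\<close>
  have "cinner w (v - u) = 0" if "w \<in> K" for w
    using orth[OF that] orth[OF csubspace_scale[OF K(1) that, of \<i>]]
    by (simp add: cinner_eq_inner[of w] complex_eq_iff)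
  with uK show ?thesis by blast
qed

text \<open>Orthogonal projections in algebraic form, with no reference to a closed subspace, so
  that complements and differences of nested projections obey the same laws.\<close>

definition cprojection :: "('h::complex_inner \<Rightarrow> 'h) \<Rightarrow> bool" where
  "cprojection P \<longleftrightarrow> (\<forall>x y. P (x + y) = P x + P y) \<and> (\<forall>a x. P (a *c x) = a *c P x) \<and>
     (\<forall>x. P (P x) = P x) \<and> (\<forall>x y. cinner (P x) y = cinner x (P y))"

lemma cprojectionD:
  assumes "cprojection P"
  shows cprojection_add: "P (x + y) = P x + P y"
    and cprojection_scale: "P (a *c x) = a *c P x"
    and cprojection_idem: "P (P x) = P x"
    and cprojection_adj: "cinner (P x) y = cinner x (P y)"
    and cprojection_0: "P 0 = 0"
    and cprojection_diff: "P (x - y) = P x - P y"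
proof -
  show *: "P (x + y) = P x + P y" "P (a *c x) = a *c P x" "P (P x) = P x"
    "cinner (P x) y = cinner x (P y)" for x y a
    using assms by (auto simp: cprojection_def)
  show "P 0 = 0" using *(2)[of 0 0] by simp
  show "P (x - y) = P x - P y" using *(1)[of "x - y" y] by (simp add: algebra_simps)
qed

lemma ortho_proj_closed:
  fixes K :: "'h::{complex_inner, complete_space} set"
  assumes K: "csubspace K" "closed K"
  shows "cprojection (ortho_proj K)" and "ortho_proj K v \<in> K"
    and "v \<in> K \<Longrightarrow> ortho_proj K v = v"
proof -
  have uniq: "u = u'"
    if "u \<in> K" "\<forall>w\<in>K. cinner w (v - u) = 0" "u' \<in> K" "\<forall>w\<in>K. cinner w (v - u') = 0" for u u' v
  proof -
    have "u - u' \<in> K" using that K by (intro csubspace_diff)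
    then have "cinner (u - u') ((v - u') - (v - u)) = 0"
      using that by (simp only: cinner_diff_right[of "u - u'" "v - u'"]) simp
    then have "cinner (u - u') (u - u') = 0" by simp
    then show ?thesis by (simp add: cinner_self_eq_0_iff)
  qed
  have eq: "ortho_proj K v = u" if "u \<in> K" "\<forall>w\<in>K. cinner w (v - u) = 0" for u v
    unfolding ortho_proj_def by (rule the_equality) (use that uniq in blast)+
  have pr: "ortho_proj K v \<in> K \<and> (\<forall>w\<in>K. cinner w (v - ortho_proj K v) = 0)" for v
    using closed_csubspace_projection[OF K, of v] eq by blast
  show "ortho_proj K v \<in> K" for v using pr by blast
  show fix_K: "v \<in> K \<Longrightarrow> ortho_proj K v = v" for v by (rule eq) auto
  show "cprojection (ortho_proj K)"
    unfolding cprojection_def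
  proof (intro conjI allI)
    fix x y :: 'h and a
    show "ortho_proj K (x + y) = ortho_proj K x + ortho_proj K y"
    proof (rule eq)
      show "ortho_proj K x + ortho_proj K y \<in> K" using pr K by (intro csubspace_add) blast+
      have "x + y - (ortho_proj K x + ortho_proj K y) = (x - ortho_proj K x) + (y - ortho_proj K y)"
        by simp
      then show "\<forall>w\<in>K. cinner w (x + y - (ortho_proj K x + ortho_proj K y)) = 0"
        using pr by (simp only: cinner_add_right) auto
    qed
    show "ortho_proj K (a *c x) = a *c ortho_proj K x"
      using pr K by (intro eq)
        (auto intro: csubspace_scale simp: scaleC_diff_right[symmetric] cinner_scaleC_right)
    show "ortho_proj K (ortho_proj K x) = ortho_proj K x" using pr fix_K by blast
    have "cinner (ortho_proj K x) (y - ortho_proj K y) = 0"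
      "cinner (x - ortho_proj K x) (ortho_proj K y) = 0"
      using pr cinner_eq_0_commute by blast+
    then show "cinner (ortho_proj K x) y = cinner x (ortho_proj K y)"
      by (simp add: cinner_diff_right cinner_diff_left)
  qed
qed

lemma spectral_proj_cprojection:
  fixes D :: "'h::{complex_inner, complete_space} unb_op"
  shows "cprojection (spectral_proj D l)"
  unfolding spectral_proj_def
  by (intro ortho_proj_closed csubspace_closure csubspace_cspan closed_closure)

text \<open>Raising the threshold leaves fewer eigenspaces, so the projection for the lower
  threshold fixes the range of the one for the higher.\<close>

lemma spectral_proj_antimono:
  fixes D :: "'h::{complex_inner, complete_space} unb_op"
  assumes "l \<le> l'"
  shows "spectral_proj D l (spectral_proj D l' v) = spectral_proj D l' v"
proof -
  let ?K = "\<lambda>l. closure (cspan (\<Union>r\<in>{l<..}. eigenspace D r))"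
  have K: "csubspace (?K l)" "closed (?K l)" for l
    by (intro csubspace_closure csubspace_cspan closed_closure)+
  have "spectral_proj D l' v \<in> ?K l'"
    unfolding spectral_proj_def using K by (rule ortho_proj_closed)
  also have "?K l' \<subseteq> ?K l" using assms by (intro closure_mono cspan_mono UN_mono) auto
  finally show ?thesis
    unfolding spectral_proj_def[of D l] using K by (intro ortho_proj_closed)
qed

text \<open>Inclusion of ranges written as an operator identity; the companion identity
  \<open>Q (P x) = Q x\<close> in \<open>proj_leD\<close> is its adjoint.\<close>

definition proj_le :: "('h::complex_inner \<Rightarrow> 'h) \<Rightarrow> ('h \<Rightarrow> 'h) \<Rightarrow> bool" where
  "proj_le Q P \<longleftrightarrow> cprojection P \<and> cprojection Q \<and> (\<forall>x. P (Q x) = Q x)"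

lemma proj_leD:
  assumes "proj_le Q P"
  shows "cprojection P" "cprojection Q" "P (Q x) = Q x" "Q (P x) = Q x"
proof -
  show *: "cprojection P" "cprojection Q" "P (Q x) = Q x" for x
    using assms by (auto simp: proj_le_def)
  show "Q (P x) = Q x"
    by (rule cinner_eqI) (metis * cprojection_adj)
qed

lemma proj_le_trans: "proj_le R Q \<Longrightarrow> proj_le Q P \<Longrightarrow> proj_le R P"
  unfolding proj_le_def by metis

lemma cprojection_gap:
  assumes "proj_le Q P" shows "cprojection (\<lambda>x. P x - Q x)"
proof -
  have "P (P x - Q x) - Q (P x - Q x) = P x - Q x" for x
    using proj_leD[OF assms] by (simp add: cprojectionD)
  then show ?thesis
    using proj_leD[OF assms] unfolding cprojection_def
    by (simp add: scaleC_diff_right cinner_diff_left cinner_diff_right)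
qed

lemma cprojection_expand:
  assumes "cprojection W" "finite E" "orthonormal E" "cspan E = range W"
  shows "W x = (\<Sum>e\<in>E. cinner e x *c e)"
proof -
  have "W x = (\<Sum>e\<in>E. cinner e (W x) *c e)"
    using assms by (intro orthonormal_expand) auto
  moreover have "cinner e (W x) = cinner e x" if "e \<in> E" for e
  proof -
    have "e \<in> range W" using that assms cspan_superset by blast
    then show ?thesis using assms(1) by (metis cprojectionD(3,4) rangeE)
  qed
  ultimately show ?thesis by simp
qed


section \<open>Alternating forms\<close>

text \<open>Covers exactly the Hilbert space and its conjugate, so that statements about forms are
  proved once for particles and antiparticles.\<close>

definition fock_structure ::
    "(complex \<Rightarrow> 'h::complex_inner \<Rightarrow> 'h) \<Rightarrow> ('h \<Rightarrow> 'h \<Rightarrow> complex) \<Rightarrow> bool" where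
  "fock_structure sm ip \<longleftrightarrow>
     sm = scaleC \<and> ip = cinner \<or> sm = scaleC_bar \<and> ip = cinner_bar"

lemma fock_structure_cinner [simp]: "fock_structure scaleC cinner"
  and fock_structure_cinner_bar [simp]: "fock_structure scaleC_bar cinner_bar"
  by (auto simp: fock_structure_def)

lemma fock_structureD:
  assumes "fock_structure sm ip"
  shows ip_add_left: "ip (x + y) z = ip x z + ip y z"
    and ip_scale_left: "ip (sm a x) z = cnj a * ip x z"
    and ip_self: "ip x x = cinner x x"
    and ip_eq_0_iff: "ip x y = 0 \<longleftrightarrow> cinner x y = 0"
  using assms cinner_eq_0_commute[of x y]
  by (auto simp: fock_structure_def cinner_bar_def scaleC_bar_def cinner_add_left cinner_add_right
      cinner_scaleC_left cinner_scaleC_right)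

lemma ip_cprojection:
  assumes "fock_structure sm ip" "cprojection Q"
  shows "ip (Q x) y = ip x (Q y)"
  using assms cprojection_adj by (auto simp: fock_structure_def cinner_bar_def)

lemma alt_formD:
  assumes "alt_form sm Q \<phi>"
  shows alt_form_map: "\<phi> (map Q gs) = \<phi> gs"
    and alt_form_add: "\<phi> (as @ (g + g') # bs) = \<phi> (as @ g # bs) + \<phi> (as @ g' # bs)"
    and alt_form_scale: "\<phi> (as @ sm z g # bs) = cnj z * \<phi> (as @ g # bs)"
    and alt_form_repeat: "\<phi> (as @ g # bs @ g # cs) = 0"
    and alt_form_add_head: "\<phi> ((g + g') # bs) = \<phi> (g # bs) + \<phi> (g' # bs)"
    and alt_form_scale_head: "\<phi> (sm z g # bs) = cnj z * \<phi> (g # bs)"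
    and alt_form_repeat_head: "\<phi> (g # g # bs) = 0"
proof -
  show *: "\<phi> (map Q gs) = \<phi> gs"
    "\<phi> (as @ (g + g') # bs) = \<phi> (as @ g # bs) + \<phi> (as @ g' # bs)"
    "\<phi> (as @ sm z g # bs) = cnj z * \<phi> (as @ g # bs)"
    "\<phi> (as @ g # bs @ g # cs) = 0" for as bs cs g g' z gs
    using assms unfolding alt_form_def by metis+
  show "\<phi> ((g + g') # bs) = \<phi> (g # bs) + \<phi> (g' # bs)"
    "\<phi> (sm z g # bs) = cnj z * \<phi> (g # bs)" "\<phi> (g # g # bs) = 0"
    using *(2)[of "[]"] *(3)[of "[]"] *(4)[of "[]" g "[]" bs] by auto
qed

lemma alt_form_map_head: "alt_form sm Q \<phi> \<Longrightarrow> cprojection Q \<Longrightarrow> \<phi> (Q g # gs) = \<phi> (g # gs)"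
  using alt_form_map[of sm Q \<phi> "Q g # gs"] alt_form_map[of sm Q \<phi> "g # gs"]
  by (simp add: cprojection_idem)

lemma alt_form_linear:
  assumes "alt_form sm Q \<phi>" "alt_form sm Q \<eta>"
  shows "alt_form sm Q (\<lambda>gs. a * \<phi> gs + b * \<eta> gs)"
  using alt_formD(1-4)[OF assms(1)] alt_formD(1-4)[OF assms(2)]
  unfolding alt_form_def by (auto simp: algebra_simps)

lemma alt_form_mult: "alt_form sm Q \<phi> \<Longrightarrow> alt_form sm Q (\<lambda>gs. a * \<phi> gs)"
  using alt_form_linear[of sm Q \<phi> \<phi> a 0] by simp

lemma alt_form_annihilation:
  assumes "alt_form sm Q \<phi>" "cprojection Q"
  shows "alt_form sm Q (annihilation g \<phi>)"
proof -
  have "\<phi> (g # map Q gs) = \<phi> (g # gs)" for gs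
    using alt_form_map_head[OF assms, of g "map Q gs"] alt_form_map[OF assms(1), of "g # gs"]
    by simp
  then show ?thesis
    using alt_formD(2-4)[OF assms(1), of "g # _"] unfolding alt_form_def annihilation_def by simp
qed

lemma alt_form_swap_head:
  assumes "alt_form sm Q \<phi>" shows "\<phi> (g # h # gs) = - \<phi> (h # g # gs)"
proof -
  have "\<phi> ((g + h) # (g + h) # gs) = 0" by (rule alt_form_repeat_head[OF assms])
  then have "\<phi> (g # g # gs) + \<phi> (g # h # gs) + (\<phi> (h # g # gs) + \<phi> (h # h # gs)) = 0"
    using alt_form_add[OF assms, of "[_]"] by (simp add: alt_form_add_head[OF assms])
  then show ?thesis by (simp add: alt_form_repeat_head[OF assms] eq_neg_iff_add_eq_0)
qed

lemma alt_form_move: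
  assumes "alt_form sm Q \<phi>" "cprojection Q"
  shows "\<phi> (as @ x # bs) = (- 1) ^ length as * \<phi> (x # as @ bs)"
  using assms(1)
proof (induction as arbitrary: \<phi>)
  case (Cons a as)
  have "annihilation a \<phi> (as @ x # bs) = (- 1) ^ length as * annihilation a \<phi> (x # as @ bs)"
    by (rule Cons.IH[OF alt_form_annihilation[OF Cons.prems assms(2)]])
  then show ?case
    using alt_form_swap_head[OF Cons.prems, of a x] by (simp add: annihilation_def)
qed simp

text \<open>Stated for moduli, which is what the norms see; the sign of the permutation then never
  has to be tracked.\<close>

lemma alt_form_permute:
  assumes "alt_form sm Q \<phi>" "cprojection Q" "mset gs = mset hs"
  shows "cmod (\<phi> gs) = cmod (\<phi> hs)"
  using assms(1,3)
proof (induction gs arbitrary: \<phi> hs)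
  case (Cons g gs)
  have "g \<in> set hs" using Cons.prems(2) by (metis list.set_intros(1) set_mset_mset)
  then obtain as bs where hs: "hs = as @ g # bs" by (meson split_list)
  have "cmod (annihilation g \<phi> gs) = cmod (annihilation g \<phi> (as @ bs))"
    using Cons.prems(2) hs
    by (intro Cons.IH alt_form_annihilation[OF Cons.prems(1) assms(2)]) simp
  moreover have "cmod (\<phi> hs) = cmod (\<phi> (g # as @ bs))"
    unfolding hs alt_form_move[OF Cons.prems(1) assms(2)] by (simp add: norm_mult norm_power)
  ultimately show ?case by (simp add: annihilation_def)
qed simp

lemma alt_form_not_distinct: "alt_form sm Q \<phi> \<Longrightarrow> \<not> distinct gs \<Longrightarrow> \<phi> gs = 0"
  using not_distinct_decomp[of gs] alt_form_repeat[of sm Q \<phi>] by fastforce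

text \<open>Operators such as creation obey a recursion in the first argument. If a class of
  functions is stable under freezing that argument, axioms checked at the head propagate to every
  position by induction on the prefix.\<close>

lemma alt_form_coinduct:
  assumes C: "\<phi> \<in> C"
    and ann: "\<And>\<phi> g. \<phi> \<in> C \<Longrightarrow> annihilation g \<phi> \<in> C"
    and proj: "\<And>\<phi> g gs. \<phi> \<in> C \<Longrightarrow> \<phi> (Q g # gs) = \<phi> (g # gs)"
    and add: "\<And>\<phi> g h gs. \<phi> \<in> C \<Longrightarrow> \<phi> ((g + h) # gs) = \<phi> (g # gs) + \<phi> (h # gs)"
    and scale: "\<And>\<phi> g z gs. \<phi> \<in> C \<Longrightarrow> \<phi> (sm z g # gs) = cnj z * \<phi> (g # gs)"
    and rep: "\<And>\<phi> g gs. \<phi> \<in> C \<Longrightarrow> \<phi> (g # g # gs) = 0"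
  shows "alt_form sm Q \<phi>"
proof -
  have "\<phi> (map Q gs) = \<phi> gs" if "\<phi> \<in> C" for \<phi> gs
    using that
  proof (induction gs arbitrary: \<phi>)
    case (Cons g gs)
    then show ?case
      using Cons.IH[OF ann[OF Cons.prems, of g]] proj[OF Cons.prems, of g "map Q gs"]
      by (simp add: annihilation_def)
  qed simp
  moreover have add': "\<phi> (as @ (g + h) # bs) = \<phi> (as @ g # bs) + \<phi> (as @ h # bs)"
    if "\<phi> \<in> C" for \<phi> as bs g h
    using that
  proof (induction as arbitrary: \<phi>)
    case (Cons a as)
    then show ?case using Cons.IH[OF ann[OF Cons.prems, of a]] by (simp add: annihilation_def)
  qed (simp add: add)
  moreover have "\<phi> (as @ sm z g # bs) = cnj z * \<phi> (as @ g # bs)" if "\<phi> \<in> C" for \<phi> as bs g z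
    using that
  proof (induction as arbitrary: \<phi>)
    case (Cons a as)
    then show ?case using Cons.IH[OF ann[OF Cons.prems, of a]] by (simp add: annihilation_def)
  qed (simp add: scale)
  moreover have "\<phi> (as @ g # bs @ g # cs) = 0" if "\<phi> \<in> C" for \<phi> as bs cs g
    using that
  proof (induction "length as + length bs" arbitrary: \<phi> as bs)
    case 0
    then show ?case by (simp add: rep)
  next
    case (Suc n)
    show ?case
    proof (cases as)
      case (Cons a as')
      then show ?thesis
        using Suc.hyps(1)[of as' bs "annihilation a \<phi>"] Suc.hyps(2) ann[OF Suc.prems]
        by (simp add: annihilation_def)
    next
      case Nil
      with Suc.hyps(2) obtain b bs' where bs: "bs = b # bs'" "n = length bs'"
        by (cases bs) auto
      let ?r = "bs' @ g # cs"
      \<comment> \<open>Polarising a repeated \<open>g + b\<close> exchanges \<open>g\<close> with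
        \<open>b\<close>, which brings the two copies of \<open>g\<close> one place closer.\<close>
      have "\<phi> ((g + b) # (g + b) # ?r) = 0" by (rule rep[OF Suc.prems])
      then have "\<phi> (g # g # ?r) + \<phi> (g # b # ?r) + (\<phi> (b # g # ?r) + \<phi> (b # b # ?r)) = 0"
        using add'[OF Suc.prems, of "[_]" g b] by (simp add: add[OF Suc.prems])
      then have "\<phi> (g # b # ?r) = - \<phi> (b # g # ?r)"
        by (simp add: rep[OF Suc.prems] eq_neg_iff_add_eq_0)
      moreover have "\<phi> (b # g # ?r) = 0"
        using Suc.hyps(1)[of "[]" bs' "annihilation b \<phi>"] bs ann[OF Suc.prems]
        by (simp add: annihilation_def)
      ultimately show ?thesis using Nil bs by simp
    qed
  qed
  ultimately show ?thesis using C unfolding alt_form_def by metis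
qed

lemma alt_form_superspace:
  assumes "alt_form sm Q \<phi>" "\<And>x. Q (P x) = Q x"
  shows "alt_form sm P \<phi>"
proof -
  have "\<phi> (map P gs) = \<phi> gs" for gs
    using alt_form_map[OF assms(1), of "map P gs"] alt_form_map[OF assms(1), of gs]
    by (simp add: o_def assms(2))
  then show ?thesis using alt_formD(2-4)[OF assms(1)] unfolding alt_form_def by metis
qed

lemma alt_form_vacuum: "alt_form sm Q vacuum"
  by (auto simp: alt_form_def vacuum_def)


section \<open>Creation and annihilation operators\<close>

lemma creation_Nil [simp]: "creation ip f \<phi> [] = 0"
  by (simp add: creation_def)

text \<open>The canonical anticommutation relation between annihilation by \<open>g\<close> and
  creation by \<open>f\<close>, written as a recursion on the list; it drives the inductions about
  creation.\<close>

lemma creation_Cons: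
  "creation ip f \<phi> (g # gs) = ip g f * \<phi> gs - creation ip f (annihilation g \<phi>) gs"
proof -
  have "creation ip f \<phi> (g # gs) = ip g f * \<phi> gs +
      (\<Sum>k<length gs. (- 1) ^ Suc k * ip (gs ! k) f * \<phi> (g # remove_nth k gs))"
    unfolding creation_def length_Cons sum.lessThan_Suc_shift by (simp add: remove_nth_def)
  then show ?thesis
    by (simp add: creation_def annihilation_def sum_negf)
qed

lemma creation_linear:
  "creation ip f (\<lambda>gs. a * \<phi> gs + b * \<eta> gs) gs = a * creation ip f \<phi> gs + b * creation ip f \<eta> gs"
  unfolding creation_def by (simp add: sum_distrib_left sum.distrib algebra_simps)

lemma creation_add: "creation ip f (\<lambda>gs. \<phi> gs + \<eta> gs) gs = creation ip f \<phi> gs + creation ip f \<eta> gs"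
  using creation_linear[of ip f 1 \<phi> 1 \<eta>] by simp

lemma creation_diff: "creation ip f (\<lambda>gs. \<phi> gs - \<eta> gs) gs = creation ip f \<phi> gs - creation ip f \<eta> gs"
  using creation_linear[of ip f 1 \<phi> "- 1" \<eta>] by simp

lemma creation_mult: "creation ip f (\<lambda>gs. a * \<phi> gs) gs = a * creation ip f \<phi> gs"
  using creation_linear[of ip f a \<phi> 0 \<phi>] by simp

lemma creation_zero [simp]: "creation ip f (\<lambda>gs. 0) gs = 0"
  by (simp add: creation_def)

text \<open>Creation evaluates its argument on lists shorter by one, hence anticommutes with the
  degree sign.\<close>

lemma creation_parity:
  "creation ip f (\<lambda>gs. (- 1) ^ length gs * \<phi> gs) gs = - ((- 1) ^ length gs * creation ip f \<phi> gs)"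
proof -
  have "length (remove_nth k gs) = length gs - 1" if "k < length gs" for k
    using that by (simp add: remove_nth_def)
  moreover have "(- 1) ^ (length gs - 1) = - ((- 1) ^ length gs :: complex)" if "k < length gs" for k
    using that by (cases "length gs") auto
  ultimately show ?thesis
    unfolding creation_def sum_distrib_left sum_negf[symmetric]
    by (intro sum.cong) (auto simp: algebra_simps)
qed

lemma creation_vec_add:
  assumes "\<And>g. ip g (f + f') = ip g f + ip g f'"
  shows "creation ip (f + f') \<phi> gs = creation ip f \<phi> gs + creation ip f' \<phi> gs"
  unfolding creation_def by (simp add: assms algebra_simps sum.distrib)

lemma creation_vec_scale:
  assumes "\<And>g. ip g f' = c * ip g f"
  shows "creation ip f' \<phi> gs = c * creation ip f \<phi> gs"
  unfolding creation_def by (simp add: assms algebra_simps sum_distrib_left)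

lemma creation_cinner_add:
  "creation cinner (f + f') \<phi> gs = creation cinner f \<phi> gs + creation cinner f' \<phi> gs"
  by (rule creation_vec_add) (rule cinner_add_right)

lemma creation_cinner_scale: "creation cinner (c *c f) \<phi> gs = c * creation cinner f \<phi> gs"
  by (rule creation_vec_scale) (rule cinner_scaleC_right)

lemma creation_bar_add:
  "creation cinner_bar (f + f') \<phi> gs = creation cinner_bar f \<phi> gs + creation cinner_bar f' \<phi> gs"
  by (rule creation_vec_add) (simp add: cinner_bar_def cinner_add_left)

lemma creation_bar_scale: "creation cinner_bar (c *c f) \<phi> gs = cnj c * creation cinner_bar f \<phi> gs"
  by (rule creation_vec_scale) (simp add: cinner_bar_def cinner_scaleC_left)

lemma creation_orthogonal:
  assumes "\<And>g. g \<in> set gs \<Longrightarrow> ip g f = 0" shows "creation ip f \<phi> gs = 0"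
  using assms unfolding creation_def by (intro sum.neutral) auto

lemma annihilation_creation:
  "annihilation g (creation ip f \<phi>) = (\<lambda>gs. ip g f * \<phi> gs - creation ip f (annihilation g \<phi>) gs)"
  by (simp add: fun_eq_iff annihilation_def creation_Cons)

lemma creation_anticommute:
  "creation ip f (creation ip g \<phi>) gs = - creation ip g (creation ip f \<phi>) gs"
proof (induction gs arbitrary: \<phi>)
  case (Cons h gs)
  show ?case
    by (simp add: creation_Cons annihilation_creation creation_diff creation_mult
        Cons.IH[of "annihilation h \<phi>"])
qed simp

lemma creation_map:
  assumes "\<And>x y. ip (Q x) y = ip x (Q y)"
  shows "creation ip f \<phi> (map Q gs) = creation ip (Q f) (\<lambda>gs. \<phi> (map Q gs)) gs"
  unfolding creation_def
  by (simp add: assms remove_nth_def take_map drop_map)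

lemma creation_commute:
  "creation ip f (\<lambda>gs. creation ip' f' (\<psi> gs) hs) gs =
   creation ip' f' (\<lambda>hs. creation ip f (\<lambda>gs. \<psi> gs hs) gs) hs"
  unfolding creation_def sum_distrib_left
  by (subst sum.swap) (simp add: mult_ac)

lemma alt_form_creation:
  assumes S: "fock_structure sm ip" and Q: "cprojection Q" and f: "Q f = f" and \<phi>: "alt_form sm Q \<phi>"
  shows "alt_form sm Q (creation ip f \<phi>)"
proof -
  \<comment> \<open>Annihilating a created form also produces a multiple of the original form, so
    created forms alone are not a stable class. Allowing an arbitrary alternating summand makes it
    stable.\<close>
  define C where "C = {\<lambda>gs. \<eta> gs + creation ip f \<theta> gs | \<eta> \<theta>. alt_form sm Q \<eta> \<and> alt_form sm Q \<theta>}"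
  have "alt_form sm Q (\<lambda>gs. 0 * \<phi> gs)" by (rule alt_form_mult[OF \<phi>])
  then have "creation ip f \<phi> \<in> C"
    unfolding C_def using \<phi>
    by (intro CollectI exI[of _ "\<lambda>gs. 0"] exI[of _ \<phi>]) auto
  then show ?thesis
  proof (rule alt_form_coinduct[where C = C])
    fix \<xi> assume "\<xi> \<in> C"
    then obtain \<eta> \<theta> where \<xi>: "\<xi> = (\<lambda>gs. \<eta> gs + creation ip f \<theta> gs)"
      and alt: "alt_form sm Q \<eta>" "alt_form sm Q \<theta>" by (auto simp: C_def)
    note ann = alt_form_annihilation[OF _ Q]
    fix g h z gs
    have "annihilation g \<xi> = (\<lambda>gs. (1 * annihilation g \<eta> gs + ip g f * \<theta> gs) +
        creation ip f (\<lambda>gs. - 1 * annihilation g \<theta> gs) gs)"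
      unfolding \<xi> creation_mult by (simp add: fun_eq_iff annihilation_def[abs_def] creation_Cons)
    moreover have "alt_form sm Q (\<lambda>gs. 1 * annihilation g \<eta> gs + ip g f * \<theta> gs)"
      "alt_form sm Q (\<lambda>gs. - 1 * annihilation g \<theta> gs)"
      by (intro alt_form_linear alt_form_mult alt ann)+
    ultimately show "annihilation g \<xi> \<in> C"
      unfolding C_def mem_Collect_eq by (intro exI conjI)
    have "annihilation (Q g) \<theta> = annihilation g \<theta>"
      by (simp add: fun_eq_iff annihilation_def alt_form_map_head[OF alt(2) Q])
    then show "\<xi> (Q g # gs) = \<xi> (g # gs)"
      by (simp add: \<xi> creation_Cons alt_form_map_head[OF alt(1) Q] ip_cprojection[OF S Q] f)
    have "annihilation (g + h) \<theta> = (\<lambda>gs. annihilation g \<theta> gs + annihilation h \<theta> gs)"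
      by (simp add: fun_eq_iff annihilation_def alt_form_add_head[OF alt(2)])
    then show "\<xi> ((g + h) # gs) = \<xi> (g # gs) + \<xi> (h # gs)"
      by (simp add: \<xi> creation_Cons alt_form_add_head[OF alt(1)] ip_add_left[OF S] creation_add
          algebra_simps)
    have "annihilation (sm z g) \<theta> = (\<lambda>gs. cnj z * annihilation g \<theta> gs)"
      by (simp add: fun_eq_iff annihilation_def alt_form_scale_head[OF alt(2)])
    then show "\<xi> (sm z g # gs) = cnj z * \<xi> (g # gs)"
      by (simp add: \<xi> creation_Cons alt_form_scale_head[OF alt(1)] ip_scale_left[OF S] creation_mult
          algebra_simps)
    have "annihilation g (annihilation g \<theta>) = (\<lambda>gs. 0)"
      by (simp add: fun_eq_iff annihilation_def alt_form_repeat_head[OF alt(2)])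
    then show "\<xi> (g # g # gs) = 0"
      by (simp add: \<xi> creation_Cons alt_form_repeat_head[OF alt(1)]) (simp add: annihilation_def)
  qed
qed


section \<open>The Hilbert-Schmidt norm of forms\<close>

lemma finite_distinct_lists: "finite E \<Longrightarrow> finite (distinct_lists E)"
  unfolding distinct_lists_def using finite_subset_distinct[of E] by (simp add: conj_commute)

lemma Nil_in_distinct_lists [simp]: "[] \<in> distinct_lists E"
  by (simp add: distinct_lists_def)

lemma fock_sum_nonneg: "0 \<le> fock_sum \<phi> E"
  unfolding fock_sum_def by (intro sum_nonneg) auto

lemma fock_sum_cong: "(\<And>gs. gs \<in> distinct_lists E \<Longrightarrow> cmod (\<phi> gs) = cmod (\<eta> gs)) \<Longrightarrow>
    fock_sum \<phi> E = fock_sum \<eta> E"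
  unfolding fock_sum_def by (intro sum.cong) auto

lemma fock_sum_mult: "fock_sum (\<lambda>gs. a * \<phi> gs) E = (cmod a)\<^sup>2 * fock_sum \<phi> E"
  unfolding fock_sum_def by (simp add: norm_mult power_mult_distrib sum_distrib_left)

abbreviation lists_of_length :: "nat \<Rightarrow> 'a set \<Rightarrow> 'a list set" where
  "lists_of_length n E \<equiv> {gs. set gs \<subseteq> E \<and> length gs = n}"

lemma sum_lists_of_length_Suc:
  "(\<Sum>gs\<in>lists_of_length (Suc n) E. h gs) = (\<Sum>g\<in>E. \<Sum>gs\<in>lists_of_length n E. h (g # gs))"
proof -
  have "lists_of_length (Suc n) E = (\<lambda>(g, gs). g # gs) ` (E \<times> lists_of_length n E)"
    by (auto simp: length_Suc_conv image_iff)
  moreover have "inj_on (\<lambda>(g, gs). g # gs) (E \<times> lists_of_length n E)"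
    by (auto simp: inj_on_def)
  ultimately show ?thesis by (simp add: sum.reindex sum.cartesian_product case_prod_unfold)
qed

text \<open>Lists with repetitions contribute zero, so all lists may be counted, sorted by length.
  The free bound \<open>N\<close> lets two orthonormal sets be compared degree by degree.\<close>

lemma fock_sum_degrees:
  assumes "alt_form sm Q \<phi>" "finite E" "card E < N"
  shows "fock_sum \<phi> E = (\<Sum>n<N. (\<Sum>gs\<in>lists_of_length n E. (cmod (\<phi> gs))\<^sup>2) / fact n)"
proof -
  let ?L = "\<Union>n\<in>{..<N}. lists_of_length n E"
  have fin: "finite (lists_of_length n E)" for n
    using assms(2) by (rule finite_lists_length_eq)
  have sub: "distinct_lists E \<subseteq> ?L"
  proof
    fix gs assume "gs \<in> distinct_lists E"
    then have "set gs \<subseteq> E" "length gs \<le> card E"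
      using card_mono[OF assms(2), of "set gs"] distinct_card[of gs]
      by (auto simp: distinct_lists_def)
    then show "gs \<in> ?L" using assms(3) by simp
  qed
  have "fock_sum \<phi> E = (\<Sum>gs\<in>?L. (cmod (\<phi> gs))\<^sup>2 / fact (length gs))"
    unfolding fock_sum_def
  proof (rule sum.mono_neutral_left[OF _ sub])
    show "finite ?L" using fin by blast
    show "\<forall>gs\<in>?L - distinct_lists E. (cmod (\<phi> gs))\<^sup>2 / fact (length gs) = 0"
      using alt_form_not_distinct[OF assms(1)] by (auto simp: distinct_lists_def)
  qed
  also have "\<dots> = (\<Sum>n<N. \<Sum>gs\<in>lists_of_length n E. (cmod (\<phi> gs))\<^sup>2 / fact (length gs))"
    using fin by (subst sum.UNION_disjoint) auto
  finally show ?thesis by (simp add: sum_divide_distrib)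
qed

text \<open>The orthonormal set is changed in one argument at a time:
  \<open>antilinear_bessel\<close> treats the first argument and the induction hypothesis the
  others.\<close>

lemma sum_lists_mono:
  assumes S: "fock_structure sm ip" and Q: "cprojection Q" and \<phi>: "alt_form sm Q \<phi>"
    and E: "finite E" "orthonormal E" "finite E'" "orthonormal E'" "E \<subseteq> cspan E'"
  shows "(\<Sum>gs\<in>lists_of_length n E. (cmod (\<phi> gs))\<^sup>2) \<le> (\<Sum>gs\<in>lists_of_length n E'. (cmod (\<phi> gs))\<^sup>2)"
  using \<phi>
proof (induction n arbitrary: \<phi>)
  case 0
  have "lists_of_length 0 E = {[]}" "lists_of_length 0 E' = {[]}" by auto
  then show ?case by simp
next
  case (Suc n)
  have one: "(\<Sum>g\<in>E. (cmod (\<phi> (g # gs)))\<^sup>2) \<le> (\<Sum>g\<in>E'. (cmod (\<phi> (g # gs)))\<^sup>2)" for gs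
  proof -
    from S consider "sm = scaleC" | "sm = scaleC_bar" by (auto simp: fock_structure_def)
    then show ?thesis
    proof cases
      case 1
      then show ?thesis
        using alt_form_scale_head[OF Suc.prems]
        by (intro antilinear_bessel[OF E]) (auto simp: alt_form_add_head[OF Suc.prems])
    next
      case 2
      \<comment> \<open>Forms on the conjugate space are linear for the original scalar
        multiplication, so it is their complex conjugates that are antilinear.\<close>
      have "\<phi> ((z *c g) # gs) = z * \<phi> (g # gs)" for z g
        using alt_form_scale_head[OF Suc.prems, of "cnj z"] 2 by (simp add: scaleC_bar_def)
      then have "(\<Sum>g\<in>E. (cmod (cnj (\<phi> (g # gs))))\<^sup>2) \<le> (\<Sum>g\<in>E'. (cmod (cnj (\<phi> (g # gs))))\<^sup>2)"
        by (intro antilinear_bessel[OF E]) (auto simp: alt_form_add_head[OF Suc.prems])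
      then show ?thesis by simp
    qed
  qed
  have "(\<Sum>gs\<in>lists_of_length (Suc n) E. (cmod (\<phi> gs))\<^sup>2) =
      (\<Sum>g\<in>E. \<Sum>gs\<in>lists_of_length n E. (cmod (\<phi> (g # gs)))\<^sup>2)"
    by (rule sum_lists_of_length_Suc)
  also have "\<dots> \<le> (\<Sum>g\<in>E. \<Sum>gs\<in>lists_of_length n E'. (cmod (\<phi> (g # gs)))\<^sup>2)"
    using Suc.IH[OF alt_form_annihilation[OF Suc.prems Q]]
    by (intro sum_mono) (simp add: annihilation_def)
  also have "\<dots> = (\<Sum>gs\<in>lists_of_length n E'. \<Sum>g\<in>E. (cmod (\<phi> (g # gs)))\<^sup>2)"
    by (rule sum.swap)
  also have "\<dots> \<le> (\<Sum>gs\<in>lists_of_length n E'. \<Sum>g\<in>E'. (cmod (\<phi> (g # gs)))\<^sup>2)"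
    by (intro sum_mono one)
  also have "\<dots> = (\<Sum>g\<in>E'. \<Sum>gs\<in>lists_of_length n E'. (cmod (\<phi> (g # gs)))\<^sup>2)"
    by (rule sum.swap)
  also have "\<dots> = (\<Sum>gs\<in>lists_of_length (Suc n) E'. (cmod (\<phi> gs))\<^sup>2)"
    by (rule sum_lists_of_length_Suc[symmetric])
  finally show ?case .
qed

lemma fock_sum_mono:
  assumes "fock_structure sm ip" "cprojection Q" "alt_form sm Q \<phi>"
    and "finite E" "orthonormal E" "finite E'" "orthonormal E'" "E \<subseteq> cspan E'"
  shows "fock_sum \<phi> E \<le> fock_sum \<phi> E'"
proof -
  let ?N = "Suc (max (card E) (card E'))"
  have "fock_sum \<phi> E = (\<Sum>n<?N. (\<Sum>gs\<in>lists_of_length n E. (cmod (\<phi> gs))\<^sup>2) / fact n)"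
    using assms(3,4) by (rule fock_sum_degrees) simp
  also have "\<dots> \<le> (\<Sum>n<?N. (\<Sum>gs\<in>lists_of_length n E'. (cmod (\<phi> gs))\<^sup>2) / fact n)"
    by (intro sum_mono divide_right_mono sum_lists_mono[OF assms]) auto
  also have "\<dots> = fock_sum \<phi> E'"
    using assms(3,6) by (rule fock_sum_degrees[symmetric]) simp
  finally show ?thesis .
qed

text \<open>Splits a form according to whether \<open>e\<close> is empty or occupied. A distinct
  list containing \<open>e\<close> arises from a list of length n without it by insertion at one of
  n + 1 places, all of equal modulus by antisymmetry; this count turns 1/(n+1)! into 1/n!.\<close>

lemma fock_sum_insert:
  assumes \<phi>: "alt_form sm Q \<phi>" and Q: "cprojection Q" and E: "finite E" "e \<notin> E"
  shows "fock_sum \<phi> (insert e E) = fock_sum \<phi> E + fock_sum (annihilation e \<phi>) E"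
proof -
  let ?D = "distinct_lists E" and ?h = "\<lambda>gs. (cmod (\<phi> gs))\<^sup>2 / fact (length gs) :: real"
  let ?D' = "{gs \<in> distinct_lists (insert e E). e \<in> set gs}"
  let ?S = "Sigma ?D (\<lambda>gs. {..length gs})"
  have D: "distinct_lists (insert e E) = ?D \<union> ?D'" "?D \<inter> ?D' = {}"
    using E by (auto simp: distinct_lists_def)
  have fin: "finite ?D" "finite ?D'"
    using finite_distinct_lists[of E] finite_distinct_lists[of "insert e E"] E by simp_all
  have "fock_sum \<phi> (insert e E) = fock_sum \<phi> E + (\<Sum>gs\<in>?D'. ?h gs)"
    unfolding fock_sum_def by (subst D(1)) (rule sum.union_disjoint[OF fin D(2)])
  also have "(\<Sum>gs\<in>?D'. ?h gs) = (\<Sum>(gs, k)\<in>?S. ?h (take k gs @ e # drop k gs))"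
  proof (rule sum.reindex_bij_witness[where
        i = "\<lambda>(gs, k). take k gs @ e # drop k gs" and
        j = "\<lambda>gs. (removeAll e gs, length (takeWhile (\<lambda>x. x \<noteq> e) gs))"])
    fix gs assume gs: "gs \<in> ?D'"
    then obtain as bs where ab: "gs = as @ e # bs" by (auto dest: split_list)
    with gs have d: "e \<notin> set as" "e \<notin> set bs" "distinct (as @ bs)" "set (as @ bs) \<subseteq> E"
      by (auto simp: distinct_lists_def)
    then have tw: "takeWhile (\<lambda>x. x \<noteq> e) gs = as" unfolding ab
      by (subst takeWhile_append2) auto
    have ra: "removeAll e gs = as @ bs" using d ab by simp
    show "(case (removeAll e gs, length (takeWhile (\<lambda>x. x \<noteq> e) gs)) of
        (gs, k) \<Rightarrow> take k gs @ e # drop k gs) = gs"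
      by (simp only: tw ra) (simp add: ab)
    show "(removeAll e gs, length (takeWhile (\<lambda>x. x \<noteq> e) gs)) \<in> ?S"
      using d by (simp only: tw ra) (auto simp: distinct_lists_def)
    show "(case (removeAll e gs, length (takeWhile (\<lambda>x. x \<noteq> e) gs)) of
        (gs, k) \<Rightarrow> ?h (take k gs @ e # drop k gs)) = ?h gs"
      by (simp only: tw ra) (simp add: ab)
  next
    fix p assume p: "p \<in> ?S"
    obtain gs k where gk: "p = (gs, k)" by (cases p)
    with p have gs: "distinct gs" "set gs \<subseteq> E" "k \<le> length gs" by (auto simp: distinct_lists_def)
    have e: "e \<notin> set gs" using gs E by auto
    let ?gs = "take k gs @ e # drop k gs"
    have "e \<notin> set (take k gs)" "e \<notin> set (drop k gs)"
      using e by (auto dest: in_set_takeD in_set_dropD)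
    then have "removeAll e ?gs = gs" "takeWhile (\<lambda>x. x \<noteq> e) ?gs = take k gs"
      by (simp, subst takeWhile_append2) auto
    then show "(\<lambda>gs. (removeAll e gs, length (takeWhile (\<lambda>x. x \<noteq> e) gs)))
        ((\<lambda>(gs, k). take k gs @ e # drop k gs) p) = p"
      using gk gs by simp
    have "distinct ?gs"
      using gs(1) e by (auto simp: distinct_append set_take_disj_set_drop_if_distinct
          dest: in_set_takeD in_set_dropD)
    moreover have "set ?gs \<subseteq> insert e E" using gs(2) by (auto dest: in_set_takeD in_set_dropD)
    ultimately show "(\<lambda>(gs, k). take k gs @ e # drop k gs) p \<in> ?D'"
      using gk by (simp add: distinct_lists_def)
  qed
  also have "\<dots> = (\<Sum>gs\<in>?D. \<Sum>k\<le>length gs. ?h (take k gs @ e # drop k gs))"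
    using E by (intro sum.Sigma[symmetric]) (auto simp: finite_distinct_lists)
  also have "\<dots> = fock_sum (annihilation e \<phi>) E"
    unfolding fock_sum_def
  proof (rule sum.cong[OF refl])
    fix gs :: "'a list"
    have "?h (take k gs @ e # drop k gs) = (cmod (\<phi> (e # gs)))\<^sup>2 / fact (Suc (length gs))"
      if "k \<le> length gs" for k
    proof -
      have "cmod (\<phi> (take k gs @ e # drop k gs)) = cmod (\<phi> (e # gs))"
        using alt_form_move[OF \<phi> Q, of "take k gs" e "drop k gs"]
        by (simp add: norm_mult norm_power)
      then show ?thesis using that by simp
    qed
    then have "(\<Sum>k\<le>length gs. ?h (take k gs @ e # drop k gs)) =
        real (Suc (length gs)) * ((cmod (\<phi> (e # gs)))\<^sup>2 / fact (Suc (length gs)))" by simp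
    also have "\<dots> = (cmod (\<phi> (e # gs)))\<^sup>2 / fact (length gs)"
      by (simp add: field_simps del: of_nat_Suc)
    finally show "(\<Sum>k\<le>length gs. ?h (take k gs @ e # drop k gs)) =
        (cmod (annihilation e \<phi> gs))\<^sup>2 / fact (length gs)" by (simp add: annihilation_def)
  qed
  finally show ?thesis .
qed

text \<open>Annihilating \<open>e\<close> twice gives zero, so for \<open>e\<close> in
  \<open>E\<close> only the occupied half of the sum survives.\<close>

lemma fock_sum_annihilation_unit:
  assumes \<phi>: "alt_form sm Q \<phi>" and Q: "cprojection Q" and E: "finite E" "e \<in> E"
  shows "fock_sum (annihilation e \<phi>) E \<le> fock_sum \<phi> E"
proof -
  obtain E0 where E0: "E = insert e E0" "e \<notin> E0" "finite E0"
    using E by (metis finite_insert mk_disjoint_insert)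
  have "annihilation e (annihilation e \<phi>) = (\<lambda>gs. 0)"
    by (simp add: fun_eq_iff annihilation_def alt_form_repeat_head[OF \<phi>])
  then show ?thesis
    using fock_sum_insert[OF alt_form_annihilation[OF \<phi> Q, of e] Q E0(3,2)]
      fock_sum_insert[OF \<phi> Q E0(3,2)] fock_sum_nonneg[of \<phi> E0]
    by (simp add: E0(1) fock_sum_def)
qed

text \<open>With \<open>e\<close> in \<open>E\<close>, creation carries the \<open>e\<close>-free
  half of the sum isometrically onto the occupied half, and nothing else remains.\<close>

lemma fock_sum_creation_unit:
  assumes S: "fock_structure sm ip" and \<phi>: "alt_form sm Q \<phi>" and Q: "cprojection Q" "Q e = e"
    and E: "finite E" "orthonormal E" "e \<in> E"
  shows "fock_sum (creation ip e \<phi>) E \<le> fock_sum \<phi> E"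
proof -
  obtain E0 where E0: "E = insert e E0" "e \<notin> E0" "finite E0"
    using E by (metis finite_insert mk_disjoint_insert)
  have orth: "creation ip e \<eta> gs = 0" if "gs \<in> distinct_lists E0" for \<eta> gs
  proof (rule creation_orthogonal)
    fix g assume "g \<in> set gs"
    then have "g \<in> E" "g \<noteq> e" using that E0 by (auto simp: distinct_lists_def)
    then show "ip g e = 0" using E orthonormalD[of E g e] by (simp add: ip_eq_0_iff[OF S])
  qed
  have "ip e e = 1" using E orthonormalD[of E e e] by (simp add: ip_self[OF S])
  then have "fock_sum (annihilation e (creation ip e \<phi>)) E0 = fock_sum \<phi> E0"
    by (intro fock_sum_cong) (simp add: annihilation_creation orth)
  moreover have "fock_sum (creation ip e \<phi>) E0 = 0"
    unfolding fock_sum_def by (simp add: orth)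
  ultimately show ?thesis
    using fock_sum_insert[OF alt_form_creation[OF S Q \<phi>] Q(1) E0(3,2)]
      fock_sum_insert[OF \<phi> Q(1) E0(3,2)] fock_sum_nonneg[of "annihilation e \<phi>" E0]
    by (simp add: E0(1))
qed


section \<open>The two-sided Fock space\<close>

definition alt_biform :: "('h \<Rightarrow> 'h) \<Rightarrow> 'h::complex_inner biform \<Rightarrow> bool" where
  "alt_biform P \<psi> \<longleftrightarrow> (\<forall>hs. alt_form scaleC P (\<lambda>gs. \<psi> gs hs)) \<and>
     (\<forall>gs. alt_form scaleC_bar (\<lambda>h. h - P h) (\<psi> gs))"

lemma alt_biformD:
  assumes "alt_biform P \<psi>"
  shows "alt_form scaleC P (\<lambda>gs. \<psi> gs hs)" "alt_form scaleC_bar (\<lambda>h. h - P h) (\<psi> gs)"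
  using assms by (auto simp: alt_biform_def)

abbreviation finite_onb :: "'h::complex_inner set \<Rightarrow> bool" where
  "finite_onb E \<equiv> finite E \<and> orthonormal E"

lemma fock2_eq: "fock2 P = {\<psi>. alt_biform P \<psi> \<and> bdd_above (fock2_sum \<psi> ` {E. finite_onb E})}"
  unfolding fock2_def alt_biform_def by auto

lemma fock2_alt_biform: "\<psi> \<in> fock2 P \<Longrightarrow> alt_biform P \<psi>"
  by (simp add: fock2_eq)

lemma cprojection_complement: "cprojection P \<Longrightarrow> cprojection (\<lambda>h. h - P h)"
proof -
  assume P: "cprojection P"
  have "h - P h - P (h - P h) = h - P h" for h using P by (simp add: cprojectionD)
  then show ?thesis
    using P unfolding cprojection_def by (simp add: scaleC_diff_right cinner_diff_left cinner_diff_right)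
qed

lemma alt_form_sum:
  assumes "alt_form sm Q \<eta>" "\<And>i. i \<in> I \<Longrightarrow> alt_form sm Q (\<phi> i)"
  shows "alt_form sm Q (\<lambda>gs. \<Sum>i\<in>I. \<phi> i gs)"
  using assms(2)
proof (induction I rule: infinite_finite_induct)
  case (insert i I)
  then show ?case using alt_form_linear[of sm Q "\<phi> i" "\<lambda>gs. \<Sum>i\<in>I. \<phi> i gs" 1 1] by simp
qed (use alt_form_mult[OF assms(1), of 0] in simp_all)

section \<open>Partial sums in two variables and bounds along adapted orthonormal sets\<close>

lemma fock2_sum_eq_left:
  "fock2_sum \<psi> E = (\<Sum>gs\<in>distinct_lists E. fock_sum (\<psi> gs) E / fact (length gs))"
  unfolding fock2_sum_def fock_sum_def sum_divide_distrib by (simp add: mult.commute)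

lemma fock2_sum_eq_right:
  "fock2_sum \<psi> E = (\<Sum>hs\<in>distinct_lists E. fock_sum (\<lambda>gs. \<psi> gs hs) E / fact (length hs))"
  unfolding fock2_sum_def fock_sum_def sum_divide_distrib by (subst sum.swap) simp

lemma fock2_sum_nonneg: "0 \<le> fock2_sum \<psi> E"
  unfolding fock2_sum_eq_left by (intro sum_nonneg divide_nonneg_nonneg fock_sum_nonneg) auto

lemma fock2_sum_mono_left:
  "(\<And>hs. fock_sum (\<lambda>gs. \<psi> gs hs) E \<le> fock_sum (\<lambda>gs. \<eta> gs hs) E) \<Longrightarrow>
    fock2_sum \<psi> E \<le> fock2_sum \<eta> E"
  unfolding fock2_sum_eq_right by (intro sum_mono divide_right_mono) auto

lemma fock2_sum_mono_right:
  "(\<And>gs. fock_sum (\<psi> gs) E \<le> fock_sum (\<eta> gs) E) \<Longrightarrow> fock2_sum \<psi> E \<le> fock2_sum \<eta> E"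
  unfolding fock2_sum_eq_left by (intro sum_mono divide_right_mono) auto

lemma fock2_sum_mult: "fock2_sum (\<lambda>gs hs. a * \<psi> gs hs) E = (cmod a)\<^sup>2 * fock2_sum \<psi> E"
  unfolding fock2_sum_eq_left fock_sum_mult sum_distrib_left by simp

text \<open>The set is enlarged in the second variable first, then, after exchanging the sums, in
  the first.\<close>

lemma fock2_sum_mono:
  assumes P: "cprojection P" and \<psi>: "alt_biform P \<psi>"
    and E: "finite E" "orthonormal E" "finite E'" "orthonormal E'" "E \<subseteq> cspan E'"
  shows "fock2_sum \<psi> E \<le> fock2_sum \<psi> E'"
proof -
  have "fock2_sum \<psi> E \<le> (\<Sum>gs\<in>distinct_lists E. fock_sum (\<psi> gs) E' / fact (length gs))"
    unfolding fock2_sum_eq_left using alt_biformD(2)[OF \<psi>] cprojection_complement[OF P] E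
    by (intro sum_mono divide_right_mono fock_sum_mono[OF fock_structure_cinner_bar]) auto
  also have "\<dots> = (\<Sum>hs\<in>distinct_lists E'. fock_sum (\<lambda>gs. \<psi> gs hs) E / fact (length hs))"
    unfolding fock_sum_def sum_divide_distrib by (subst sum.swap) (simp add: mult.commute)
  also have "\<dots> \<le> fock2_sum \<psi> E'"
    unfolding fock2_sum_eq_right using alt_biformD(1)[OF \<psi>] P E
    by (intro sum_mono divide_right_mono fock_sum_mono[OF fock_structure_cinner]) auto
  finally show ?thesis .
qed

lemma finite_onb_enlarge:
  assumes "finite_onb E" "cinner e e = 1"
  shows "\<exists>E'. finite_onb E' \<and> e \<in> E' \<and> E \<subseteq> cspan E'"
  using gram_schmidt[of "{e}" E] assms by (auto simp: orthonormal_def)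

text \<open>Sets containing \<open>e\<close> are cofinal: any finite orthonormal set lies in the
  span of one of them, by Gram-Schmidt started at \<open>e\<close>.\<close>

lemma fock2_sum_adapted:
  assumes P: "cprojection P" "alt_biform P \<psi>" and e: "cinner e e = 1"
    and B: "\<And>E. finite_onb E \<Longrightarrow> e \<in> E \<Longrightarrow> fock2_sum \<psi> E \<le> B" and E: "finite_onb E"
  shows "fock2_sum \<psi> E \<le> B"
proof -
  obtain E' where "finite_onb E'" "e \<in> E'" "E \<subseteq> cspan E'" using finite_onb_enlarge[OF E e] by auto
  then show ?thesis using fock2_sum_mono[OF P, of E E'] B[of E'] E by simp
qed

lemma fock2_sum_le_SUP:
  assumes "\<psi> \<in> fock2 P" "finite_onb E"
  shows "fock2_sum \<psi> E \<le> (SUP E\<in>{E. finite_onb E}. fock2_sum \<psi> E)"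
  using assms by (intro cSUP_upper) (auto simp: fock2_eq)

text \<open>The dominating form may belong to a different projection \<open>Q\<close>, which makes
  this a membership test for maps between Fock spaces as well.\<close>

lemma fock2_dominated:
  assumes "cprojection P" "alt_biform P \<xi>" "\<psi> \<in> fock2 Q" "cinner e e = 1"
    and "\<And>E. finite_onb E \<Longrightarrow> e \<in> E \<Longrightarrow> fock2_sum \<xi> E \<le> fock2_sum \<psi> E"
  shows "\<xi> \<in> fock2 P"
proof -
  have "fock2_sum \<xi> E \<le> (SUP E\<in>{E. finite_onb E}. fock2_sum \<psi> E)" if "finite_onb E" for E
    using assms(5) fock2_sum_le_SUP[OF assms(3)] order_trans
    by (intro fock2_sum_adapted[OF assms(1,2,4) _ that]) blast
  then have "bdd_above (fock2_sum \<xi> ` {E. finite_onb E})"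
    by (auto simp: bdd_above_def)
  then show ?thesis using assms(2) by (simp add: fock2_eq)
qed

lemma finite_onb_empty [simp]: "finite_onb {}"
  by (auto simp: orthonormal_def)

lemma fock2_norm_adapted:
  assumes "cprojection P" "\<psi> \<in> fock2 P" "cprojection Q" "\<xi> \<in> fock2 Q" "cinner e e = 1"
    and "\<And>E. finite_onb E \<Longrightarrow> e \<in> E \<Longrightarrow> fock2_sum \<xi> E = fock2_sum \<psi> E"
  shows "fock2_norm \<xi> = fock2_norm \<psi>"
proof -
  have ne: "{E :: 'a set. finite_onb E} \<noteq> {}" using finite_onb_empty by blast
  have "(SUP E\<in>{E. finite_onb E}. fock2_sum \<xi> E) \<le> (SUP E\<in>{E. finite_onb E}. fock2_sum \<psi> E)"
  proof (rule cSUP_least[OF ne])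
    fix E assume "E \<in> {E :: 'a set. finite_onb E}"
    then have E: "finite_onb E" by simp
    show "fock2_sum \<xi> E \<le> (SUP E\<in>{E. finite_onb E}. fock2_sum \<psi> E)"
    proof (rule fock2_sum_adapted[OF assms(3) fock2_alt_biform[OF assms(4)] assms(5) _ E])
      fix E' :: "'a set" assume E': "finite_onb E'" "e \<in> E'"
      show "fock2_sum \<xi> E' \<le> (SUP E\<in>{E. finite_onb E}. fock2_sum \<psi> E)"
        using fock2_sum_le_SUP[OF assms(2) E'(1)] assms(6)[OF E'] by linarith
    qed
  qed
  moreover have "(SUP E\<in>{E. finite_onb E}. fock2_sum \<psi> E) \<le> (SUP E\<in>{E. finite_onb E}. fock2_sum \<xi> E)"
  proof (rule cSUP_least[OF ne])
    fix E assume "E \<in> {E :: 'a set. finite_onb E}"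
    then have E: "finite_onb E" by simp
    show "fock2_sum \<psi> E \<le> (SUP E\<in>{E. finite_onb E}. fock2_sum \<xi> E)"
    proof (rule fock2_sum_adapted[OF assms(1) fock2_alt_biform[OF assms(2)] assms(5) _ E])
      fix E' :: "'a set" assume E': "finite_onb E'" "e \<in> E'"
      show "fock2_sum \<psi> E' \<le> (SUP E\<in>{E. finite_onb E}. fock2_sum \<xi> E)"
        using fock2_sum_le_SUP[OF assms(4) E'(1)] assms(6)[OF E'] by linarith
    qed
  qed
  ultimately show ?thesis unfolding fock2_norm_def by simp
qed

section \<open>Stability under linear combinations and field operators\<close>

lemma alt_biform_linear:
  "alt_biform P \<psi> \<Longrightarrow> alt_biform P \<eta> \<Longrightarrow> alt_biform P (\<lambda>gs hs. a * \<psi> gs hs + b * \<eta> gs hs)"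
  unfolding alt_biform_def by (auto intro: alt_form_linear)

text \<open>The factor 2 comes from the crude bound of the square of a sum by twice the sum of
  squares, which suffices for boundedness and continuity.\<close>

lemma fock2_sum_linear_le:
  "fock2_sum (\<lambda>gs hs. a * \<psi> gs hs + b * \<eta> gs hs) E \<le>
    2 * (cmod a)\<^sup>2 * fock2_sum \<psi> E + 2 * (cmod b)\<^sup>2 * fock2_sum \<eta> E"
proof -
  have sq: "(cmod (x + y))\<^sup>2 \<le> 2 * (cmod x)\<^sup>2 + 2 * (cmod y)\<^sup>2" for x y
  proof -
    have "(cmod (x + y))\<^sup>2 \<le> (cmod x + cmod y)\<^sup>2"
      by (intro power_mono norm_triangle_ineq) auto
    also have "\<dots> \<le> 2 * (cmod x)\<^sup>2 + 2 * (cmod y)\<^sup>2"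
      using zero_le_power2[of "cmod x - cmod y"] unfolding power2_sum power2_diff by linarith
    finally show ?thesis .
  qed
  have "fock2_sum (\<lambda>gs hs. a * \<psi> gs hs + b * \<eta> gs hs) E \<le>
     (\<Sum>gs\<in>distinct_lists E. \<Sum>hs\<in>distinct_lists E.
      (2 * (cmod (a * \<psi> gs hs))\<^sup>2 + 2 * (cmod (b * \<eta> gs hs))\<^sup>2) / (fact (length gs) * fact (length hs)))"
    unfolding fock2_sum_def by (intro sum_mono divide_right_mono sq) auto
  also have "\<dots> = 2 * fock2_sum (\<lambda>gs hs. a * \<psi> gs hs) E + 2 * fock2_sum (\<lambda>gs hs. b * \<eta> gs hs) E"
    unfolding fock2_sum_def by (simp add: sum_distrib_left sum.distrib add_divide_distrib)
  finally show ?thesis by (simp add: fock2_sum_mult)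
qed

lemma fock2_linear:
  assumes "\<psi> \<in> fock2 P" "\<eta> \<in> fock2 P"
  shows "(\<lambda>gs hs. a * \<psi> gs hs + b * \<eta> gs hs) \<in> fock2 P"
proof -
  let ?S = "\<lambda>\<psi>. SUP E\<in>{E. finite_onb E}. fock2_sum \<psi> E"
  have "fock2_sum (\<lambda>gs hs. a * \<psi> gs hs + b * \<eta> gs hs) E \<le>
      2 * (cmod a)\<^sup>2 * ?S \<psi> + 2 * (cmod b)\<^sup>2 * ?S \<eta>" if "finite_onb E" for E
    using fock2_sum_le_SUP[OF assms(1) that] fock2_sum_le_SUP[OF assms(2) that]
    by (intro order_trans[OF fock2_sum_linear_le] add_mono mult_left_mono) auto
  then have "bdd_above (fock2_sum (\<lambda>gs hs. a * \<psi> gs hs + b * \<eta> gs hs) ` {E. finite_onb E})"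
    unfolding bdd_above_def by blast
  then show ?thesis using assms alt_biform_linear by (auto simp: fock2_eq)
qed

lemma fock2_mult: "\<psi> \<in> fock2 P \<Longrightarrow> (\<lambda>gs hs. a * \<psi> gs hs) \<in> fock2 P"
  using fock2_linear[of \<psi> P \<psi> a 0] by simp

lemma fock2_add: "\<psi> \<in> fock2 P \<Longrightarrow> \<eta> \<in> fock2 P \<Longrightarrow> (\<lambda>gs hs. \<psi> gs hs + \<eta> gs hs) \<in> fock2 P"
  using fock2_linear[of \<psi> P \<eta> 1 1] by simp

lemma alt_form_parity: "alt_form sm Q \<phi> \<Longrightarrow> alt_form sm Q (\<lambda>gs. (- 1) ^ length gs * \<phi> gs)"
  unfolding alt_form_def by (auto simp: algebra_simps)

lemma alt_biform_parity_left:
  "alt_biform P \<psi> \<Longrightarrow> alt_biform P (\<lambda>gs hs. (- 1) ^ length gs * \<psi> gs hs)"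
  unfolding alt_biform_def by (auto intro: alt_form_parity alt_form_mult)

lemma alt_biform_parity_right:
  "alt_biform P \<psi> \<Longrightarrow> alt_biform P (\<lambda>gs hs. (- 1) ^ length hs * \<psi> gs hs)"
  unfolding alt_biform_def by (auto intro: alt_form_parity alt_form_mult)

lemma fock2_parity: "\<psi> \<in> fock2 P \<Longrightarrow> (\<lambda>gs hs. (- 1) ^ length gs * \<psi> gs hs) \<in> fock2 P"
proof -
  have "fock2_sum (\<lambda>gs hs. (- 1) ^ length gs * \<psi> gs hs) = fock2_sum \<psi>"
    unfolding fock2_sum_def by (simp add: fun_eq_iff norm_mult norm_power)
  then show "\<psi> \<in> fock2 P \<Longrightarrow> (\<lambda>gs hs. (- 1) ^ length gs * \<psi> gs hs) \<in> fock2 P"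
    by (simp add: fock2_eq alt_biform_parity_left)
qed

lemma alt_biform_annihilation_left:
  assumes "cprojection P" "alt_biform P \<psi>"
  shows "alt_biform P (\<lambda>gs hs. \<psi> (g # gs) hs)"
  using alt_form_annihilation[OF alt_biformD(1)[OF assms(2)] assms(1), where g = g]
    alt_biformD(2)[OF assms(2)]
  unfolding alt_biform_def annihilation_def[abs_def] by blast

lemma alt_biform_annihilation_right:
  assumes "cprojection P" "alt_biform P \<psi>"
  shows "alt_biform P (\<lambda>gs hs. \<psi> gs (h # hs))"
  using alt_form_annihilation[OF alt_biformD(2)[OF assms(2)] cprojection_complement[OF assms(1)],
      where g = h]
    alt_biformD(1)[OF assms(2)]
  unfolding alt_biform_def annihilation_def[abs_def] by blast

lemma alt_biform_creation_left:
  assumes "cprojection P" "alt_biform P \<psi>" "P f = f"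
  shows "alt_biform P (\<lambda>gs hs. creation cinner f (\<lambda>gs'. \<psi> gs' hs) gs)"
proof -
  have "alt_form scaleC_bar (\<lambda>h. h - P h) (\<lambda>hs. creation cinner f (\<lambda>gs'. \<psi> gs' hs) gs)" for gs
    unfolding creation_def using alt_biformD(2)[OF assms(2)]
    by (intro alt_form_sum[where \<eta> = "\<psi> []"] alt_form_mult)
  moreover have "alt_form scaleC P (\<lambda>gs. creation cinner f (\<lambda>gs'. \<psi> gs' hs) gs)" for hs
    using alt_form_creation[OF fock_structure_cinner assms(1,3) alt_biformD(1)[OF assms(2)]] .
  ultimately show ?thesis unfolding alt_biform_def by blast
qed

lemma alt_biform_creation_right:
  assumes "cprojection P" "alt_biform P \<psi>" "P f = 0"
  shows "alt_biform P (\<lambda>gs hs. creation cinner_bar f (\<psi> gs) hs)"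
proof -
  have "alt_form scaleC P (\<lambda>gs. creation cinner_bar f (\<psi> gs) hs)" for hs
    unfolding creation_def using alt_biformD(1)[OF assms(2)]
    by (intro alt_form_sum[where \<eta> = "\<lambda>gs. \<psi> gs []"] alt_form_mult)
  moreover have "alt_form scaleC_bar (\<lambda>h. h - P h) (\<lambda>hs. creation cinner_bar f (\<psi> gs) hs)" for gs
    using alt_form_creation[OF fock_structure_cinner_bar cprojection_complement[OF assms(1)] _
        alt_biformD(2)[OF assms(2)], of f] assms(3) by simp
  ultimately show ?thesis unfolding alt_biform_def by blast
qed

text \<open>Adapted orthonormal sets need a unit vector, so operators indexed by \<open>f\<close>
  are treated by scaling. The expression of \<open>e\<close> through \<open>f\<close> passes
  conditions such as \<open>P f = f\<close> on to \<open>e\<close>.\<close>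

lemma unit_vector_cases:
  fixes f :: "'h::complex_inner"
  obtains "f = 0" | r e where "f = of_real r *c e" "cinner e e = 1" "r \<noteq> 0"
    "e = of_real (1 / r) *c f"
  using normalize_cinner[of f] that(2)[of "norm f" "of_real (1 / norm f) *c f"]
  by (cases "f = 0") (auto simp: scaleC_scaleC that(1))

lemma fock2_annihilation_left:
  assumes P: "cprojection P" and \<psi>: "\<psi> \<in> fock2 P"
  shows "(\<lambda>gs hs. \<psi> (g # gs) hs) \<in> fock2 P"
proof -
  note alt = alt_biformD(1)[OF fock2_alt_biform[OF \<psi>]]
  have scale: "\<psi> ((a *c g) # gs) hs = cnj a * \<psi> (g # gs) hs" for a g gs hs
    using alt_form_scale_head[OF alt] .
  show ?thesis
  proof (cases g rule: unit_vector_cases)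
    case 1
    then show ?thesis using fock2_mult[OF \<psi>, of 0] scale[of 0 0] by simp
  next
    case (2 r e)
    have "(\<lambda>gs hs. \<psi> (e # gs) hs) \<in> fock2 P"
      using fock_sum_annihilation_unit[OF alt P]
      by (intro fock2_dominated[OF P alt_biform_annihilation_left[OF P fock2_alt_biform[OF \<psi>]] \<psi> 2(2)]
          fock2_sum_mono_left) (auto simp: annihilation_def[abs_def])
    then show ?thesis unfolding 2(1) scale by (rule fock2_mult)
  qed
qed

lemma fock2_annihilation_right:
  assumes P: "cprojection P" and \<psi>: "\<psi> \<in> fock2 P"
  shows "(\<lambda>gs hs. \<psi> gs (h # hs)) \<in> fock2 P"
proof -
  note alt = alt_biformD(2)[OF fock2_alt_biform[OF \<psi>]]
  have scale: "\<psi> gs ((a *c g) # hs) = a * \<psi> gs (g # hs)" for a g gs hs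
    using alt_form_scale_head[OF alt, of gs "cnj a"] by (simp add: scaleC_bar_def)
  show ?thesis
  proof (cases h rule: unit_vector_cases)
    case 1
    then show ?thesis using fock2_mult[OF \<psi>, of 0] scale[of _ 0 0] by simp
  next
    case (2 r e)
    have "(\<lambda>gs hs. \<psi> gs (e # hs)) \<in> fock2 P"
      using fock_sum_annihilation_unit[OF alt cprojection_complement[OF P]]
      by (intro fock2_dominated[OF P alt_biform_annihilation_right[OF P fock2_alt_biform[OF \<psi>]] \<psi> 2(2)]
          fock2_sum_mono_right) (auto simp: annihilation_def[abs_def])
    then show ?thesis unfolding 2(1) scale by (rule fock2_mult)
  qed
qed

lemma fock2_creation_left:
  assumes P: "cprojection P" and \<psi>: "\<psi> \<in> fock2 P" and f: "P f = f"
  shows "(\<lambda>gs hs. creation cinner f (\<lambda>gs'. \<psi> gs' hs) gs) \<in> fock2 P"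
proof (cases f rule: unit_vector_cases)
  case 1
  then show ?thesis using fock2_mult[OF \<psi>, of 0] by (simp add: creation_def)
next
  case (2 r e)
  note alt = alt_biformD(1)[OF fock2_alt_biform[OF \<psi>]]
  have e: "P e = e" using f 2(4) cprojection_scale[OF P] by metis
  have "(\<lambda>gs hs. creation cinner e (\<lambda>gs'. \<psi> gs' hs) gs) \<in> fock2 P"
    using fock_sum_creation_unit[OF fock_structure_cinner alt P e]
    by (intro fock2_dominated[OF P alt_biform_creation_left[OF P fock2_alt_biform[OF \<psi>] e] \<psi> 2(2)]
        fock2_sum_mono_left) auto
  then show ?thesis unfolding 2(1) creation_cinner_scale by (rule fock2_mult)
qed

lemma fock2_creation_right:
  assumes P: "cprojection P" and \<psi>: "\<psi> \<in> fock2 P" and f: "P f = 0"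
  shows "(\<lambda>gs hs. creation cinner_bar f (\<psi> gs) hs) \<in> fock2 P"
proof (cases f rule: unit_vector_cases)
  case 1
  then show ?thesis
    using fock2_mult[OF \<psi>, of 0] by (simp add: creation_def cinner_bar_def)
next
  case (2 r e)
  note alt = alt_biformD(2)[OF fock2_alt_biform[OF \<psi>]]
  have e: "P e = 0" using f 2(4) cprojection_scale[OF P] by (metis scaleC_zero_right)
  have "(\<lambda>gs hs. creation cinner_bar e (\<psi> gs) hs) \<in> fock2 P"
    using fock_sum_creation_unit[OF fock_structure_cinner_bar alt cprojection_complement[OF P]] e
    by (intro fock2_dominated[OF P alt_biform_creation_right[OF P fock2_alt_biform[OF \<psi>] e] \<psi> 2(2)]
        fock2_sum_mono_right) auto
  then show ?thesis unfolding 2(1) creation_bar_scale by (rule fock2_mult)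
qed

lemma qf_creation_eq:
  "qf_creation P f \<psi> = (\<lambda>gs hs. creation cinner (P f) (\<lambda>gs'. \<psi> gs' hs) gs +
     (- 1) ^ length gs * \<psi> gs ((f - P f) # hs))"
  by (simp add: fun_eq_iff qf_creation_def on_left_def on_right_def parity_def annihilation_def)

lemma qf_annihilation_eq:
  "qf_annihilation P f \<psi> = (\<lambda>gs hs. \<psi> (P f # gs) hs +
     (- 1) ^ length gs * creation cinner_bar (f - P f) (\<psi> gs) hs)"
  by (simp add: fun_eq_iff qf_annihilation_def on_left_def on_right_def parity_def annihilation_def)

lemma fock2_qf_creation:
  assumes P: "cprojection P" and \<psi>: "\<psi> \<in> fock2 P"
  shows "qf_creation P f \<psi> \<in> fock2 P"
  unfolding qf_creation_eq
  by (intro fock2_add fock2_creation_left fock2_parity fock2_annihilation_right P \<psi>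
      cprojection_idem)

lemma fock2_qf_annihilation:
  assumes P: "cprojection P" and \<psi>: "\<psi> \<in> fock2 P"
  shows "qf_annihilation P f \<psi> \<in> fock2 P"
  unfolding qf_annihilation_eq
  by (intro fock2_add fock2_annihilation_left P \<psi>
      fock2_parity[of "\<lambda>gs hs. creation cinner_bar (f - P f) (\<psi> gs) hs"] fock2_creation_right)
     (simp add: cprojectionD[OF P])


section \<open>Intertwiners\<close>

abbreviation fock2_vacuum :: "'h biform" where
  "fock2_vacuum \<equiv> tensor vacuum vacuum"

lemma fock2_sum_add_vacuum:
  assumes "finite E"
  shows "fock2_sum (\<lambda>gs hs. \<psi> gs hs + t * fock2_vacuum gs hs) E =
    fock2_sum \<psi> E + (2 * Re (cnj t * \<psi> [] []) + (cmod t)\<^sup>2)"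
proof -
  let ?c = "2 * Re (cnj t * \<psi> [] []) + (cmod t)\<^sup>2"
  have "(cmod (\<psi> gs hs + t * fock2_vacuum gs hs))\<^sup>2 / (fact (length gs) * fact (length hs)) =
      (cmod (\<psi> gs hs))\<^sup>2 / (fact (length gs) * fact (length hs)) +
      (if gs = [] then if hs = [] then ?c else 0 else 0)" for gs hs
    unfolding cmod_power2 by (simp add: tensor_def vacuum_def power2_eq_square algebra_simps)
  then have "fock2_sum (\<lambda>gs hs. \<psi> gs hs + t * fock2_vacuum gs hs) E = fock2_sum \<psi> E +
      (\<Sum>gs\<in>distinct_lists E. \<Sum>hs\<in>distinct_lists E. if gs = [] then if hs = [] then ?c else 0 else 0)"
    unfolding fock2_sum_def by (simp only: sum.distrib)
  also have "(\<Sum>gs\<in>distinct_lists E. \<Sum>hs\<in>distinct_lists E. if gs = [] then if hs = [] then ?c else 0 else 0) =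
      (\<Sum>gs\<in>distinct_lists E. if gs = [] then ?c else 0)"
    using finite_distinct_lists[OF assms] by (intro sum.cong) auto
  also have "\<dots> = ?c" using finite_distinct_lists[OF assms] by simp
  finally show ?thesis .
qed

text \<open>Polarisation against the vacuum: the correction term is the same for every orthonormal
  set, hence passes through the supremum. It makes the vacuum component \<open>\<psi> [] []\<close>
  visible to norm-preserving maps.\<close>

lemma fock2_norm_add_vacuum:
  assumes "\<psi> \<in> fock2 P"
  shows "(fock2_norm (\<lambda>gs hs. \<psi> gs hs + t * fock2_vacuum gs hs))\<^sup>2 =
    (fock2_norm \<psi>)\<^sup>2 + (2 * Re (cnj t * \<psi> [] []) + (cmod t)\<^sup>2)"
proof -
  let ?c = "2 * Re (cnj t * \<psi> [] []) + (cmod t)\<^sup>2" and ?A = "{E :: 'a set. finite_onb E}"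
  let ?\<xi> = "\<lambda>gs hs. \<psi> gs hs + t * fock2_vacuum gs hs"
  have ne: "?A \<noteq> {}" using finite_onb_empty by blast
  have eq: "fock2_sum ?\<xi> E = fock2_sum \<psi> E + ?c" if "finite_onb E" for E
    using that by (intro fock2_sum_add_vacuum) auto
  have le: "fock2_sum \<psi> E \<le> (SUP E\<in>?A. fock2_sum \<psi> E)" if "finite_onb E" for E
    using fock2_sum_le_SUP[OF assms that] .
  have bdd: "bdd_above (fock2_sum ?\<xi> ` ?A)"
    unfolding bdd_above_def using le by (intro exI[of _ "(SUP E\<in>?A. fock2_sum \<psi> E) + ?c"]) (auto simp: eq)
  have "(SUP E\<in>?A. fock2_sum ?\<xi> E) \<le> (SUP E\<in>?A. fock2_sum \<psi> E) + ?c"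
    using le by (intro cSUP_least[OF ne]) (simp add: eq)
  moreover have "(SUP E\<in>?A. fock2_sum \<psi> E) \<le> (SUP E\<in>?A. fock2_sum ?\<xi> E) - ?c"
  proof (rule cSUP_least[OF ne])
    fix E assume "E \<in> ?A"
    then show "fock2_sum \<psi> E \<le> (SUP E\<in>?A. fock2_sum ?\<xi> E) - ?c"
      using cSUP_upper[OF _ bdd, of E] eq[of E] by simp
  qed
  ultimately have "(SUP E\<in>?A. fock2_sum ?\<xi> E) = (SUP E\<in>?A. fock2_sum \<psi> E) + ?c" by simp
  moreover have "0 \<le> (SUP E\<in>?A. fock2_sum \<psi> E)" "0 \<le> (SUP E\<in>?A. fock2_sum ?\<xi> E)"
    using order_trans[OF fock2_sum_nonneg fock2_sum_le_SUP[OF assms finite_onb_empty]]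
      order_trans[OF fock2_sum_nonneg cSUP_upper[OF _ bdd, of "{}"]] by auto
  ultimately show ?thesis unfolding fock2_norm_def by simp
qed

lemma fock2_vacuum_in_fock2: "fock2_vacuum \<in> fock2 P"
proof -
  have "alt_form scaleC P (\<lambda>gs. vacuum gs * vacuum hs)" for hs :: "'a list"
    using alt_form_mult[OF alt_form_vacuum, of scaleC P "vacuum hs"] by (simp only: mult.commute)
  then have "alt_biform P fock2_vacuum"
    unfolding alt_biform_def tensor_def[abs_def]
    using alt_form_mult[OF alt_form_vacuum] by blast
  moreover have "alt_biform P (\<lambda>gs hs. 0)"
    by (auto simp: alt_biform_def alt_form_def)
  moreover have "fock2_sum fock2_vacuum E = 1" if "finite E" for E :: "'a set"
    using fock2_sum_add_vacuum[OF that, of "\<lambda>gs hs. 0" 1] by (simp add: fock2_sum_def)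
  ultimately show ?thesis by (auto simp: fock2_eq intro!: bdd_aboveI[of _ 1])
qed

lemma fock2_norm_nonneg: "\<psi> \<in> fock2 P \<Longrightarrow> 0 \<le> fock2_norm \<psi>"
  unfolding fock2_norm_def
  using order_trans[OF fock2_sum_nonneg fock2_sum_le_SUP[OF _ finite_onb_empty]] by simp

lemma fock2_norm_zero: "fock2_norm (\<lambda>gs hs. 0) = 0"
proof -
  have "{E :: 'a set. finite_onb E} \<noteq> {}" using finite_onb_empty by blast
  then show ?thesis by (simp add: fock2_norm_def fock2_sum_def)
qed

lemma fock2_norm_vacuum:
  "fock2_norm (\<lambda>gs hs. t * (fock2_vacuum :: 'h::complex_inner biform) gs hs) = cmod t"
proof -
  let ?\<Omega> = "fock2_vacuum :: 'h biform"
  have "(\<lambda>gs hs. 0) \<in> fock2 (id :: 'h \<Rightarrow> 'h)"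
    using fock2_mult[OF fock2_vacuum_in_fock2, of 0] by simp
  from fock2_norm_add_vacuum[OF this, of t]
  have "(fock2_norm (\<lambda>gs hs. t * ?\<Omega> gs hs))\<^sup>2 = (cmod t)\<^sup>2" by (simp add: fock2_norm_zero)
  moreover have "0 \<le> fock2_norm (\<lambda>gs hs. t * ?\<Omega> gs hs)"
    by (intro fock2_norm_nonneg[of _ id] fock2_mult fock2_vacuum_in_fock2)
  ultimately show ?thesis by (simp add: power2_eq_iff_nonneg)
qed

lemma qf_annihilation_range:
  assumes "cprojection P" "alt_biform P \<psi>"
  shows "qf_annihilation P (P g) \<psi> = (\<lambda>gs hs. \<psi> (g # gs) hs)"
  unfolding qf_annihilation_eq
  by (simp add: fun_eq_iff cprojectionD[OF assms(1)] creation_def cinner_bar_def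
      alt_form_map_head[OF alt_biformD(1)[OF assms(2)] assms(1)])

lemma qf_creation_complement:
  assumes "cprojection P" "alt_biform P \<psi>"
  shows "qf_creation P (h - P h) \<psi> = (\<lambda>gs hs. (- 1) ^ length gs * \<psi> gs (h # hs))"
  using alt_form_map_head[OF alt_biformD(2)[OF assms(2)] cprojection_complement[OF assms(1)]]
  unfolding qf_creation_eq by (simp add: fun_eq_iff cprojectionD[OF assms(1)] creation_def)

text \<open>Uniqueness of the vacuum. On arguments in the range of \<open>P\<close>,
  \<open>qf_annihilation\<close> removes particles; on the complement, \<open>qf_creation\<close>
  removes antiparticles. A vector killed by all of these lives on the pair of empty lists.\<close>

lemma killed_by_annihilators:
  assumes P: "cprojection P" "alt_biform P \<psi>"
    and ann: "\<And>g. qf_annihilation P (P g) \<psi> = (\<lambda>gs hs. 0)"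
    and cre: "\<And>h. qf_creation P (h - P h) \<psi> = (\<lambda>gs hs. 0)"
  shows "\<psi> = (\<lambda>gs hs. \<psi> [] [] * fock2_vacuum gs hs)"
proof -
  have "\<psi> (g # gs) hs = 0" "\<psi> gs (h # hs) = 0" for g h gs hs
    using ann[of g] cre[of h]
    unfolding qf_annihilation_range[OF P] qf_creation_complement[OF P] by (auto simp: fun_eq_iff)
  then show ?thesis
    by (auto simp: fun_eq_iff tensor_def vacuum_def) (metis neq_Nil_conv)+
qed

section \<open>Composition, inversion and uniqueness of intertwiners\<close>

lemma fock2_unitaryD:
  assumes "fock2_unitary P Q T"
  shows "bij_betw T (fock2 P) (fock2 Q)"
    and "\<psi> \<in> fock2 P \<Longrightarrow> \<eta> \<in> fock2 P \<Longrightarrow>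
      T (\<lambda>gs hs. a * \<psi> gs hs + b * \<eta> gs hs) = (\<lambda>gs hs. a * T \<psi> gs hs + b * T \<eta> gs hs)"
    and "\<psi> \<in> fock2 P \<Longrightarrow> fock2_norm (T \<psi>) = fock2_norm \<psi>"
    and "\<psi> \<in> fock2 P \<Longrightarrow> T \<psi> \<in> fock2 Q"
    and "\<psi> \<in> fock2 P \<Longrightarrow> T (\<lambda>gs hs. a * \<psi> gs hs) = (\<lambda>gs hs. a * T \<psi> gs hs)"
proof -
  show *: "bij_betw T (fock2 P) (fock2 Q)"
    "\<psi> \<in> fock2 P \<Longrightarrow> \<eta> \<in> fock2 P \<Longrightarrow>
      T (\<lambda>gs hs. a * \<psi> gs hs + b * \<eta> gs hs) = (\<lambda>gs hs. a * T \<psi> gs hs + b * T \<eta> gs hs)"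
    "\<psi> \<in> fock2 P \<Longrightarrow> fock2_norm (T \<psi>) = fock2_norm \<psi>" for \<psi> \<eta> a b
    using assms unfolding fock2_unitary_def by blast+
  show "\<psi> \<in> fock2 P \<Longrightarrow> T \<psi> \<in> fock2 Q" using *(1) bij_betwE by blast
  show "\<psi> \<in> fock2 P \<Longrightarrow> T (\<lambda>gs hs. a * \<psi> gs hs) = (\<lambda>gs hs. a * T \<psi> gs hs)"
    using *(2)[of \<psi> \<psi> a 0] by simp
qed

lemma intertwinesD:
  assumes "intertwines P Q T" "\<psi> \<in> fock2 P"
  shows "T (qf_creation P f \<psi>) = qf_creation Q f (T \<psi>)"
    and "T (qf_annihilation P f \<psi>) = qf_annihilation Q f (T \<psi>)"
  using assms unfolding intertwines_def by blast+

lemma fock2_unitary_compose: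
  "fock2_unitary P Q T \<Longrightarrow> fock2_unitary Q R T' \<Longrightarrow> fock2_unitary P R (\<lambda>\<psi>. T' (T \<psi>))"
  using fock2_unitaryD(4)[of P Q T] bij_betw_trans[of T "fock2 P" "fock2 Q" T' "fock2 R"]
  unfolding fock2_unitary_def comp_def by simp

lemma intertwines_compose:
  "fock2_unitary P Q T \<Longrightarrow> intertwines P Q T \<Longrightarrow> intertwines Q R T' \<Longrightarrow>
    intertwines P R (\<lambda>\<psi>. T' (T \<psi>))"
  using fock2_unitaryD(4)[of P Q T] unfolding intertwines_def by simp

lemma fock2_unitary_inverse:
  assumes "fock2_unitary P Q T"
  shows "fock2_unitary Q P (the_inv_into (fock2 P) T)"
proof -
  let ?S = "the_inv_into (fock2 P) T"
  note T = fock2_unitaryD[OF assms]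
  have inj: "inj_on T (fock2 P)" and img: "T ` fock2 P = fock2 Q"
    using T(1) by (auto simp: bij_betw_def)
  have bij: "bij_betw ?S (fock2 Q) (fock2 P)" using T(1) by (rule bij_betw_the_inv_into)
  have S: "?S \<psi> \<in> fock2 P" "T (?S \<psi>) = \<psi>" if "\<psi> \<in> fock2 Q" for \<psi>
    using that bij f_the_inv_into_f[OF inj] img by (auto simp: bij_betw_def)
  have "?S (\<lambda>gs hs. a * \<psi> gs hs + b * \<eta> gs hs) = (\<lambda>gs hs. a * ?S \<psi> gs hs + b * ?S \<eta> gs hs)"
    if "\<psi> \<in> fock2 Q" "\<eta> \<in> fock2 Q" for \<psi> \<eta> a b
    using that S T(2)[of "?S \<psi>" "?S \<eta>" a b]
    by (intro the_inv_into_f_eq[OF inj] fock2_linear) auto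
  moreover have "fock2_norm (?S \<psi>) = fock2_norm \<psi>" if "\<psi> \<in> fock2 Q" for \<psi>
    using T(3)[of "?S \<psi>"] S[OF that] by simp
  ultimately show ?thesis using bij unfolding fock2_unitary_def by blast
qed

lemma intertwines_inverse:
  assumes P: "cprojection P" and "fock2_unitary P Q T" "intertwines P Q T"
  shows "intertwines Q P (the_inv_into (fock2 P) T)"
proof -
  let ?S = "the_inv_into (fock2 P) T"
  have inj: "inj_on T (fock2 P)" and img: "T ` fock2 P = fock2 Q"
    using fock2_unitaryD(1)[OF assms(2)] by (auto simp: bij_betw_def)
  have "?S (qf_creation Q f \<psi>) = qf_creation P f (?S \<psi>) \<and>
      ?S (qf_annihilation Q f \<psi>) = qf_annihilation P f (?S \<psi>)" if "\<psi> \<in> fock2 Q" for f \<psi>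
  proof -
    have S: "?S \<psi> \<in> fock2 P" "T (?S \<psi>) = \<psi>"
      using that fock2_unitaryD(4)[OF fock2_unitary_inverse[OF assms(2)]] f_the_inv_into_f[OF inj] img
      by auto
    then show ?thesis
      using assms(3) P unfolding intertwines_def
      by (intro conjI the_inv_into_f_eq[OF inj] fock2_qf_creation fock2_qf_annihilation) auto
  qed
  then show ?thesis unfolding intertwines_def by blast
qed

text \<open>Irreducibility. A vector is determined by the vacuum components of its images under the
  generators, and a unitary which fixes the vacuum line preserves vacuum components.\<close>

lemma intertwiner_scalar:
  assumes P: "cprojection P" and S: "fock2_unitary P P S" "intertwines P P S"
  shows "\<exists>z. \<forall>\<psi>\<in>fock2 P. S \<psi> = (\<lambda>gs hs. z * \<psi> gs hs)"
proof -
  note SD = fock2_unitaryD[OF S(1)]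
  note \<Omega> = fock2_vacuum_in_fock2[of P]
  note alt = fock2_alt_biform
  have ann: "S (\<lambda>gs hs. \<psi> (g # gs) hs) = (\<lambda>gs hs. S \<psi> (g # gs) hs)" if "\<psi> \<in> fock2 P" for g \<psi>
    using intertwinesD(2)[OF S(2) that, of "P g"]
    unfolding qf_annihilation_range[OF P alt[OF that]] qf_annihilation_range[OF P alt[OF SD(4)[OF that]]] .
  have cre: "S (\<lambda>gs hs. (- 1) ^ length gs * \<psi> gs (h # hs)) = (\<lambda>gs hs. (- 1) ^ length gs * S \<psi> gs (h # hs))"
    if "\<psi> \<in> fock2 P" for h \<psi>
    using intertwinesD(1)[OF S(2) that, of "h - P h"]
    unfolding qf_creation_complement[OF P alt[OF that]] qf_creation_complement[OF P alt[OF SD(4)[OF that]]] .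
  have zero: "S (\<lambda>gs hs. 0) = (\<lambda>gs hs. 0)" using SD(5)[OF \<Omega>, of 0] by simp
  define z where "z = S fock2_vacuum [] []"
  \<comment> \<open>The image is killed by the same operators as the vacuum, hence stays on the
    vacuum line.\<close>
  have S\<Omega>: "S fock2_vacuum = (\<lambda>gs hs. z * fock2_vacuum gs hs)"
    unfolding z_def
  proof (rule killed_by_annihilators[OF P alt[OF SD(4)[OF \<Omega>]]])
    show "qf_annihilation P (P g) (S fock2_vacuum) = (\<lambda>gs hs. 0)" for g
      using ann[OF \<Omega>, of g] zero
      by (simp add: qf_annihilation_range[OF P alt[OF SD(4)[OF \<Omega>]]] tensor_def vacuum_def)
    show "qf_creation P (h - P h) (S fock2_vacuum) = (\<lambda>gs hs. 0)" for h
      using cre[OF \<Omega>, of h] zero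
      by (simp add: qf_creation_complement[OF P alt[OF SD(4)[OF \<Omega>]]] tensor_def vacuum_def)
  qed
  have z: "cmod z = 1"
    using SD(3)[OF \<Omega>] fock2_norm_vacuum[of z, where 'h = 'a]
      fock2_norm_vacuum[of 1, where 'h = 'a] by (simp add: S\<Omega>)
  have vac: "S \<psi> [] [] = z * \<psi> [] []" if \<psi>: "\<psi> \<in> fock2 P" for \<psi>
  proof -
    \<comment> \<open>Compares the norm of \<open>\<psi>\<close> plus t times the vacuum with that
      of its image; t = 1 and t = \<open>\<i>\<close> then recover both parts of the vacuum
      component.\<close>
    have *: "Re (cnj t * \<psi> [] []) = Re (cnj (t * z) * S \<psi> [] [])" for t
    proof -
      have "S (\<lambda>gs hs. \<psi> gs hs + t * fock2_vacuum gs hs) =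
          (\<lambda>gs hs. S \<psi> gs hs + (t * z) * fock2_vacuum gs hs)"
        using SD(2)[OF \<psi> \<Omega>, of 1 t] by (simp add: S\<Omega> mult.assoc)
      moreover have "(\<lambda>gs hs. \<psi> gs hs + t * fock2_vacuum gs hs) \<in> fock2 P"
        using fock2_linear[OF \<psi> \<Omega>, of 1 t] by simp
      ultimately show ?thesis
        using SD(3)[of "\<lambda>gs hs. \<psi> gs hs + t * fock2_vacuum gs hs"] SD(3)[OF \<psi>]
          fock2_norm_add_vacuum[OF \<psi>, of t] fock2_norm_add_vacuum[OF SD(4)[OF \<psi>], of "t * z"] z
        by (simp add: norm_mult)
    qed
    have "\<psi> [] [] = cnj z * S \<psi> [] []"
      using *[of 1] *[of \<i>] by (simp add: complex_eq_iff)
    moreover have "z * cnj z = 1" using z by (simp add: complex_norm_square[symmetric])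
    ultimately show ?thesis by (simp add: mult.assoc[symmetric])
  qed
  \<comment> \<open>The antiparticle list is shortened first, while the particle list is empty and
    the sign in \<open>cre\<close> is 1.\<close>
  have "S \<psi> [] hs = z * \<psi> [] hs" if "\<psi> \<in> fock2 P" for \<psi> hs
    using that
  proof (induction hs arbitrary: \<psi>)
    case (Cons h hs)
    have "(\<lambda>gs hs. (- 1) ^ length gs * \<psi> gs (h # hs)) \<in> fock2 P"
      by (intro fock2_parity fock2_annihilation_right P Cons.prems)
    from Cons.IH[OF this] show ?case by (simp add: cre[OF Cons.prems])
  qed (rule vac)
  then have "S \<psi> gs hs = z * \<psi> gs hs" if "\<psi> \<in> fock2 P" for \<psi> gs hs
    using that
  proof (induction gs arbitrary: \<psi>)
    case (Cons g gs)
    from Cons.IH[OF Cons.prems(1) fock2_annihilation_left[OF P Cons.prems(2)]]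
    show ?case by (simp add: ann[OF Cons.prems(2)])
  qed
  then show ?thesis by blast
qed

text \<open>Schur's argument: \<open>T'\<close> after the inverse of \<open>T\<close> is an
  intertwiner of the representation of \<open>Q\<close> with itself.\<close>

lemma intertwiners_proportional:
  assumes P: "cprojection P" "cprojection Q"
    and T: "fock2_unitary P Q T" "intertwines P Q T" and T': "fock2_unitary P Q T'" "intertwines P Q T'"
  shows "\<exists>z. \<forall>\<psi>\<in>fock2 P. T' \<psi> = (\<lambda>gs hs. z * T \<psi> gs hs)"
proof -
  let ?S = "the_inv_into (fock2 P) T"
  note S = fock2_unitary_inverse[OF T(1)] intertwines_inverse[OF P(1) T]
  obtain z where z: "\<And>\<psi>. \<psi> \<in> fock2 Q \<Longrightarrow> T' (?S \<psi>) = (\<lambda>gs hs. z * \<psi> gs hs)"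
    using intertwiner_scalar[OF P(2) fock2_unitary_compose[OF S(1) T'(1)]
        intertwines_compose[OF S T'(2)]] by blast
  have "T' \<psi> = (\<lambda>gs hs. z * T \<psi> gs hs)" if "\<psi> \<in> fock2 P" for \<psi>
    using z[OF fock2_unitaryD(4)[OF T(1) that]] that fock2_unitaryD(1)[OF T(1)]
    by (simp add: the_inv_into_f_f bij_betw_def)
  then show ?thesis by blast
qed

text \<open>Any intertwiner \<open>T0\<close> sends a unit vector killed by the annihilators of
  \<open>Q\<close> to a phase times the vacuum. Dividing by this phase gives existence, and
  proportionality of intertwiners gives uniqueness, which resolves the description operator.\<close>

lemma vacuum_intertwiner_properties:
  assumes P: "cprojection P" "cprojection Q"
    and T0: "fock2_unitary P Q T0" "intertwines P Q T0"
    and w: "tensor w vacuum \<in> fock2 P" "fock2_norm (tensor w vacuum) = 1"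
    and ann: "\<And>g. qf_annihilation P (Q g) (tensor w vacuum) = (\<lambda>gs hs. 0)"
    and cre: "\<And>h. qf_creation P (h - Q h) (tensor w vacuum) = (\<lambda>gs hs. 0)"
  defines "T \<equiv> vacuum_intertwiner P Q w"
  shows "fock2_unitary P Q T" "intertwines P Q T" "T (tensor w vacuum) = fock2_vacuum"
proof -
  let ?w = "tensor w vacuum"
  let ?C = "\<lambda>T. T \<in> extensional (fock2 P) \<and> fock2_unitary P Q T \<and> intertwines P Q T \<and>
    T ?w = fock2_vacuum"
  note TD = fock2_unitaryD[OF T0(1)]
  have zero: "T0 (\<lambda>gs hs. 0) = (\<lambda>gs hs. 0)" using TD(5)[OF w(1), of 0] by simp
  define z where "z = T0 ?w [] []"
  have T0w: "T0 ?w = (\<lambda>gs hs. z * fock2_vacuum gs hs)"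
    unfolding z_def
  proof (rule killed_by_annihilators[OF P(2) fock2_alt_biform[OF TD(4)[OF w(1)]]])
    show "qf_annihilation Q (Q g) (T0 ?w) = (\<lambda>gs hs. 0)" for g
      using intertwinesD(2)[OF T0(2) w(1), of "Q g"] unfolding ann zero ..
    show "qf_creation Q (h - Q h) (T0 ?w) = (\<lambda>gs hs. 0)" for h
      using intertwinesD(1)[OF T0(2) w(1), of "h - Q h"] unfolding cre zero ..
  qed
  have z: "cmod z = 1"
    using TD(3)[OF w(1)] w(2) fock2_norm_vacuum[of z, where 'h = 'a] by (simp add: T0w)
  then have "z \<noteq> 0" by auto
  \<comment> \<open>The restriction provides the extensionality that
    \<open>vacuum_intertwiner\<close> asks for.\<close>
  define T1 where "T1 = restrict (\<lambda>\<psi> gs hs. inverse z * T0 \<psi> gs hs) (fock2 P)"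
  have T1: "T1 \<psi> = (\<lambda>gs hs. inverse z * T0 \<psi> gs hs)" if "\<psi> \<in> fock2 P" for \<psi>
    using that by (simp add: T1_def)
  have norm1: "fock2_norm (\<lambda>gs hs. a * \<psi> gs hs) = fock2_norm \<psi>" if "cmod a = 1" for a and \<psi> :: "'a biform"
    using that unfolding fock2_norm_def by (simp add: fock2_sum_mult)
  have "?C T1"
  proof (intro conjI)
    show "T1 \<in> extensional (fock2 P)" by (simp add: T1_def)
    show "T1 ?w = fock2_vacuum" using \<open>z \<noteq> 0\<close> by (simp add: T1[OF w(1)] T0w fun_eq_iff)
    show "intertwines P Q T1"
      unfolding intertwines_def
    proof (intro allI ballI conjI)
      fix f \<psi> assume \<psi>: "\<psi> \<in> fock2 P"
      show "T1 (qf_creation P f \<psi>) = qf_creation Q f (T1 \<psi>)"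
        unfolding T1[OF fock2_qf_creation[OF P(1) \<psi>]] T1[OF \<psi>] intertwinesD[OF T0(2) \<psi>]
        by (simp add: qf_creation_eq creation_mult algebra_simps)
      show "T1 (qf_annihilation P f \<psi>) = qf_annihilation Q f (T1 \<psi>)"
        unfolding T1[OF fock2_qf_annihilation[OF P(1) \<psi>]] T1[OF \<psi>] intertwinesD[OF T0(2) \<psi>]
        by (simp add: qf_annihilation_eq creation_mult algebra_simps)
    qed
    show "fock2_unitary P Q T1"
      unfolding fock2_unitary_def
    proof (intro conjI ballI allI)
      show "bij_betw T1 (fock2 P) (fock2 Q)"
      proof (rule bij_betwI[where g = "\<lambda>\<psi>. the_inv_into (fock2 P) T0 (\<lambda>gs hs. z * \<psi> gs hs)"])
        show "T1 \<in> fock2 P \<rightarrow> fock2 Q"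
          by (intro funcsetI) (simp only: T1, intro fock2_mult TD(4))
        show "(\<lambda>\<psi>. the_inv_into (fock2 P) T0 (\<lambda>gs hs. z * \<psi> gs hs)) \<in> fock2 Q \<rightarrow> fock2 P"
          using fock2_unitaryD(4)[OF fock2_unitary_inverse[OF T0(1)]] fock2_mult by auto
        show "the_inv_into (fock2 P) T0 (\<lambda>gs hs. z * T1 \<psi> gs hs) = \<psi>" if "\<psi> \<in> fock2 P" for \<psi>
          using that \<open>z \<noteq> 0\<close> TD(1) by (simp add: T1 the_inv_into_f_f bij_betw_def mult.assoc[symmetric])
        show "T1 (the_inv_into (fock2 P) T0 (\<lambda>gs hs. z * \<psi> gs hs)) = \<psi>" if "\<psi> \<in> fock2 Q" for \<psi>
          using that \<open>z \<noteq> 0\<close> TD(1) fock2_mult[OF that, of z]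
            fock2_unitaryD(4)[OF fock2_unitary_inverse[OF T0(1)]]
          by (simp add: T1 f_the_inv_into_f bij_betw_def mult.assoc[symmetric])
      qed
      fix \<psi> assume \<psi>: "\<psi> \<in> fock2 P"
      show "fock2_norm (T1 \<psi>) = fock2_norm \<psi>"
        using z by (simp add: T1[OF \<psi>] norm1 norm_inverse TD(3)[OF \<psi>])
      fix \<eta> a b assume \<eta>: "\<eta> \<in> fock2 P"
      show "T1 (\<lambda>gs hs. a * \<psi> gs hs + b * \<eta> gs hs) = (\<lambda>gs hs. a * T1 \<psi> gs hs + b * T1 \<eta> gs hs)"
        by (simp add: T1 \<psi> \<eta> fock2_linear TD(2) algebra_simps)
    qed
  qed
  moreover have "T' = T1" if T': "?C T'" for T'
  proof -
    obtain c where c: "\<And>\<psi>. \<psi> \<in> fock2 P \<Longrightarrow> T' \<psi> = (\<lambda>gs hs. c * T1 \<psi> gs hs)"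
      using intertwiners_proportional[OF P, of T1 T'] T' \<open>?C T1\<close> by blast
    have "T' ?w = fock2_vacuum" "T1 ?w = fock2_vacuum" using T' \<open>?C T1\<close> by blast+
    with c[OF w(1)] have "fock2_vacuum = (\<lambda>gs hs. c * (fock2_vacuum :: 'a biform) gs hs)" by simp
    from fun_cong[OF fun_cong[OF this, of "[]"], of "[]"] have "c = 1"
      by (simp add: tensor_def vacuum_def)
    show ?thesis
    proof (rule extensionalityI)
      show "T' \<in> extensional (fock2 P)" "T1 \<in> extensional (fock2 P)" using T' \<open>?C T1\<close> by blast+
      show "T' \<psi> = T1 \<psi>" if "\<psi> \<in> fock2 P" for \<psi>
        using c[OF that] unfolding \<open>c = 1\<close> by simp
    qed
  qed
  ultimately have "T = T1" unfolding T_def vacuum_intertwiner_def by (intro the_equality)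
  with \<open>?C T1\<close> show "fock2_unitary P Q T" "intertwines P Q T" "T ?w = fock2_vacuum" by auto
qed


section \<open>Intertwiners for projections with a one-dimensional gap\<close>

text \<open>Since forms vanish on a repeated \<open>e\<close>, at most one argument can contribute
  its \<open>e\<close>-component. Collecting these contributions gives creation after annihilation,
  the number operator of \<open>e\<close> when \<open>e\<close> is a unit vector.\<close>

lemma alt_form_peel:
  assumes S: "fock_structure sm ip" and P: "cprojection P" and \<phi>: "alt_form sm P \<phi>"
    and Q: "\<And>x. Q x = P x - cinner e x *c e"
  shows "\<phi> (map Q gs) = \<phi> gs - creation ip e (annihilation e \<phi>) gs"
  using \<phi>
proof (induction gs arbitrary: \<phi>)
  case (Cons g gs)
  note head = alt_form_add_head[OF Cons.prems] alt_form_scale_head[OF Cons.prems]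
  have scale: "\<phi> ((cinner e g *c e) # r) = ip g e * \<phi> (e # r)" for r
    using S head(2)[of "cinner e g" e r] head(2)[of "cnj (cinner e g)" e r] cinner_commute[of g e]
    by (auto simp: fock_structure_def scaleC_bar_def cinner_bar_def)
  have zero: "annihilation e (annihilation e \<phi>) = (\<lambda>gs. 0)"
    by (simp add: fun_eq_iff annihilation_def alt_form_repeat_head[OF Cons.prems])
  have swap: "annihilation e (annihilation g \<phi>) = (\<lambda>gs. - 1 * annihilation g (annihilation e \<phi>) gs)"
    using alt_form_swap_head[OF Cons.prems, of g e] by (simp add: fun_eq_iff annihilation_def)
  have "P g = Q g + cinner e g *c e" by (simp add: Q)
  then have "\<phi> (Q g # map Q gs) = \<phi> (P g # map Q gs) - ip g e * \<phi> (e # map Q gs)"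
    using head(1)[of "Q g" "cinner e g *c e" "map Q gs"] scale by simp
  also have "\<phi> (P g # map Q gs) = annihilation g \<phi> (map Q gs)"
    by (simp add: annihilation_def alt_form_map_head[OF Cons.prems P])
  also have "\<dots> = annihilation g \<phi> gs + creation ip e (annihilation g (annihilation e \<phi>)) gs"
    unfolding Cons.IH[OF alt_form_annihilation[OF Cons.prems P]] swap creation_mult by simp
  also have "\<phi> (e # map Q gs) = annihilation e \<phi> gs"
    using Cons.IH[OF alt_form_annihilation[OF Cons.prems P], of e] unfolding zero
    by (simp add: annihilation_def)
  finally show ?case by (simp add: creation_Cons annihilation_def[of g \<phi>])
qed simp

lemma alt_form_smaller:
  assumes "fock_structure sm ip" "cprojection P" "alt_form sm P \<phi>"
    and "\<And>x. Q x = P x - cinner e x *c e" and "\<And>gs. \<phi> (e # gs) = 0"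
  shows "alt_form sm Q \<phi>"
proof -
  have "annihilation e \<phi> = (\<lambda>gs. 0)" using assms(5) by (simp add: fun_eq_iff annihilation_def)
  then have "\<phi> (map Q gs) = \<phi> gs" for gs
    using alt_form_peel[OF assms(1-4), of gs] by simp
  then show ?thesis by (simp add: alt_form_def alt_formD(2-4)[OF assms(3)])
qed

text \<open>The four summands are the four occupation patterns of \<open>e\<close> in the particle
  and antiparticle factors.\<close>

lemma fock2_sum_insert:
  assumes P: "cprojection P" and \<psi>: "alt_biform P \<psi>" and E: "finite E" "e \<notin> E"
  shows "fock2_sum \<psi> (insert e E) =
    fock2_sum \<psi> E + fock2_sum (\<lambda>gs hs. \<psi> (e # gs) hs) E +
    (fock2_sum (\<lambda>gs hs. \<psi> gs (e # hs)) E + fock2_sum (\<lambda>gs hs. \<psi> (e # gs) (e # hs)) E)"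
proof -
  have swap: "(\<Sum>hs\<in>distinct_lists B. fock_sum (\<lambda>gs. \<eta> gs hs) A / fact (length hs)) =
      (\<Sum>gs\<in>distinct_lists A. fock_sum (\<eta> gs) B / fact (length gs))" for \<eta> :: "'a biform" and A B
    unfolding fock_sum_def sum_divide_distrib by (subst sum.swap) (simp add: mult.commute)
  have "fock2_sum \<psi> (insert e E) =
      (\<Sum>hs\<in>distinct_lists (insert e E). fock_sum (\<lambda>gs. \<psi> gs hs) E / fact (length hs)) +
      (\<Sum>hs\<in>distinct_lists (insert e E). fock_sum (\<lambda>gs. \<psi> (e # gs) hs) E / fact (length hs))"
    unfolding fock2_sum_eq_right fock_sum_insert[OF alt_biformD(1)[OF \<psi>] P E]
    by (simp add: add_divide_distrib sum.distrib annihilation_def[abs_def])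
  also have "\<dots> = (\<Sum>gs\<in>distinct_lists E. fock_sum (\<psi> gs) (insert e E) / fact (length gs)) +
      (\<Sum>gs\<in>distinct_lists E. fock_sum (\<psi> (e # gs)) (insert e E) / fact (length gs))"
    using swap[of \<psi> E "insert e E"] swap[of "\<lambda>gs. \<psi> (e # gs)" E "insert e E"] by simp
  also have "\<dots> = (fock2_sum \<psi> E + fock2_sum (\<lambda>gs hs. \<psi> gs (e # hs)) E) +
      (fock2_sum (\<lambda>gs hs. \<psi> (e # gs) hs) E + fock2_sum (\<lambda>gs hs. \<psi> (e # gs) (e # hs)) E)"
    unfolding fock2_sum_eq_left fock_sum_insert[OF alt_biformD(2)[OF \<psi>] cprojection_complement[OF P] E]
    by (simp add: add_divide_distrib sum.distrib annihilation_def[abs_def])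
  finally show ?thesis by simp
qed

lemma fock2_sum_cong:
  "(\<And>gs hs. gs \<in> distinct_lists E \<Longrightarrow> hs \<in> distinct_lists E \<Longrightarrow> cmod (\<psi> gs hs) = cmod (\<eta> gs hs)) \<Longrightarrow>
    fock2_sum \<psi> E = fock2_sum \<eta> E"
  unfolding fock2_sum_def by (intro sum.cong) auto

lemma fock2_sum_zero: "fock2_sum (\<lambda>gs hs. 0) E = 0"
  by (simp add: fock2_sum_def)

lemma sign_cancel [simp]: "(- 1) ^ n * ((- 1) ^ n * x) = (x :: complex)"
  by (simp add: mult.assoc[symmetric])

lemma sign_cancel2 [simp]:
  "(- 1) ^ n * ((- 1) ^ k * ((- 1) ^ n * ((- 1) ^ k * x))) = (x :: complex)"
  by (subst mult.left_commute) simp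

text \<open>A gap of dimension one; every finite gap is reached by adding such lines
  successively.\<close>

locale line_gap =
  fixes Q :: "'h::complex_inner \<Rightarrow> 'h" and e :: 'h
  assumes Q: "cprojection Q" and e: "Q e = 0" "cinner e e = 1"
begin

definition P :: "'h \<Rightarrow> 'h" where "P x = Q x + cinner e x *c e"

text \<open>The unitary of \<open>\<F>(P H) = \<F>(Q H) \<otimes> \<F>(\<complex> e)\<close> and \<open>\<F>(\<complex> e) \<cong> \<F>(conjugate of \<complex> e)\<close>, which moves the
  line \<open>\<complex> e\<close> from the particles to the antiparticles by exchanging empty and full states.\<close>

definition shift :: "'h biform \<Rightarrow> 'h biform" where
  "shift \<psi> gs hs = (- 1) ^ length gs * ((- 1) ^ length hs * \<psi> (e # gs) hs) -
     (- 1) ^ length hs * creation cinner_bar e (\<psi> (map Q gs)) hs"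

text \<open>The inverse of \<open>shift\<close>. Mapping along \<open>1 - P\<close> keeps the states
  with \<open>e\<close> empty among the antiparticles, before \<open>e\<close> is created among the
  particles; the second term empties an occupied \<open>e\<close>. By irreducibility the relative
  signs in an intertwiner leave no choice beyond a common scalar.\<close>

definition unshift :: "'h biform \<Rightarrow> 'h biform" where
  "unshift \<psi> gs hs = creation cinner e (\<lambda>gs. (- 1) ^ length gs * ((- 1) ^ length hs *
       \<psi> gs (map (\<lambda>h. h - P h) hs))) gs +
     (- 1) ^ length hs * \<psi> gs (e # hs)"

lemma cinner_e_Q: "cinner e (Q x) = 0"
  using cprojection_adj[OF Q, of e x] e by simp

lemma P: "cprojection P"
proof -
  have "P (P x) = P x" for x
    by (simp add: P_def cprojectionD[OF Q] e cinner_add_right cinner_scaleC_right cinner_e_Q)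
  moreover have "cinner (P x) y = cinner x (P y)" for x y
    using cinner_commute[of x e]
    by (simp add: P_def cprojectionD[OF Q] cinner_add_left cinner_add_right cinner_scaleC_left
        cinner_scaleC_right)
  ultimately show ?thesis
    unfolding cprojection_def
    by (simp add: P_def cprojectionD[OF Q] cinner_add_right cinner_scaleC_right scaleC_add_left
        scaleC_add_right scaleC_scaleC)
qed

lemma P_simps: "P e = e" "P (Q x) = Q x" "Q (P x) = Q x"
  by (simp_all add: P_def e cprojectionD[OF Q] cinner_e_Q)

lemma alt_kills_e:
  assumes "alt_biform P \<psi>" shows "\<psi> gs (e # hs) = 0"
  using alt_form_map_head[OF alt_biformD(2)[OF assms] cprojection_complement[OF P], of gs e hs]
    alt_form_scale_head[OF alt_biformD(2)[OF assms], of gs 0 0 hs]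
  by (simp add: P_simps scaleC_bar_def)

lemma alt_kills_e':
  assumes "alt_biform Q \<psi>" shows "\<psi> (e # gs) hs = 0"
  using alt_form_map_head[OF alt_biformD(1)[OF assms] Q, of e gs hs]
    alt_form_scale_head[OF alt_biformD(1)[OF assms], of 0 0 gs hs] by (simp add: e)

lemma peel:
  assumes "alt_biform P \<psi>"
  shows "\<psi> (map Q gs) hs = \<psi> gs hs - creation cinner e (\<lambda>gs. \<psi> (e # gs) hs) gs"
  using alt_form_peel[OF fock_structure_cinner P alt_biformD(1)[OF assms], of Q e gs hs]
  by (simp add: P_def annihilation_def[abs_def])

lemma peel':
  assumes "alt_biform Q \<psi>"
  shows "\<psi> gs (map (\<lambda>h. h - P h) hs) = \<psi> gs hs - creation cinner_bar e (\<lambda>hs. \<psi> gs (e # hs)) hs"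
  using alt_form_peel[OF fock_structure_cinner_bar cprojection_complement[OF Q]
      alt_biformD(2)[OF assms], of "\<lambda>h. h - P h" e gs hs]
  by (simp add: P_def annihilation_def[abs_def])

lemma alt_biform_down:
  assumes "alt_biform P \<psi>" "\<And>gs hs. \<psi> (e # gs) hs = 0"
  shows "alt_biform Q \<psi>"
proof -
  have "alt_form scaleC Q (\<lambda>gs. \<psi> gs hs)" for hs
    using alt_form_smaller[OF fock_structure_cinner P alt_biformD(1)[OF assms(1)], of Q e] assms(2)
    by (simp add: P_def)
  moreover have "alt_form scaleC_bar (\<lambda>h. h - Q h) (\<psi> gs)" for gs
    using alt_biformD(2)[OF assms(1)] by (rule alt_form_superspace) (simp add: cprojectionD[OF P] P_simps)
  ultimately show ?thesis unfolding alt_biform_def by blast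
qed

lemma alt_biform_up:
  assumes "alt_biform Q \<psi>" "\<And>gs hs. \<psi> gs (e # hs) = 0"
  shows "alt_biform P \<psi>"
proof -
  have "alt_form scaleC_bar (\<lambda>h. h - P h) (\<psi> gs)" for gs
    using alt_form_smaller[OF fock_structure_cinner_bar cprojection_complement[OF Q]
      alt_biformD(2)[OF assms(1)], of "\<lambda>h. h - P h" e] assms(2)
    by (simp add: P_def)
  moreover have "alt_form scaleC P (\<lambda>gs. \<psi> gs hs)" for hs
    using alt_biformD(1)[OF assms(1)] by (rule alt_form_superspace) (simp add: P_simps)
  ultimately show ?thesis unfolding alt_biform_def by blast
qed

lemma alt_biform_shift:
  assumes \<psi>: "alt_biform P \<psi>" shows "alt_biform Q (shift \<psi>)"
proof -
  have A: "alt_biform Q (\<lambda>gs hs. (- 1) ^ length gs * ((- 1) ^ length hs * \<psi> (e # gs) hs))"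
    by (rule alt_biform_down)
      (intro alt_biform_parity_left alt_biform_parity_right alt_biform_annihilation_left P \<psi>,
        simp add: alt_form_repeat_head[OF alt_biformD(1)[OF \<psi>]])
  \<comment> \<open>By \<open>peel\<close>, restriction along \<open>Q\<close> is a combination of
    \<open>\<psi>\<close> and a created form, so it is again alternating.\<close>
  have "alt_biform P (\<lambda>gs hs. 1 * \<psi> gs hs + (- 1) * creation cinner e (\<lambda>gs. \<psi> (e # gs) hs) gs)"
    by (intro alt_biform_linear \<psi> alt_biform_creation_left[where \<psi> = "\<lambda>gs hs. \<psi> (e # gs) hs"]
        alt_biform_annihilation_left P P_simps)
  then have N: "alt_biform P (\<lambda>gs hs. \<psi> (map Q gs) hs)" by (simp add: peel[OF \<psi>])
  have "alt_biform Q (\<lambda>gs hs. \<psi> (map Q gs) hs)"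
    using alt_form_scale_head[OF alt_biformD(1)[OF \<psi>], of 0 0]
    by (intro alt_biform_down N) (simp add: e)
  then have B: "alt_biform Q (\<lambda>gs hs. (- 1) ^ length hs * creation cinner_bar e (\<psi> (map Q gs)) hs)"
    by (intro alt_biform_parity_right alt_biform_creation_right[where \<psi> = "\<lambda>gs hs. \<psi> (map Q gs) hs"]
        Q e)
  show ?thesis
    using alt_biform_linear[OF A B, of 1 "- 1"] by (simp add: shift_def[abs_def])
qed

lemma alt_biform_unshift:
  assumes \<psi>: "alt_biform Q \<psi>" shows "alt_biform P (unshift \<psi>)"
proof -
  have "alt_biform Q (\<lambda>gs hs. 1 * \<psi> gs hs + (- 1) * creation cinner_bar e (\<lambda>hs. \<psi> gs (e # hs)) hs)"
    by (intro alt_biform_linear \<psi> alt_biform_creation_right[where \<psi> = "\<lambda>gs hs. \<psi> gs (e # hs)"]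
        alt_biform_annihilation_right Q e)
  then have N: "alt_biform Q (\<lambda>gs hs. \<psi> gs (map (\<lambda>h. h - P h) hs))" by (simp add: peel'[OF \<psi>])
  have "alt_biform P (\<lambda>gs hs. \<psi> gs (map (\<lambda>h. h - P h) hs))"
    using alt_form_scale_head[OF alt_biformD(2)[OF \<psi>], of _ 0 0]
    by (intro alt_biform_up N) (simp add: P_simps scaleC_bar_def)
  then have A: "alt_biform P (\<lambda>gs hs. creation cinner e (\<lambda>gs. (- 1) ^ length gs * ((- 1) ^ length hs *
       \<psi> gs (map (\<lambda>h. h - P h) hs))) gs)"
    by (intro alt_biform_creation_left[where \<psi> = "\<lambda>gs hs. (- 1) ^ length gs * ((- 1) ^ length hs *
       \<psi> gs (map (\<lambda>h. h - P h) hs))"] alt_biform_parity_left alt_biform_parity_right P P_simps)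
  have B: "alt_biform P (\<lambda>gs hs. (- 1) ^ length hs * \<psi> gs (e # hs))"
    by (intro alt_biform_parity_right, rule alt_biform_up)
      (intro alt_biform_annihilation_right Q \<psi>, simp add: alt_form_repeat_head[OF alt_biformD(2)[OF \<psi>]])
  show ?thesis
    using alt_biform_linear[OF A B, of 1 1] by (simp add: unshift_def[abs_def])
qed

lemma shift_unshift:
  assumes \<psi>: "alt_biform Q \<psi>" shows "shift (unshift \<psi>) = \<psi>"
proof (intro ext)
  fix gs hs :: "'h list"
  let ?\<xi> = "\<lambda>gs hs. \<psi> gs (map (\<lambda>h. h - P h) hs)"
  have "unshift \<psi> (e # gs) hs = (- 1) ^ length gs * ((- 1) ^ length hs * ?\<xi> gs hs)"
    using alt_kills_e'[OF \<psi>] by (simp add: unshift_def creation_Cons e annihilation_def[abs_def])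
  moreover have "unshift \<psi> (map Q gs) = (\<lambda>hs. (- 1) ^ length hs * \<psi> gs (e # hs))"
    using alt_form_map[OF alt_biformD(1)[OF \<psi>], of gs]
    by (simp add: fun_eq_iff unshift_def creation_map[of cinner Q, OF cprojection_adj[OF Q]] e)
      (simp add: creation_def)
  ultimately show "shift (unshift \<psi>) gs hs = \<psi> gs hs"
    by (simp add: shift_def creation_parity peel'[OF \<psi>])
qed

lemma unshift_shift:
  assumes \<psi>: "alt_biform P \<psi>" shows "unshift (shift \<psi>) = \<psi>"
proof (intro ext)
  fix gs hs :: "'h list"
  have adj: "cinner_bar (x - P x) y = cinner_bar x (y - P y)" for x y
    by (rule ip_cprojection[OF fock_structure_cinner_bar cprojection_complement[OF P]])
  have "creation cinner_bar e \<eta> (map (\<lambda>h. h - P h) hs) = 0" for \<eta> :: "'h form" and hs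
    using creation_map[of cinner_bar "\<lambda>h. h - P h" e \<eta> hs, OF adj]
    by (simp add: P_simps) (simp add: creation_def cinner_bar_def)
  then have "shift \<psi> gs (map (\<lambda>h. h - P h) hs) = (- 1) ^ length gs * ((- 1) ^ length hs * \<psi> (e # gs) hs)"
    for gs hs
    using alt_form_map[OF alt_biformD(2)[OF \<psi>], of "e # gs" hs] by (simp add: shift_def)
  moreover have "shift \<psi> gs (e # hs) = (- 1) ^ length hs * \<psi> (map Q gs) hs"
    using alt_kills_e[OF \<psi>]
    by (simp add: shift_def creation_Cons annihilation_def[abs_def] cinner_bar_def e)
  ultimately show "unshift (shift \<psi>) gs hs = \<psi> gs hs"
    by (simp add: unshift_def peel[OF \<psi>])
qed

text \<open>A form over \<open>P\<close> never has \<open>e\<close> among the antiparticles, its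
  shift never has \<open>e\<close> among the particles. For \<open>e\<close> in \<open>E\<close>
  both sums therefore have two parts, which \<open>shift\<close> exchanges up to signs.\<close>

lemma fock2_sum_shift:
  assumes \<psi>: "alt_biform P \<psi>" and E: "finite_onb E" "e \<in> E"
  shows "fock2_sum (shift \<psi>) E = fock2_sum \<psi> E"
proof -
  obtain E0 where E0: "E = insert e E0" "e \<notin> E0" "finite E0"
    using E by (metis finite_insert mk_disjoint_insert)
  have orth: "cinner g e = 0" if "gs \<in> distinct_lists E0" "g \<in> set gs" for g gs
  proof -
    have "g \<in> E" "g \<noteq> e" using that E0 by (auto simp: distinct_lists_def)
    then show ?thesis using E orthonormalD[of E g e] by simp
  qed
  have left: "creation cinner e \<phi> gs = 0" if "gs \<in> distinct_lists E0" for gs \<phi>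
    using orth[OF that] by (rule creation_orthogonal)
  have right: "creation cinner_bar e \<phi> gs = 0" if "gs \<in> distinct_lists E0" for gs \<phi>
    using orth[OF that] cinner_eq_0_commute
    by (intro creation_orthogonal) (auto simp: cinner_bar_def)
  have "fock2_sum (shift \<psi>) E =
      fock2_sum (shift \<psi>) E0 + fock2_sum (\<lambda>gs hs. shift \<psi> gs (e # hs)) E0"
    using fock2_sum_insert[OF Q alt_biform_shift[OF \<psi>] E0(3,2)]
    by (simp add: E0(1) alt_kills_e'[OF alt_biform_shift[OF \<psi>]] fock2_sum_zero)
  also have "fock2_sum (shift \<psi>) E0 = fock2_sum (\<lambda>gs hs. \<psi> (e # gs) hs) E0"
    by (rule fock2_sum_cong) (simp add: shift_def right norm_mult norm_power)
  also have "fock2_sum (\<lambda>gs hs. shift \<psi> gs (e # hs)) E0 = fock2_sum \<psi> E0"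
    by (rule fock2_sum_cong) (simp add: shift_def creation_Cons right peel[OF \<psi>] left norm_mult
        norm_power alt_kills_e[OF \<psi>] cinner_bar_def e)
  also have "fock2_sum (\<lambda>gs hs. \<psi> (e # gs) hs) E0 + fock2_sum \<psi> E0 = fock2_sum \<psi> E"
    using fock2_sum_insert[OF P \<psi> E0(3,2)]
    by (simp add: E0(1) alt_kills_e[OF \<psi>] fock2_sum_zero)
  finally show ?thesis .
qed

lemma fock2_shift:
  assumes "\<psi> \<in> fock2 P" shows "shift \<psi> \<in> fock2 Q"
  using fock2_sum_shift[OF fock2_alt_biform[OF assms]]
  by (intro fock2_dominated[OF Q alt_biform_shift[OF fock2_alt_biform[OF assms]] assms e(2)]) simp

lemma fock2_unshift:
  assumes "\<psi> \<in> fock2 Q" shows "unshift \<psi> \<in> fock2 P"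
proof (rule fock2_dominated[OF P alt_biform_unshift[OF fock2_alt_biform[OF assms]] assms e(2)])
  fix E :: "'h set" assume "finite_onb E" "e \<in> E"
  from fock2_sum_shift[OF alt_biform_unshift[OF fock2_alt_biform[OF assms]] this]
  show "fock2_sum (unshift \<psi>) E \<le> fock2_sum \<psi> E"
    by (simp add: shift_unshift[OF fock2_alt_biform[OF assms]])
qed

lemma shift_unitary: "fock2_unitary P Q shift"
  unfolding fock2_unitary_def
proof (intro conjI ballI allI)
  show "bij_betw shift (fock2 P) (fock2 Q)"
    using fock2_shift fock2_unshift shift_unshift unshift_shift fock2_alt_biform
    by (intro bij_betwI[where g = unshift]) blast+
  fix \<psi> assume \<psi>: "\<psi> \<in> fock2 P"
  show "fock2_norm (shift \<psi>) = fock2_norm \<psi>"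
    using fock2_sum_shift[OF fock2_alt_biform[OF \<psi>]]
    by (intro fock2_norm_adapted[OF P \<psi> Q fock2_shift[OF \<psi>] e(2)])
  fix \<eta> a b
  show "shift (\<lambda>gs hs. a * \<psi> gs hs + b * \<eta> gs hs) = (\<lambda>gs hs. a * shift \<psi> gs hs + b * shift \<eta> gs hs)"
    by (simp add: shift_def[abs_def] creation_linear algebra_simps)
qed

text \<open>The \<open>e\<close>-component of \<open>f\<close> is created among the particles for
  \<open>P\<close> and annihilated among the antiparticles for \<open>Q\<close>. Each side yields
  the same term with factor \<open>c\<close>, through the anticommutator with \<open>e\<close>; the
  other terms agree once the signs are collected.\<close>

lemma shift_creation:
  assumes \<psi>: "alt_biform P \<psi>"
  shows "shift (qf_creation P f \<psi>) = qf_creation Q f (shift \<psi>)"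
proof (intro ext)
  fix gs hs :: "'h list"
  define c where "c = cinner e f"
  have Pf: "creation cinner (P f) \<phi> gs = creation cinner (Q f) \<phi> gs + c * creation cinner e \<phi> gs" for \<phi> gs
    by (simp add: P_def c_def creation_cinner_add creation_cinner_scale)
  have Pf_map: "creation cinner (P f) \<phi> (map Q gs) = creation cinner (Q f) (\<lambda>gs. \<phi> (map Q gs)) gs"
    for \<phi> gs
    by (simp add: creation_map[of cinner Q, OF cprojection_adj[OF Q]] P_simps)
  have ip: "cinner e (P f) = c" "cinner e (f - Q f) = c"
    using cprojection_adj[OF P, of e f] by (simp_all add: P_simps c_def cinner_diff_right cinner_e_Q)
  have X: "creation cinner (P f) (\<lambda>gs'. \<psi> gs' hs) (e # gs) =
      c * \<psi> (map Q gs) hs - creation cinner (Q f) (\<lambda>gs. \<psi> (e # gs) hs) gs"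
    unfolding creation_Cons ip Pf peel[OF \<psi>] by (simp add: annihilation_def[abs_def] algebra_simps)
  have right: "\<psi> gs ((f - Q f) # hs) = \<psi> gs ((f - P f) # hs)" for gs hs
  proof -
    have eq: "f - Q f = (f - P f) + scaleC_bar (cnj c) e" by (simp add: P_def c_def scaleC_bar_def)
    show ?thesis
      unfolding eq alt_form_add_head[OF alt_biformD(2)[OF \<psi>]]
        alt_form_scale_head[OF alt_biformD(2)[OF \<psi>]] alt_kills_e[OF \<psi>] by simp
  qed
  \<comment> \<open>Naming the two degree signs lets the simplifier treat them as commuting
    involutions.\<close>
  define t u where "t = (- 1 :: complex) ^ length gs" and "u = (- 1 :: complex) ^ length hs"
  have tu: "t * (t * x) = x" "u * (u * x) = x" for x by (simp_all add: t_def u_def)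
  have L: "shift (qf_creation P f \<psi>) gs hs =
      t * (u * (c * \<psi> (map Q gs) hs - creation cinner (Q f) (\<lambda>gs. \<psi> (e # gs) hs) gs
         - t * \<psi> (e # gs) ((f - P f) # hs))) -
      u * (creation cinner_bar e (\<lambda>hs. creation cinner (Q f) (\<lambda>gs. \<psi> (map Q gs) hs) gs) hs +
         t * creation cinner_bar e (\<lambda>hs. \<psi> (map Q gs) ((f - P f) # hs)) hs)"
    unfolding shift_def qf_creation_eq X Pf_map creation_add
    by (simp add: t_def u_def creation_mult)
  have R: "qf_creation Q f (shift \<psi>) gs hs =
      - (t * (u * creation cinner (Q f) (\<lambda>gs. \<psi> (e # gs) hs) gs)) -
      u * creation cinner_bar e (\<lambda>hs. creation cinner (Q f) (\<lambda>gs. \<psi> (map Q gs) hs) gs) hs +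
      t * (- (t * (u * \<psi> (e # gs) ((f - P f) # hs))) + u * (c * \<psi> (map Q gs) hs -
         creation cinner_bar e (\<lambda>hs. \<psi> (map Q gs) ((f - P f) # hs)) hs))"
    unfolding qf_creation_eq shift_def creation_diff creation_parity creation_mult creation_Cons
      creation_commute[of cinner "Q f" cinner_bar e]
    by (simp add: t_def u_def right ip annihilation_def[abs_def] cinner_bar_def)
  show "shift (qf_creation P f \<psi>) gs hs = qf_creation Q f (shift \<psi>) gs hs"
    unfolding L R by (simp add: tu algebra_simps)
qed

lemma shift_annihilation:
  assumes \<psi>: "alt_biform P \<psi>"
  shows "shift (qf_annihilation P f \<psi>) = qf_annihilation Q f (shift \<psi>)"
proof (intro ext)
  fix gs hs :: "'h list"
  define c where "c = cinner e f"
  note alt = alt_biformD(1)[OF \<psi>]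
  have Pf: "\<psi> (P f # gs) hs = \<psi> (Q f # gs) hs + cnj c * \<psi> (e # gs) hs" for gs hs
    by (simp add: P_def c_def alt_form_add_head[OF alt] alt_form_scale_head[OF alt])
  have swap: "\<psi> (P f # e # gs) hs = - \<psi> (e # Q f # gs) hs"
    by (subst Pf, subst alt_form_swap_head[OF alt, of "Q f" e], subst alt_form_repeat_head[OF alt]) simp
  have e_map: "\<psi> (e # map Q gs) hs = \<psi> (e # gs) hs" for hs
    using peel[OF alt_biform_annihilation_left[OF P \<psi>, of e], of gs hs]
    by (simp add: alt_form_repeat_head[OF alt])
  have Qf: "creation cinner_bar (f - Q f) \<phi> hs =
      creation cinner_bar (f - P f) \<phi> hs + cnj c * creation cinner_bar e \<phi> hs" for \<phi> hs
  proof -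
    have "f - Q f = (f - P f) + c *c e" by (simp add: P_def c_def)
    then show ?thesis by (simp only: creation_bar_add creation_bar_scale)
  qed
  have ee: "creation cinner_bar e (creation cinner_bar e \<phi>) hs = 0" for \<phi> hs
    using creation_anticommute[of cinner_bar e e \<phi> hs] by (simp add: eq_neg_iff_add_eq_0)
  define t u where "t = (- 1 :: complex) ^ length gs" and "u = (- 1 :: complex) ^ length hs"
  have tu: "t * (t * x) = x" "u * (u * x) = x" for x by (simp_all add: t_def u_def)
  have L: "shift (qf_annihilation P f \<psi>) gs hs =
      t * (u * (- \<psi> (e # Q f # gs) hs - t * creation cinner_bar (f - P f) (\<psi> (e # gs)) hs)) -
      u * (creation cinner_bar e (\<psi> (Q f # map Q gs)) hs + cnj c * creation cinner_bar e (\<psi> (e # gs)) hs +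
        t * creation cinner_bar e (creation cinner_bar (f - P f) (\<psi> (map Q gs))) hs)"
    unfolding shift_def qf_annihilation_eq swap
    by (simp add: creation_add creation_mult Pf e_map t_def u_def)
  have R: "qf_annihilation Q f (shift \<psi>) gs hs =
      - (t * (u * \<psi> (e # Q f # gs) hs)) - u * creation cinner_bar e (\<psi> (Q f # map Q gs)) hs +
      t * (- (t * (u * (creation cinner_bar (f - P f) (\<psi> (e # gs)) hs +
             cnj c * creation cinner_bar e (\<psi> (e # gs)) hs))) +
        u * creation cinner_bar (f - P f) (creation cinner_bar e (\<psi> (map Q gs))) hs)"
    unfolding qf_annihilation_eq shift_def creation_diff creation_parity creation_mult
    by (simp add: Qf ee cprojection_idem[OF Q] t_def u_def)
  \<comment> \<open>The last terms of \<open>L\<close> and \<open>R\<close> contain two creations in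
    opposite order, and the sign of the exchange is the one required.\<close>
  note anti = creation_anticommute[of cinner_bar e "f - P f" "\<psi> (map Q gs)" hs]
  show "shift (qf_annihilation P f \<psi>) gs hs = qf_annihilation Q f (shift \<psi>) gs hs"
    unfolding L R anti by (simp add: tu algebra_simps)
qed

lemma shift_intertwines: "intertwines P Q shift"
  unfolding intertwines_def using shift_creation shift_annihilation fock2_alt_biform by blast

end

text \<open>The induction carries the \<open>cprojection\<close> claim along with the intertwiner,
  since \<open>line_gap\<close> requires it of the projection to be enlarged next.\<close>

lemma intertwiner_exists_finite:
  assumes Q: "cprojection Q" and E: "finite E" "orthonormal E" "\<And>e. e \<in> E \<Longrightarrow> Q e = 0"
  shows "cprojection (\<lambda>x. Q x + (\<Sum>e\<in>E. cinner e x *c e)) \<and>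
    (\<exists>T. fock2_unitary (\<lambda>x. Q x + (\<Sum>e\<in>E. cinner e x *c e)) Q T \<and>
      intertwines (\<lambda>x. Q x + (\<Sum>e\<in>E. cinner e x *c e)) Q T)"
  using E
proof (induction E)
  case empty
  have "fock2_unitary Q Q (\<lambda>\<psi>. \<psi>)" "intertwines Q Q (\<lambda>\<psi>. \<psi>)"
    by (auto simp: fock2_unitary_def intertwines_def bij_betw_def)
  then show ?case using Q by auto
next
  case (insert e E)
  let ?P = "\<lambda>x. Q x + (\<Sum>e\<in>E. cinner e x *c e)"
  have o: "cinner f e = (if f = e then 1 else 0)" if "f \<in> insert e E" for f
    using orthonormalD[OF insert.prems(1) that, of e] by simp
  have "orthonormal E" using insert.prems(1) by (auto simp: orthonormal_def)
  then obtain T where T: "cprojection ?P" "fock2_unitary ?P Q T" "intertwines ?P Q T"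
    using insert.IH insert.prems by blast
  \<comment> \<open>The new vector is orthogonal to \<open>E\<close> and killed by \<open>Q\<close>,
    hence killed by the projection built so far, as \<open>line_gap\<close> demands.\<close>
  have "(\<Sum>f\<in>E. cinner f e *c f) = 0"
    using o insert.hyps(2) by (intro sum.neutral) (metis insertI2 scaleC_zero_left)
  then have "?P e = 0" using insert.prems(2)[of e] by simp
  then interpret line_gap ?P e using T(1) o[of e] by unfold_locales auto
  have eq: "P = (\<lambda>x. Q x + (\<Sum>e\<in>insert e E. cinner e x *c e))"
    using insert.hyps by (simp add: fun_eq_iff P_def algebra_simps)
  have "cprojection P \<and> (\<exists>T. fock2_unitary P Q T \<and> intertwines P Q T)"
    using P fock2_unitary_compose[OF shift_unitary T(2)]
      intertwines_compose[OF shift_unitary shift_intertwines T(3)] by blast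
  then show ?case unfolding eq .
qed

lemma intertwiner_exists:
  assumes "proj_le Q P" "has_cdim (range (\<lambda>x. P x - Q x)) n"
  shows "\<exists>T. fock2_unitary P Q T \<and> intertwines P Q T"
proof -
  obtain E where E: "finite E" "orthonormal E" "cspan E = range (\<lambda>x. P x - Q x)"
    using assms(2) by (auto simp: has_cdim_def)
  have "Q e = 0" if "e \<in> E" for e
  proof -
    have "e \<in> range (\<lambda>x. P x - Q x)" using that E(3) cspan_superset by blast
    then show ?thesis using proj_leD[OF assms(1)] by (auto simp: cprojectionD)
  qed
  moreover have "P = (\<lambda>x. Q x + (\<Sum>e\<in>E. cinner e x *c e))"
    using cprojection_expand[OF cprojection_gap[OF assms(1)] E] by (simp add: fun_eq_iff algebra_simps)
  ultimately show ?thesis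
    using intertwiner_exists_finite[OF proj_leD(2)[OF assms(1)] E(1,2)] by simp
qed


section \<open>Top exterior powers\<close>

lemma alt_form_sum_head:
  assumes "alt_form scaleC Q \<phi>"
  shows "\<phi> ((\<Sum>i\<in>I. c i *c v i) # gs) = (\<Sum>i\<in>I. cnj (c i) * \<phi> (v i # gs))"
proof (induction I rule: infinite_finite_induct)
  case (insert i I)
  then show ?case by (simp add: alt_form_add_head[OF assms] alt_form_scale_head[OF assms])
qed (use alt_form_scale_head[OF assms, of 0 0] in simp_all)

lemma alt_form_zero_on_basis:
  assumes W: "cprojection W" and E: "finite E" "orthonormal E" "cspan E = range W"
    and \<phi>: "alt_form scaleC W \<phi>"
    and zero: "\<And>gs. set gs \<subseteq> E \<Longrightarrow> length gs = n \<Longrightarrow> \<phi> gs = 0"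
  shows "length gs = n \<Longrightarrow> \<phi> gs = 0"
  using \<phi> zero
proof (induction n arbitrary: \<phi> gs)
  case (Suc n)
  then obtain g hs where gs: "gs = g # hs" "length hs = n" by (auto simp: length_Suc_conv)
  have "\<phi> (e # hs) = 0" if "e \<in> E" for e
  proof -
    have "annihilation e \<phi> hs = 0"
      using Suc.prems(3) that
      by (intro Suc.IH[OF gs(2) alt_form_annihilation[OF Suc.prems(2) W]]) (simp add: annihilation_def)
    then show ?thesis by (simp add: annihilation_def)
  qed
  moreover have "\<phi> gs = (\<Sum>e\<in>E. cnj (cinner e g) * \<phi> (e # hs))"
    using alt_form_map_head[OF Suc.prems(2) W, of g hs]
    unfolding gs cprojection_expand[OF W E] alt_form_sum_head[OF Suc.prems(2)] by simp
  ultimately show ?case by simp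
qed simp

text \<open>A list longer than the dimension must repeat a basis vector.\<close>

lemma alt_form_above_dimension:
  assumes W: "cprojection W" "has_cdim (range W) n" and \<phi>: "alt_form scaleC W \<phi>" and "n < length gs"
  shows "\<phi> gs = 0"
proof -
  obtain E where E: "finite E" "card E = n" "orthonormal E" "cspan E = range W"
    using W(2) by (auto simp: has_cdim_def)
  show ?thesis
  proof (rule alt_form_zero_on_basis[OF W(1) E(1,3,4) \<phi> _ refl])
    fix hs assume "set hs \<subseteq> E" "length hs = length gs"
    then have "\<not> distinct hs"
      using distinct_card[of hs] card_mono[OF E(1), of "set hs"] E(2) assms(4) by auto
    then show "\<phi> hs = 0" by (rule alt_form_not_distinct[OF \<phi>])
  qed
qed

text \<open>A full-length list of basis vectors either repeats one of them or permutes
  \<open>es\<close>, where the modulus is that at \<open>es\<close>.\<close>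

lemma top_form_zero:
  assumes W: "cprojection W" and es: "distinct es" "orthonormal (set es)" "cspan (set es) = range W"
    and \<phi>: "alt_form scaleC W \<phi>" "\<And>gs. length gs \<noteq> length es \<Longrightarrow> \<phi> gs = 0" "\<phi> es = 0"
  shows "\<phi> gs = 0"
proof (cases "length gs = length es")
  case True
  show ?thesis
  proof (rule alt_form_zero_on_basis[OF W _ es(2,3) \<phi>(1) _ True])
    fix hs assume hs: "set hs \<subseteq> set es" "length hs = length es"
    show "\<phi> hs = 0"
    proof (cases "distinct hs")
      case True
      then have "set hs = set es"
        using hs es(1) by (intro card_subset_eq) (auto simp: distinct_card)
      then have "mset hs = mset es" using True es(1) by (simp add: set_eq_iff_mset_eq_distinct)
      then show ?thesis using alt_form_permute[OF \<phi>(1) W] \<phi>(3) by (metis norm_eq_zero)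
    qed (rule alt_form_not_distinct[OF \<phi>(1)])
  qed simp
qed (rule \<phi>(2))

lemma top_powerD:
  assumes "\<phi> \<in> top_power W"
  shows "alt_form scaleC W \<phi>" "\<phi> \<in> fock_space scaleC W"
    and "\<exists>n. has_cdim (range W) n \<and> (\<forall>gs. length gs \<noteq> n \<longrightarrow> \<phi> gs = 0)"
  using assms by (auto simp: top_power_def fock_space_def)

lemma has_cdim_list:
  assumes "has_cdim V n"
  obtains es where "distinct es" "length es = n" "orthonormal (set es)" "cspan (set es) = V"
  using assms finite_distinct_list unfolding has_cdim_def by (metis distinct_card)

lemma top_power_degree:
  assumes "\<phi> \<in> top_power W" "has_cdim (range W) n" "length gs \<noteq> n"
  shows "\<phi> gs = 0"
  using top_powerD(3)[OF assms(1)] has_cdim_unique[OF _ assms(2)] assms(3) by blast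

text \<open>A top form is determined by its value on one basis list, and there a nonzero form is
  nonzero; the quotient of the two values is the factor.\<close>

lemma top_power_one_dimensional:
  assumes W: "cprojection W" and v: "v \<in> top_power W" "v \<noteq> (\<lambda>gs. 0)" and w: "w \<in> top_power W"
  shows "\<exists>a. w = (\<lambda>gs. a * v gs)"
proof -
  obtain n where n: "has_cdim (range W) n" using top_powerD(3)[OF v(1)] by blast
  obtain es where es: "distinct es" "length es = n" "orthonormal (set es)" "cspan (set es) = range W"
    using has_cdim_list[OF n] by blast
  note deg = top_power_degree[OF _ n]
  have "v es \<noteq> 0"
    using top_form_zero[OF W es(1,3,4) top_powerD(1)[OF v(1)]] deg[OF v(1)] v(2) es(2) by blast
  have zero: "w gs + (- (w es / v es)) * v gs = 0" for gs
  proof (rule top_form_zero[OF W es(1,3,4)])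
    show "alt_form scaleC W (\<lambda>gs. w gs + (- (w es / v es)) * v gs)"
      using alt_form_linear[OF top_powerD(1)[OF w] top_powerD(1)[OF v(1)], of 1 "- (w es / v es)"]
      by (simp only: mult_1)
    show "w gs + (- (w es / v es)) * v gs = 0" if "length gs \<noteq> length es" for gs
      using deg[OF v(1), of gs] deg[OF w, of gs] that es(2) by simp
    show "w es + (- (w es / v es)) * v es = 0" using \<open>v es \<noteq> 0\<close> by simp
  qed
  have "w = (\<lambda>gs. w es / v es * v gs)"
  proof
    show "w gs = w es / v es * v gs" for gs
      using zero[of gs] by (subst eq_iff_diff_eq_0) simp
  qed
  then show ?thesis ..
qed

text \<open>Tensoring with the vacuum embeds the one-sided Fock space isometrically, so its norm
  inherits the estimates proved for \<open>fock2\<close>.\<close>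

lemma fock2_sum_tensor_vacuum: "finite E \<Longrightarrow> fock2_sum (tensor \<phi> vacuum) E = fock_sum \<phi> E"
proof -
  assume E: "finite E"
  have "fock_sum (tensor \<phi> vacuum gs) E = (cmod (\<phi> gs))\<^sup>2" for gs
  proof -
    have "fock_sum (tensor \<phi> vacuum gs) E =
        (\<Sum>hs\<in>distinct_lists E. if hs = [] then (cmod (\<phi> gs))\<^sup>2 else 0)"
      unfolding fock_sum_def by (intro sum.cong) (auto simp: tensor_def vacuum_def)
    then show ?thesis using finite_distinct_lists[OF E] by simp
  qed
  then show ?thesis unfolding fock2_sum_eq_left by (simp add: fock_sum_def)
qed

lemma fock2_norm_tensor_vacuum: "fock2_norm (tensor \<phi> vacuum) = fock_norm \<phi>"
  unfolding fock2_norm_def fock_norm_def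
  by (intro arg_cong[where f = sqrt] SUP_cong refl) (simp add: fock2_sum_tensor_vacuum)

lemma tensor_vacuum_in_fock2_iff: "tensor \<phi> vacuum \<in> fock2 P \<longleftrightarrow> \<phi> \<in> fock_space scaleC P"
proof -
  have "fock2_sum (tensor \<phi> vacuum) ` {E. finite_onb E} = fock_sum \<phi> ` {E. finite_onb E}"
    by (intro image_cong refl) (simp add: fock2_sum_tensor_vacuum)
  moreover have "alt_biform P (tensor \<phi> vacuum) \<longleftrightarrow> alt_form scaleC P \<phi>"
  proof
    assume "alt_biform P (tensor \<phi> vacuum)"
    from alt_biformD(1)[OF this, of "[]"] show "alt_form scaleC P \<phi>"
      by (simp add: tensor_def vacuum_def)
  next
    assume "alt_form scaleC P \<phi>"
    then have "alt_form scaleC P (\<lambda>gs. \<phi> gs * vacuum hs)" for hs :: "'a list"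
      using alt_form_mult[of scaleC P \<phi> "vacuum hs"] by (simp only: mult.commute)
    then show "alt_biform P (tensor \<phi> vacuum)"
      unfolding alt_biform_def tensor_def[abs_def] using alt_form_mult[OF alt_form_vacuum] by blast
  qed
  ultimately show ?thesis unfolding fock2_eq fock_space_def by simp
qed


section \<open>Exterior multiplication\<close>

lemma wedge_Nil: "wedge \<phi> \<eta> [] = \<phi> [] * \<eta> []"
  by (simp add: wedge_def)

text \<open>The graded Leibniz rule for annihilation. The subsets are split by whether they contain
  the first index; if it goes to the second factor, every index of the first factor forms an
  inversion with it, whence the degree sign on \<open>\<phi>\<close>.\<close>

lemma wedge_Cons:
  "wedge \<phi> \<eta> (g # gs) = wedge (annihilation g \<phi>) \<eta> gs +
     wedge (\<lambda>gs. (- 1) ^ length gs * \<phi> gs) (annihilation g \<eta>) gs"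
proof -
  let ?n = "length gs"
  \<comment> \<open>The inversions of the shuffle given by \<open>I\<close>; their parity is its
    sign.\<close>
  define S where "S n I = {(p, q). p < q \<and> q < n \<and> p \<notin> I \<and> q \<in> I}" for n :: nat and I
  define h where "h I = (- 1 :: complex) ^ card (S (Suc ?n) I) * \<phi> (nths (g # gs) I) * \<eta> (nths (g # gs) (- I))" for I
  have fin: "finite (S n I)" for n I
    by (rule finite_subset[of _ "{..<n} \<times> {..<n}"]) (auto simp: S_def)
  have shift: "S (Suc n) (insert 0 (Suc ` I)) = map_prod Suc Suc ` S n I" for n I
  proof (intro set_eqI iffI)
    fix r assume "r \<in> S (Suc n) (insert 0 (Suc ` I))"
    then obtain p q where "r = (Suc p, Suc q)" "(p, q) \<in> S n I"
      by (cases r) (auto simp: S_def gr0_conv_Suc image_iff)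
    then show "r \<in> map_prod Suc Suc ` S n I" by (metis imageI map_prod_simp)
  qed (auto simp: S_def)
  have shift': "S (Suc n) (Suc ` I) = map_prod Suc Suc ` S n I \<union> Pair 0 ` Suc ` I" if "I \<subseteq> {..<n}" for n I
  proof (intro set_eqI iffI)
    fix r assume r: "r \<in> S (Suc n) (Suc ` I)"
    then obtain p q where pq: "r = (p, Suc q)" "q \<in> I" by (cases r) (auto simp: S_def)
    show "r \<in> map_prod Suc Suc ` S n I \<union> Pair 0 ` Suc ` I"
    proof (cases p)
      case (Suc p')
      then have "(p', q) \<in> S n I" using r pq by (auto simp: S_def)
      then show ?thesis unfolding pq(1) Suc by (metis UnI1 imageI map_prod_simp)
    qed (use pq in auto)
  qed (use that in \<open>auto simp: S_def\<close>)
  have inj: "inj_on (map_prod Suc Suc) A" for A by (auto simp: inj_on_def)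
  have one: "h (insert 0 (Suc ` I)) = (- 1) ^ card (S ?n I) * annihilation g \<phi> (nths gs I) * \<eta> (nths gs (- I))"
    for I
  proof -
    have "{j. Suc j \<in> insert 0 (Suc ` I)} = I" "{j. Suc j \<in> - insert 0 (Suc ` I)} = - I" by auto
    then show ?thesis
      by (simp add: h_def nths_Cons annihilation_def shift card_image[OF inj])
  qed
  have two: "h (Suc ` I) = (- 1) ^ card (S ?n I) * ((- 1) ^ length (nths gs I) * \<phi> (nths gs I)) *
      annihilation g \<eta> (nths gs (- I))" if "I \<subseteq> {..<?n}" for I
  proof -
    have "{j. Suc j \<in> Suc ` I} = I" "{j. Suc j \<in> - Suc ` I} = - I" by auto
    moreover have "{i. i < ?n \<and> i \<in> I} = I" using that by auto
    then have "length (nths gs I) = card I" by (simp add: length_nths)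
    moreover have "card (S (Suc ?n) (Suc ` I)) = card (S ?n I) + card I"
    proof -
      have "finite I" using that finite_subset by blast
      then have "finite (Pair (0::nat) ` Suc ` I)" by blast
      moreover have "map_prod Suc Suc ` S ?n I \<inter> Pair 0 ` Suc ` I = {}" by auto
      ultimately have "card (S (Suc ?n) (Suc ` I)) = card (map_prod Suc Suc ` S ?n I) + card (Pair (0::nat) ` Suc ` I)"
        unfolding shift'[OF that] using fin[of ?n I] by (simp add: card_Un_disjoint)
      moreover have "card (Pair (0::nat) ` Suc ` I) = card I"
        unfolding image_image by (intro card_image) (auto simp: inj_on_def)
      ultimately show ?thesis by (simp add: card_image[OF inj])
    qed
    ultimately show ?thesis
      by (simp add: h_def nths_Cons annihilation_def power_add mult_ac)
  qed
  have Pow: "Pow {..<Suc ?n} = (\<lambda>I. insert 0 (Suc ` I)) ` Pow {..<?n} \<union> image Suc ` Pow {..<?n}"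
    unfolding lessThan_Suc_eq_insert_0 Pow_insert image_Pow_surj[OF refl, symmetric] image_image
    by (rule Un_commute)
  have inj1: "inj_on (\<lambda>I. insert 0 (Suc ` I)) (Pow {..<?n})"
  proof (rule inj_onI)
    fix I J :: "nat set" assume "insert 0 (Suc ` I) = insert 0 (Suc ` J)"
    then have "Suc ` I = Suc ` J" by (metis image_iff insert_ident nat.distinct(1))
    then show "I = J" by (simp add: inj_image_eq_iff)
  qed
  have inj2: "inj_on (image Suc) (Pow {..<?n})" by (auto simp: inj_on_def inj_image_eq_iff)
  have "wedge \<phi> \<eta> (g # gs) = (\<Sum>I\<in>Pow {..<Suc ?n}. h I)"
    by (simp add: wedge_def h_def S_def)
  also have "\<dots> = (\<Sum>I\<in>Pow {..<?n}. h (insert 0 (Suc ` I))) + (\<Sum>I\<in>Pow {..<?n}. h (Suc ` I))"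
    unfolding Pow by (subst sum.union_disjoint) (auto simp: sum.reindex[OF inj1] sum.reindex[OF inj2])
  also have "\<dots> = wedge (annihilation g \<phi>) \<eta> gs +
     wedge (\<lambda>gs. (- 1) ^ length gs * \<phi> gs) (annihilation g \<eta>) gs"
    unfolding wedge_def S_def[symmetric] by (intro arg_cong2[where f = "(+)"] sum.cong refl) (auto simp: one two)
  finally show ?thesis .
qed

lemma wedge_linear_left:
  "wedge (\<lambda>gs. a * \<phi> gs + b * \<phi>' gs) \<eta> gs = a * wedge \<phi> \<eta> gs + b * wedge \<phi>' \<eta> gs"
  unfolding wedge_def by (simp add: sum_distrib_left sum.distrib algebra_simps)

lemma wedge_scale: "wedge (\<lambda>gs. a * \<phi> gs) (\<lambda>gs. b * \<eta> gs) gs = a * b * wedge \<phi> \<eta> gs"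
  unfolding wedge_def by (simp add: sum_distrib_left algebra_simps)

text \<open>Creation is left exterior multiplication by \<open>f\<close>, so this is associativity;
  the induction balances the Leibniz rule against the anticommutator.\<close>

lemma wedge_creation: "wedge (creation ip f \<phi>) \<eta> = creation ip f (wedge \<phi> \<eta>)"
proof
  fix gs
  show "wedge (creation ip f \<phi>) \<eta> gs = creation ip f (wedge \<phi> \<eta>) gs"
  proof (induction gs arbitrary: \<phi> \<eta>)
    case Nil
    show ?case by (simp add: wedge_Nil)
  next
    case (Cons g gs)
    let ?p = "\<lambda>gs. (- 1) ^ length gs * \<phi> gs"
    have "annihilation g (wedge \<phi> \<eta>) =
        (\<lambda>gs. 1 * wedge (annihilation g \<phi>) \<eta> gs + 1 * wedge ?p (annihilation g \<eta>) gs)"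
      by (simp add: fun_eq_iff wedge_Cons annihilation_def[of g "wedge \<phi> \<eta>"])
    then have R: "creation ip f (annihilation g (wedge \<phi> \<eta>)) gs =
        creation ip f (wedge (annihilation g \<phi>) \<eta>) gs + creation ip f (wedge ?p (annihilation g \<eta>)) gs"
      by (simp only: creation_linear) simp
    have A: "annihilation g (creation ip f \<phi>) =
        (\<lambda>gs. ip g f * \<phi> gs + (- 1) * creation ip f (annihilation g \<phi>) gs)"
      by (simp add: annihilation_creation)
    have B: "(\<lambda>gs. (- 1) ^ length gs * creation ip f \<phi> gs) =
        (\<lambda>gs. (- 1) * creation ip f ?p gs + 0 * \<phi> gs)"
      by (simp add: fun_eq_iff creation_parity)
    have "wedge (creation ip f \<phi>) \<eta> (g # gs) =
        ip g f * wedge \<phi> \<eta> gs - wedge (creation ip f (annihilation g \<phi>)) \<eta> gs -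
        wedge (creation ip f ?p) (annihilation g \<eta>) gs"
      unfolding wedge_Cons[of "creation ip f \<phi>"] A B wedge_linear_left by simp
    also have "\<dots> = creation ip f (wedge \<phi> \<eta>) (g # gs)"
      unfolding Cons.IH creation_Cons R by simp
    finally show ?case .
  qed
qed

lemma wedge_vacuum: "wedge vacuum \<eta> = \<eta>"
proof
  fix gs
  show "wedge vacuum \<eta> gs = \<eta> gs"
  proof (induction gs arbitrary: \<eta>)
    case Nil
    show ?case by (simp add: wedge_Nil vacuum_def)
  next
    case (Cons g gs)
    have "annihilation g vacuum = (\<lambda>gs. 0)"
      "(\<lambda>gs. (- 1) ^ length gs * vacuum gs) = (vacuum :: 'a form)"
      by (auto simp: fun_eq_iff annihilation_def vacuum_def)
    moreover have "wedge (\<lambda>gs. 0) \<eta> gs = 0" by (simp add: wedge_def)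
    ultimately show ?case
      by (simp only: wedge_Cons Cons.IH) (simp add: annihilation_def)
  qed
qed

text \<open>The product \<open>f\<^sub>1 \<and> \<dots> \<and> f\<^sub>n \<and> \<phi>\<close>.\<close>

definition slater :: "'h::complex_inner list \<Rightarrow> 'h form \<Rightarrow> 'h form" where
  "slater fs \<phi> = foldr (creation cinner) fs \<phi>"

lemma slater_simps [simp]:
  "slater [] \<phi> = \<phi>" "slater (f # fs) \<phi> = creation cinner f (slater fs \<phi>)"
  by (simp_all add: slater_def)

text \<open>Turns multiplication by a decomposable form into iterated creation, an operation that
  intertwiners respect.\<close>

lemma wedge_slater: "wedge (slater fs vacuum) \<eta> = slater fs \<eta>"
  by (induction fs) (simp_all add: wedge_vacuum wedge_creation)

lemma alt_form_slater:
  "cprojection P \<Longrightarrow> alt_form scaleC P \<phi> \<Longrightarrow> (\<And>f. f \<in> set fs \<Longrightarrow> P f = f) \<Longrightarrow>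
    alt_form scaleC P (slater fs \<phi>)"
  by (induction fs) (auto intro: alt_form_creation)

lemma slater_degree:
  assumes "\<And>gs. length gs \<noteq> n \<Longrightarrow> \<phi> gs = 0"
  shows "length gs \<noteq> length fs + n \<Longrightarrow> slater fs \<phi> gs = 0"
proof (induction fs arbitrary: gs)
  case (Cons f fs)
  have "slater fs \<phi> (remove_nth k gs) = 0" if "k < length gs" for k
    using that Cons.prems by (intro Cons.IH) (auto simp: remove_nth_def)
  then show ?case by (simp add: creation_def)
qed (use assms in simp)

lemma slater_orthonormal:
  assumes "distinct fs" "orthonormal (set fs)" shows "slater fs vacuum fs = 1"
  using assms
proof (induction fs)
  case (Cons f fs)
  have "orthonormal (set fs)" using Cons.prems(2) by (auto simp: orthonormal_def)
  moreover have "creation cinner f \<phi> fs = 0" for \<phi>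
    using Cons.prems orthonormalD[OF Cons.prems(2), of _ f] by (intro creation_orthogonal) auto
  ultimately show ?case
    using Cons orthonormalD[OF Cons.prems(2), of f f] by (simp add: creation_Cons)
qed (simp add: vacuum_def)

text \<open>The wedge of an orthonormal list takes the value 1 on that list, so the coefficient is
  the value of \<open>\<eta>\<close> there.\<close>

lemma top_power_slater:
  assumes W: "cprojection W" and \<eta>: "\<eta> \<in> top_power W"
    and fs: "distinct fs" "orthonormal (set fs)" "cspan (set fs) = range W"
  shows "\<eta> = (\<lambda>gs. \<eta> fs * slater fs vacuum gs)"
proof
  fix gs
  have W_fs: "W f = f" if "f \<in> set fs" for f
  proof -
    have "f \<in> range W" using that fs(3) cspan_superset by blast
    then show ?thesis using cprojection_idem[OF W] by auto
  qed
  have n: "has_cdim (range W) (length fs)"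
    unfolding has_cdim_def using fs by (intro exI[of _ "set fs"]) (simp add: distinct_card)
  have "1 * \<eta> gs + (- \<eta> fs) * slater fs vacuum gs = 0"
  proof (rule top_form_zero[OF W fs])
    show "alt_form scaleC W (\<lambda>gs. 1 * \<eta> gs + (- \<eta> fs) * slater fs vacuum gs)"
      using W_fs by (intro alt_form_linear top_powerD(1)[OF \<eta>] alt_form_slater W alt_form_vacuum)
    show "1 * \<eta> gs + (- \<eta> fs) * slater fs vacuum gs = 0" if "length gs \<noteq> length fs" for gs
      using slater_degree[of 0 vacuum gs fs] that top_power_degree[OF \<eta> n that] by (simp add: vacuum_def)
    show "1 * \<eta> fs + (- \<eta> fs) * slater fs vacuum fs = 0"
      using slater_orthonormal[OF fs(1,2)] by simp
  qed
  then show "\<eta> gs = \<eta> fs * slater fs vacuum gs" by simp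
qed


section \<open>Intertwiners and volume elements\<close>

lemma gap_projections:
  assumes "proj_le Q P"
  defines "W \<equiv> \<lambda>x. P x - Q x"
  shows "W (P x) = W x" "W (Q x) = 0" "P (W x) = W x" "Q (W x) = 0" "P (x - Q x) = W x"
  using proj_leD[OF assms(1)] by (simp_all add: W_def cprojectionD)

lemma top_power_gap_fock_space:
  assumes "proj_le Q P" "\<omega> \<in> top_power (\<lambda>x. P x - Q x)"
  shows "\<omega> \<in> fock_space scaleC P"
proof -
  have "alt_form scaleC P \<omega>"
    using top_powerD(1)[OF assms(2)] by (rule alt_form_superspace) (rule gap_projections(1)[OF assms(1)])
  then show ?thesis using top_powerD(2)[OF assms(2)] by (simp add: fock_space_def)
qed

text \<open>The volume element is killed by the annihilators of the representation of
  \<open>Q\<close>: it vanishes on arguments from the range of \<open>Q\<close>, and one more vector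
  created in the gap would exceed its dimension. This is the hypothesis of
  \<open>vacuum_intertwiner_properties\<close>.\<close>

lemma gap_intertwiner:
  assumes le: "proj_le Q P" and \<omega>: "\<omega> \<in> top_power (\<lambda>x. P x - Q x)" "fock_norm \<omega> = 1"
  defines "T \<equiv> vacuum_intertwiner P Q \<omega>"
  shows "fock2_unitary P Q T" "intertwines P Q T" "T (tensor \<omega> vacuum) = fock2_vacuum"
proof -
  let ?W = "\<lambda>x. P x - Q x"
  note PQ = proj_leD[OF le] and W = cprojection_gap[OF le] and alt = top_powerD(1)[OF \<omega>(1)]
  obtain n where n: "has_cdim (range ?W) n" using top_powerD(3)[OF \<omega>(1)] by blast
  obtain T0 where T0: "fock2_unitary P Q T0" "intertwines P Q T0"
    using intertwiner_exists[OF le n] by blast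
  have w: "tensor \<omega> vacuum \<in> fock2 P" "fock2_norm (tensor \<omega> vacuum) = 1"
    using top_power_gap_fock_space[OF le \<omega>(1)] \<omega>(2)
    by (simp_all add: tensor_vacuum_in_fock2_iff fock2_norm_tensor_vacuum)
  have "\<omega> (Q g # gs) = 0" for g gs
    using alt_form_map_head[OF alt W, of "Q g" gs] alt_form_scale_head[OF alt, of 0 0 gs]
      gap_projections(2)[OF le, of g] by simp
  then have ann: "qf_annihilation P (Q g) (tensor \<omega> vacuum) = (\<lambda>gs hs. 0)" for g
    unfolding qf_annihilation_eq by (simp add: fun_eq_iff PQ tensor_def creation_def cinner_bar_def)
  \<comment> \<open>The created form has degree n + 1, and on a space of dimension n there is no
    nonzero alternating form of that degree.\<close>
  have cre0: "creation cinner (?W h) \<omega> gs = 0" for h gs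
  proof (cases "length gs = Suc n")
    case True
    have "alt_form scaleC ?W (creation cinner (?W h) \<omega>)"
      by (intro alt_form_creation fock_structure_cinner W alt cprojection_idem)
    then show ?thesis by (rule alt_form_above_dimension[OF W n]) (simp add: True)
  next
    case False
    have "\<omega> (remove_nth k gs) = 0" if "k < length gs" for k
      using that False by (intro top_power_degree[OF \<omega>(1) n]) (auto simp: remove_nth_def)
    then show ?thesis by (simp add: creation_def)
  qed
  have cre: "qf_creation P (h - Q h) (tensor \<omega> vacuum) = (\<lambda>gs hs. 0)" for h
    unfolding qf_creation_eq gap_projections(5)[OF le]
    using cre0[of h] creation_mult[of cinner "?W h" "vacuum _" \<omega>]
    by (simp add: fun_eq_iff tensor_def mult.commute[of "\<omega> _"]) (simp add: vacuum_def)
  show "fock2_unitary P Q T" "intertwines P Q T" "T (tensor \<omega> vacuum) = fock2_vacuum"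
    unfolding T_def by (rule vacuum_intertwiner_properties[OF PQ(1,2) T0 w ann cre])+
qed

lemma tensor_creation:
  assumes "P f = f"
  shows "tensor (creation cinner f \<phi>) vacuum = qf_creation P f (tensor \<phi> vacuum)"
  unfolding qf_creation_eq using creation_mult[of cinner f "vacuum _" \<phi>]
  by (simp add: fun_eq_iff tensor_def assms mult.commute[of "\<phi> _"] mult.commute[of "creation _ _ _ _"])
     (simp add: vacuum_def)

text \<open>For a vector fixed by both projections the creation generator acts as plain creation in
  either Fock space, so it can be pulled through \<open>T\<close>.\<close>

lemma intertwiner_slater:
  assumes P: "cprojection P" "intertwines P Q T" "T (tensor \<omega> vacuum) = tensor \<eta> vacuum"
    "tensor \<omega> vacuum \<in> fock2 P"
    and fs: "\<And>f. f \<in> set fs \<Longrightarrow> P f = f \<and> Q f = f"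
  shows "tensor (slater fs \<omega>) vacuum \<in> fock2 P \<and>
    T (tensor (slater fs \<omega>) vacuum) = tensor (slater fs \<eta>) vacuum"
  using fs
proof (induction fs)
  case (Cons f fs)
  then have f: "P f = f" "Q f = f"
    and IH: "tensor (slater fs \<omega>) vacuum \<in> fock2 P"
      "T (tensor (slater fs \<omega>) vacuum) = tensor (slater fs \<eta>) vacuum" by auto
  have "T (tensor (slater (f # fs) \<omega>) vacuum) = qf_creation Q f (tensor (slater fs \<eta>) vacuum)"
    unfolding slater_simps tensor_creation[of P f, OF f(1)] intertwinesD(1)[OF P(2) IH(1)] IH(2) ..
  then show ?case
    using fock2_qf_creation[OF P(1) IH(1), of f]
    by (simp only: slater_simps tensor_creation[of P f, OF f(1)] tensor_creation[of Q f, OF f(2), symmetric])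
qed (use P in simp)

lemma csubspace_range:
  assumes "cprojection W" shows "csubspace (range W)"
proof -
  have "0 \<in> range W" "W x + W y \<in> range W" "a *c W x \<in> range W" for x y a
    using cprojectionD(1,2,5)[OF assms] by (metis rangeI)+
  then show ?thesis unfolding csubspace_def by blast
qed

text \<open>\<open>Q\<close> kills the first gap and fixes the second, so orthonormal bases of the
  two are mutually orthogonal and combine to one of the total gap.\<close>

lemma has_cdim_gap:
  assumes PQ: "proj_le Q P" "proj_le R Q"
    and n: "has_cdim (range (\<lambda>x. P x - Q x)) n" and m: "has_cdim (range (\<lambda>x. Q x - R x)) m"
  shows "has_cdim (range (\<lambda>x. P x - R x)) (m + n)"
proof -
  let ?W1 = "\<lambda>x. P x - Q x" and ?W2 = "\<lambda>x. Q x - R x" and ?W = "\<lambda>x. P x - R x"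
  note W1 = cprojection_gap[OF PQ(1)] and W2 = cprojection_gap[OF PQ(2)]
  note W = cprojection_gap[OF proj_le_trans[OF PQ(2,1)]]
  note D = proj_leD[OF PQ(1)] proj_leD[OF PQ(2)] proj_leD[OF proj_le_trans[OF PQ(2,1)]]
  obtain E F where E: "finite E" "card E = n" "orthonormal E" "cspan E = range ?W1"
    and F: "finite F" "card F = m" "orthonormal F" "cspan F = range ?W2"
    using n m by (auto simp: has_cdim_def)
  have E1: "P e = e" "Q e = 0" if "e \<in> E" for e
  proof -
    have "e \<in> range ?W1" using that E(4) cspan_superset by blast
    then show "P e = e" "Q e = 0" using D by (auto simp: cprojectionD)
  qed
  have F1: "Q f = f" "R f = 0" if "f \<in> F" for f
  proof -
    have "f \<in> range ?W2" using that F(4) cspan_superset by blast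
    then show "Q f = f" "R f = 0" using D by (auto simp: cprojectionD)
  qed
  have orth: "cinner e f = 0" "cinner f e = 0" if "e \<in> E" "f \<in> F" for e f
  proof -
    have "cinner e f = cinner (Q e) f"
      using F1(1)[OF that(2)] cprojection_adj[OF D(2), of e f] by simp
    then show "cinner e f = 0" using E1(2)[OF that(1)] by simp
    then show "cinner f e = 0" using cinner_eq_0_commute by blast
  qed
  have disj: "E \<inter> F = {}" using orth orthonormalD[OF E(3)] by fastforce
  have on: "orthonormal (F \<union> E)"
    using orth E(3) F(3) disj unfolding orthonormal_def by auto
  have "cspan (F \<union> E) = range ?W"
  proof
    have "?W x = x" if "x \<in> F \<union> E" for x
    proof (cases "x \<in> F")
      case True
      then have "P x = x" "R x = 0" using F1 D(3)[of x] by auto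
      then show ?thesis by simp
    next
      case False
      then have "P x = x" "R x = 0" using that E1 D(8)[of x] cprojection_0[OF D(6)] by auto
      then show ?thesis by simp
    qed
    then have "F \<union> E \<subseteq> range ?W"
      by (intro subsetI range_eqI) (rule sym)
    moreover have "csubspace (range ?W)" by (rule csubspace_range[OF W])
    ultimately show "cspan (F \<union> E) \<subseteq> range ?W" by (rule cspan_minimal)
    show "range ?W \<subseteq> cspan (F \<union> E)"
    proof
      fix y assume "y \<in> range ?W"
      then obtain x where "y = ?W2 x + ?W1 x" by auto
      moreover have "?W2 x \<in> cspan (F \<union> E)" "?W1 x \<in> cspan (F \<union> E)"
        using E(4) F(4) cspan_mono[of F "F \<union> E"] cspan_mono[of E "F \<union> E"] by auto
      ultimately show "y \<in> cspan (F \<union> E)" using csubspace_add[OF csubspace_cspan] by metis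
    qed
  qed
  then show ?thesis
    unfolding has_cdim_def using on E F disj
    by (intro exI[of _ "F \<union> E"]) (auto simp: card_Un_disjoint Int_commute)
qed

text \<open>Writing \<open>\<eta>\<close> as a multiple of a wedge of vectors makes the product an
  iterated creation on \<open>\<omega>\<close>. The intertwiner turns \<open>\<omega>\<close> into
  the vacuum and leaves these creations alone, so the result is \<open>\<eta>\<close>; by linearity
  the product cannot vanish when \<open>\<eta>\<close> does not.\<close>

lemma wedge_gap:
  assumes PQ: "proj_le Q P" "proj_le R Q"
    and \<omega>: "\<omega> \<in> top_power (\<lambda>x. P x - Q x)" and \<eta>: "\<eta> \<in> top_power (\<lambda>x. Q x - R x)"
  shows "wedge \<eta> \<omega> \<in> top_power (\<lambda>x. P x - R x)"
    and "fock_norm \<omega> = 1 \<Longrightarrow>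
      vacuum_intertwiner P Q \<omega> (tensor (wedge \<eta> \<omega>) vacuum) = tensor \<eta> vacuum"
    and "fock_norm \<omega> = 1 \<Longrightarrow> \<eta> \<noteq> (\<lambda>gs. 0) \<Longrightarrow> wedge \<eta> \<omega> \<noteq> (\<lambda>gs. 0)"
proof -
  let ?W1 = "\<lambda>x. P x - Q x" and ?W2 = "\<lambda>x. Q x - R x" and ?W = "\<lambda>x. P x - R x"
  let ?T = "vacuum_intertwiner P Q \<omega>"
  note PR = proj_le_trans[OF PQ(2,1)]
  note W2 = cprojection_gap[OF PQ(2)] and W = cprojection_gap[OF PR]
  note D = proj_leD[OF PQ(1)] proj_leD[OF PQ(2)] proj_leD[OF PR]
  obtain n where n: "has_cdim (range ?W1) n" using top_powerD(3)[OF \<omega>] by blast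
  obtain m where m: "has_cdim (range ?W2) m" using top_powerD(3)[OF \<eta>] by blast
  obtain fs where fs: "distinct fs" "length fs = m" "orthonormal (set fs)" "cspan (set fs) = range ?W2"
    using has_cdim_list[OF m] by blast
  have F: "P f = f" "Q f = f" "R f = 0" if "f \<in> set fs" for f
  proof -
    have "f \<in> range ?W2" using that fs(4) cspan_superset by blast
    then show "P f = f" "Q f = f" "R f = 0" using D by (auto simp: cprojectionD)
  qed
  define c where "c = \<eta> fs"
  have \<eta>_eq: "\<eta> = (\<lambda>gs. c * slater fs vacuum gs)"
    unfolding c_def by (rule top_power_slater[OF W2 \<eta> fs(1,3,4)])
  have wedge_eq: "wedge \<eta> \<omega> = (\<lambda>gs. c * slater fs \<omega> gs)"
    using wedge_scale[of c "slater fs vacuum" 1 \<omega>] wedge_slater[of fs \<omega>]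
    by (simp add: fun_eq_iff \<eta>_eq)
  have \<omega>P: "tensor \<omega> vacuum \<in> fock2 P"
    unfolding tensor_vacuum_in_fock2_iff by (rule top_power_gap_fock_space[OF PQ(1) \<omega>])
  \<comment> \<open>Applied to the identity, \<open>intertwiner_slater\<close> yields membership of
    the iterated creations in the Fock space.\<close>
  have "intertwines P P (\<lambda>\<psi>. \<psi>)" by (simp add: intertwines_def)
  then have mem: "tensor (slater fs \<omega>) vacuum \<in> fock2 P"
    using intertwiner_slater[OF D(1), of P "\<lambda>\<psi>. \<psi>" \<omega> \<omega> fs] \<omega>P F(1) by simp
  have tensor_scale: "tensor (\<lambda>gs. c * \<phi> gs) vacuum = (\<lambda>gs hs. c * tensor \<phi> vacuum gs hs)"
    for \<phi> :: "'a form"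
    by (simp add: fun_eq_iff tensor_def mult.assoc)
  have mem': "tensor (wedge \<eta> \<omega>) vacuum \<in> fock2 P"
    unfolding wedge_eq tensor_scale by (rule fock2_mult[OF mem])
  have alt: "alt_form scaleC ?W (wedge \<eta> \<omega>)"
  proof -
    have "alt_form scaleC ?W \<omega>"
      using top_powerD(1)[OF \<omega>] by (rule alt_form_superspace) (simp add: D cprojectionD)
    then show ?thesis
      unfolding wedge_eq using F by (intro alt_form_mult alt_form_slater W) auto
  qed
  show "wedge \<eta> \<omega> \<in> top_power ?W"
    unfolding top_power_def
  proof (intro CollectI conjI exI[of _ "m + n"] allI impI)
    show "wedge \<eta> \<omega> \<in> fock_space scaleC ?W"
      using mem' alt unfolding tensor_vacuum_in_fock2_iff by (simp add: fock_space_def)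
    show "has_cdim (range ?W) (m + n)" by (rule has_cdim_gap[OF PQ n m])
    fix gs :: "'a list" assume "length gs \<noteq> m + n"
    then show "wedge \<eta> \<omega> gs = 0"
      using slater_degree[of n \<omega> gs fs] top_power_degree[OF \<omega> n] fs(2) by (simp add: wedge_eq)
  qed
  assume norm: "fock_norm \<omega> = 1"
  note T = gap_intertwiner[OF PQ(1) \<omega> norm]
  show eq: "?T (tensor (wedge \<eta> \<omega>) vacuum) = tensor \<eta> vacuum"
  proof -
    have "tensor \<eta> vacuum = (\<lambda>gs hs. c * tensor (slater fs vacuum) vacuum gs hs)"
      by (subst \<eta>_eq) (rule tensor_scale)
    then show ?thesis
      unfolding wedge_eq tensor_scale
      using intertwiner_slater[OF D(1) T(2,3) \<omega>P, of fs] F(1,2) fock2_unitaryD(5)[OF T(1) mem, of c]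
      by simp
  qed
  assume nz: "\<eta> \<noteq> (\<lambda>gs. 0)"
  show "wedge \<eta> \<omega> \<noteq> (\<lambda>gs. 0)"
  proof
    assume "wedge \<eta> \<omega> = (\<lambda>gs. 0)"
    moreover have "tensor (\<lambda>gs. 0) vacuum = ((\<lambda>gs hs. 0) :: 'a biform)"
      by (simp add: fun_eq_iff tensor_def)
    ultimately have "tensor \<eta> vacuum = (\<lambda>gs hs. 0)"
      using eq fock2_unitaryD(5)[OF T(1) mem, of 0] by simp
    from fun_cong[OF fun_cong[OF this], of _ "[]"] nz show False
      by (simp add: tensor_def vacuum_def fun_eq_iff)
  qed
qed

lemma fock_norm_nonzero:
  fixes \<phi> :: "'h::complex_inner form"
  assumes "fock_norm \<phi> = 1" shows "\<phi> \<noteq> (\<lambda>gs. 0)"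
  using assms fock2_norm_tensor_vacuum[of \<phi>] fock2_norm_zero[where 'a = 'h]
  by (auto simp: tensor_def[abs_def])

text \<open>Both sides intertwine the same representations, so they differ by a scalar. It is read
  off at \<open>tensor \<xi> vacuum\<close>, which the direct intertwiner sends to the vacuum and
  the composite to \<open>c\<close> times the vacuum.\<close>

lemma gap_intertwiner_compose:
  assumes PQ: "proj_le Q P" "proj_le R Q"
    and \<omega>: "\<omega> \<in> top_power (\<lambda>x. P x - Q x)" "fock_norm \<omega> = 1"
    and \<eta>: "\<eta> \<in> top_power (\<lambda>x. Q x - R x)" "fock_norm \<eta> = 1"
    and \<xi>: "\<xi> \<in> top_power (\<lambda>x. P x - R x)" "fock_norm \<xi> = 1" "\<xi> = (\<lambda>gs. c * wedge \<eta> \<omega> gs)"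
    and \<psi>: "\<psi> \<in> fock2 P"
  shows "vacuum_intertwiner Q R \<eta> (vacuum_intertwiner P Q \<omega> \<psi>) =
    (\<lambda>gs hs. c * vacuum_intertwiner P R \<xi> \<psi> gs hs)"
proof -
  note PR = proj_le_trans[OF PQ(2,1)]
  note T1 = gap_intertwiner[OF PQ(1) \<omega>] and T2 = gap_intertwiner[OF PQ(2) \<eta>]
    and T = gap_intertwiner[OF PR \<xi>(1,2)]
  note P = proj_leD(1)[OF PQ(1)] and R = proj_leD(2)[OF PQ(2)]
  let ?T1 = "vacuum_intertwiner P Q \<omega>" and ?T2 = "vacuum_intertwiner Q R \<eta>"
    and ?T = "vacuum_intertwiner P R \<xi>"
  obtain z where z: "\<And>\<psi>. \<psi> \<in> fock2 P \<Longrightarrow> ?T2 (?T1 \<psi>) = (\<lambda>gs hs. z * ?T \<psi> gs hs)"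
    using intertwiners_proportional[OF P R T(1,2) fock2_unitary_compose[OF T1(1) T2(1)]
        intertwines_compose[OF T1(1,2) T2(2)]] by blast
  have w: "tensor (wedge \<eta> \<omega>) vacuum \<in> fock2 P"
    unfolding tensor_vacuum_in_fock2_iff
    by (rule top_power_gap_fock_space[OF PR wedge_gap(1)[OF PQ \<omega>(1) \<eta>(1)]])
  have \<xi>P: "tensor \<xi> vacuum \<in> fock2 P"
    unfolding tensor_vacuum_in_fock2_iff by (rule top_power_gap_fock_space[OF PR \<xi>(1)])
  have "tensor \<xi> vacuum = (\<lambda>gs hs. c * tensor (wedge \<eta> \<omega>) vacuum gs hs)"
    unfolding \<xi>(3) by (simp add: fun_eq_iff tensor_def mult.assoc)
  then have "?T1 (tensor \<xi> vacuum) = (\<lambda>gs hs. c * tensor \<eta> vacuum gs hs)"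
    using fock2_unitaryD(5)[OF T1(1) w] wedge_gap(2)[OF PQ \<omega>(1) \<eta>(1) \<omega>(2)] by simp
  moreover have "tensor \<eta> vacuum \<in> fock2 Q"
    unfolding tensor_vacuum_in_fock2_iff by (rule top_power_gap_fock_space[OF PQ(2) \<eta>(1)])
  ultimately have "?T2 (?T1 (tensor \<xi> vacuum)) = (\<lambda>gs hs. c * fock2_vacuum gs hs)"
    using fock2_unitaryD(5)[OF T2(1)] T2(3) by simp
  then have "(\<lambda>gs hs. z * (fock2_vacuum :: 'a biform) gs hs) = (\<lambda>gs hs. c * fock2_vacuum gs hs)"
    using z[OF \<xi>P] T(3) by simp
  from fun_cong[OF fun_cong[OF this, of "[]"], of "[]"] have "z = c"
    by (simp add: tensor_def vacuum_def)
  then show ?thesis using z[OF \<psi>] by simp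
qed


section \<open>Cech cochains\<close>

lemma continuous_map_complex_mult:
  fixes f g :: "'a \<Rightarrow> complex"
  shows "continuous_map X euclidean f \<Longrightarrow> continuous_map X euclidean g \<Longrightarrow>
    continuous_map X euclidean (\<lambda>x. f x * g x)"
  by (simp add: continuous_map_atin tendsto_mult)

lemma continuous_map_complex_inverse:
  fixes f :: "'a \<Rightarrow> complex"
  shows "continuous_map X euclidean f \<Longrightarrow> (\<And>x. x \<in> topspace X \<Longrightarrow> f x \<noteq> 0) \<Longrightarrow>
    continuous_map X euclidean (\<lambda>x. inverse (f x))"
  by (simp add: continuous_map_atin tendsto_inverse)

lemma S1_cochain_mult:
  assumes "S1_cochain M N U p u" "S1_cochain M N U p w"
  shows "S1_cochain M N U p (\<lambda>s x. u s x * w s x)"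
  using assms unfolding S1_cochain_def by (auto simp: norm_mult intro: continuous_map_complex_mult)

lemma S1_cochain_inverse:
  assumes "S1_cochain M N U p u" shows "S1_cochain M N U p (\<lambda>s x. inverse (u s x))"
  unfolding S1_cochain_def
proof (intro ballI conjI)
  fix s assume s: "s \<in> simplices N p"
  with assms show "cmod (inverse (u s x)) = 1" if "x \<in> cap U s" for x
    using that by (simp add: S1_cochain_def norm_inverse)
  show "continuous_map (subtopology M (cap U s)) euclidean (\<lambda>x. inverse (u s x))"
    using assms s by (intro continuous_map_complex_inverse) (fastforce simp: S1_cochain_def)+
qed

lemma cech_d_mult_mult:
  "cech_d_mult (\<lambda>s x. u s x * w s x) s x = cech_d_mult u s x * cech_d_mult w s x"
  unfolding cech_d_mult_def by (simp add: prod.distrib[symmetric] if_distrib cong: if_cong)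

lemma cech_d_mult_inverse:
  "cech_d_mult (\<lambda>s x. inverse (u s x)) s x = inverse (cech_d_mult u s x)"
  unfolding cech_d_mult_def by (simp add: prod_inversef[symmetric] o_def if_distrib cong: if_cong)

lemma cech_d_mult_3:
  "cech_d_mult u [i, j, k] x = u [j, k] x * inverse (u [i, k] x) * u [i, j] x"
  by (simp add: cech_d_mult_def remove_nth_def numeral_3_eq_3)

lemma simplices_1: "s \<in> simplices N 1 \<Longrightarrow> \<exists>i j. s = [i, j] \<and> i < N \<and> j < N"
  by (auto simp: simplices_def length_Suc_conv)

lemma simplices_2: "s \<in> simplices N (Suc 1) \<Longrightarrow> \<exists>i j k. s = [i, j, k] \<and> i < N \<and> j < N \<and> k < N"
  by (auto simp: simplices_def length_Suc_conv)

lemma S1_class_subset: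
  assumes u: "S1_cochain M N U p u"
    and g: "\<And>s x. s \<in> simplices N (Suc p) \<Longrightarrow> x \<in> cap U s \<Longrightarrow> g s x = h s x * cech_d_mult u s x"
  shows "S1_class M N U p g \<subseteq> S1_class M N U p h"
proof
  fix g' assume "g' \<in> S1_class M N U p g"
  then obtain w where "S1_cocycle M N U (Suc p) g'" and w: "S1_cochain M N U p w"
    "\<forall>s\<in>simplices N (Suc p). \<forall>x\<in>cap U s. g' s x = g s x * cech_d_mult w s x"
    by (auto simp: S1_class_def)
  moreover have "\<forall>s\<in>simplices N (Suc p). \<forall>x\<in>cap U s.
      g' s x = h s x * cech_d_mult (\<lambda>s x. u s x * w s x) s x"
    using w(2) g by (simp add: cech_d_mult_mult)
  ultimately show "g' \<in> S1_class M N U p h"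
    unfolding S1_class_def using S1_cochain_mult[OF u w(1)] by blast
qed

text \<open>The cocycle condition sits on the members of a class and is carried over unchanged; the
  reverse inclusion uses the inverse cochain.\<close>

lemma S1_class_eqI:
  assumes u: "S1_cochain M N U 1 u"
    and g: "\<And>i j k x. i < N \<Longrightarrow> j < N \<Longrightarrow> k < N \<Longrightarrow> x \<in> U i \<Longrightarrow> x \<in> U j \<Longrightarrow> x \<in> U k \<Longrightarrow>
      g [i, j, k] x = h [i, j, k] x * (u [j, k] x * inverse (u [i, k] x) * u [i, j] x)"
  shows "S1_class M N U 1 g = S1_class M N U 1 h"
proof (rule antisym)
  have eq: "g s x = h s x * cech_d_mult u s x" if s: "s \<in> simplices N (Suc 1)" "x \<in> cap U s" for s x
  proof -
    obtain i j k where "s = [i, j, k]" "i < N" "j < N" "k < N" using simplices_2[OF s(1)] by blast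
    then show ?thesis using g[of i j k x] s(2) by (simp add: cech_d_mult_3 cap_def)
  qed
  then show "S1_class M N U 1 g \<subseteq> S1_class M N U 1 h" by (rule S1_class_subset[OF u])
  show "S1_class M N U 1 h \<subseteq> S1_class M N U 1 g"
  proof (rule S1_class_subset[OF S1_cochain_inverse[OF u]])
    fix s x assume s: "s \<in> simplices N (Suc 1)" "x \<in> cap U s"
    then obtain i j k where ijk: "s = [i, j, k]" "i < N" "j < N" "k < N" "x \<in> U i" "x \<in> U j" "x \<in> U k"
      using simplices_2[OF s(1)] by (auto simp: cap_def)
    have "cmod (u [a, b] x) = 1" if "a \<in> {i, j, k}" "b \<in> {i, j, k}" for a b
      using u that ijk by (auto simp: S1_cochain_def simplices_def cap_def)
    then have "u [j, k] x \<noteq> 0" "u [i, k] x \<noteq> 0" "u [i, j] x \<noteq> 0" by force+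
    then have "cech_d_mult u s x \<noteq> 0" by (simp add: ijk(1) cech_d_mult_3)
    then show "h s x = g s x * cech_d_mult (\<lambda>s x. inverse (u s x)) s x"
      using eq[OF s] by (simp add: cech_d_mult_inverse)
  qed
qed


section \<open>Continuity of transition functions\<close>

lemma fock2_norm_mult:
  assumes "\<psi> \<in> fock2 P" shows "fock2_norm (\<lambda>gs hs. a * \<psi> gs hs) = cmod a * fock2_norm \<psi>"
proof (cases "a = 0")
  case False
  let ?A = "{E :: 'a set. finite_onb E}" and ?c = "(cmod a)\<^sup>2"
  have ne: "?A \<noteq> {}" using finite_onb_empty by blast
  have c: "0 < ?c" using False by simp
  have "(SUP E\<in>?A. fock2_sum (\<lambda>gs hs. a * \<psi> gs hs) E) \<le> ?c * (SUP E\<in>?A. fock2_sum \<psi> E)"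
    using fock2_sum_le_SUP[OF assms]
    by (intro cSUP_least[OF ne]) (simp add: fock2_sum_mult mult_left_mono)
  moreover have "(SUP E\<in>?A. fock2_sum \<psi> E) \<le> (SUP E\<in>?A. fock2_sum (\<lambda>gs hs. a * \<psi> gs hs) E) / ?c"
  proof (rule cSUP_least[OF ne])
    fix E assume "E \<in> ?A"
    then have "?c * fock2_sum \<psi> E \<le> (SUP E\<in>?A. fock2_sum (\<lambda>gs hs. a * \<psi> gs hs) E)"
      using fock2_sum_le_SUP[OF fock2_mult[OF assms], of E a] by (simp only: fock2_sum_mult) simp
    then show "fock2_sum \<psi> E \<le> (SUP E\<in>?A. fock2_sum (\<lambda>gs hs. a * \<psi> gs hs) E) / ?c"
      using c by (simp only: pos_le_divide_eq mult.commute)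
  qed
  ultimately have "(SUP E\<in>?A. fock2_sum (\<lambda>gs hs. a * \<psi> gs hs) E) = ?c * (SUP E\<in>?A. fock2_sum \<psi> E)"
    using c by (intro antisym) (simp_all only: pos_le_divide_eq mult.commute)
  then show ?thesis unfolding fock2_norm_def by (simp add: real_sqrt_mult)
qed (simp add: fock2_norm_zero)

lemma fock_norm_mult:
  assumes "\<phi> \<in> fock_space scaleC P" shows "fock_norm (\<lambda>gs. a * \<phi> gs) = cmod a * fock_norm \<phi>"
proof -
  have "tensor (\<lambda>gs. a * \<phi> gs) vacuum = (\<lambda>gs hs. a * tensor \<phi> vacuum gs hs)"
    by (simp add: fun_eq_iff tensor_def mult.assoc)
  then show ?thesis
    using fock2_norm_mult[of "tensor \<phi> vacuum" P a] assms
    by (simp add: tensor_vacuum_in_fock2_iff flip: fock2_norm_tensor_vacuum)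
qed

text \<open>A quadratic stand-in for the triangle inequality, sharp enough for continuity.\<close>

lemma fock_norm_linear_le:
  assumes "\<phi> \<in> fock_space scaleC P" "\<eta> \<in> fock_space scaleC P"
  shows "(fock_norm (\<lambda>gs. a * \<phi> gs + b * \<eta> gs))\<^sup>2 \<le>
    2 * (cmod a)\<^sup>2 * (fock_norm \<phi>)\<^sup>2 + 2 * (cmod b)\<^sup>2 * (fock_norm \<eta>)\<^sup>2"
proof -
  let ?S = "\<lambda>\<psi>. SUP E\<in>{E. finite_onb E}. fock2_sum \<psi> E"
  let ?\<phi> = "tensor \<phi> vacuum" and ?\<eta> = "tensor \<eta> vacuum"
  have mem: "?\<phi> \<in> fock2 P" "?\<eta> \<in> fock2 P" using assms by (simp_all add: tensor_vacuum_in_fock2_iff)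
  have sq: "(fock2_norm \<psi>)\<^sup>2 = ?S \<psi>" if "\<psi> \<in> fock2 P" for \<psi>
    using order_trans[OF fock2_sum_nonneg fock2_sum_le_SUP[OF that finite_onb_empty]]
    by (simp add: fock2_norm_def)
  have ne: "{E :: 'a set. finite_onb E} \<noteq> {}" using finite_onb_empty by blast
  have "?S (\<lambda>gs hs. a * ?\<phi> gs hs + b * ?\<eta> gs hs) \<le> 2 * (cmod a)\<^sup>2 * ?S ?\<phi> + 2 * (cmod b)\<^sup>2 * ?S ?\<eta>"
    using fock2_sum_le_SUP[OF mem(1)] fock2_sum_le_SUP[OF mem(2)]
    by (intro cSUP_least[OF ne] order_trans[OF fock2_sum_linear_le] add_mono mult_left_mono) auto
  moreover have "(\<lambda>gs hs. a * ?\<phi> gs hs + b * ?\<eta> gs hs) = tensor (\<lambda>gs. a * \<phi> gs + b * \<eta> gs) vacuum"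
    by (simp add: fun_eq_iff tensor_def algebra_simps)
  ultimately show ?thesis
    using sq[OF mem(1)] sq[OF mem(2)] sq[OF fock2_linear[OF mem, of a b]]
    by (simp add: fock2_norm_tensor_vacuum)
qed

lemma fock_space_whole: "\<phi> \<in> fock_space scaleC W \<Longrightarrow> \<phi> \<in> fock_space scaleC (\<lambda>x. x)"
  unfolding fock_space_def using alt_form_superspace[of scaleC W \<phi> "\<lambda>x. x"] by simp

lemma fock_space_linear:
  assumes "\<phi> \<in> fock_space scaleC P" "\<eta> \<in> fock_space scaleC P"
  shows "(\<lambda>gs. a * \<phi> gs + b * \<eta> gs) \<in> fock_space scaleC P"
proof -
  have "(\<lambda>gs hs. a * tensor \<phi> vacuum gs hs + b * tensor \<eta> vacuum gs hs) =
      tensor (\<lambda>gs. a * \<phi> gs + b * \<eta> gs) vacuum"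
    by (simp add: fun_eq_iff tensor_def algebra_simps)
  then show ?thesis
    using fock2_linear[of "tensor \<phi> vacuum" P "tensor \<eta> vacuum" a b] assms
    by (simp add: tensor_vacuum_in_fock2_iff)
qed

text \<open>From (a y - a x) v y = (w y - w x) - a x (v y - v x) and the unit norm of
  \<open>v y\<close>. The lines at \<open>x\<close> and \<open>y\<close> are different, so the
  differences are taken in the Fock space of the whole Hilbert space.\<close>

lemma transition_continuous:
  assumes w: "fock_continuous M A w" and v: "fock_continuous M A v"
    and mem: "\<And>x. x \<in> A \<Longrightarrow> v x \<in> fock_space scaleC (\<lambda>x. x)"
    and norm: "\<And>x. x \<in> A \<Longrightarrow> fock_norm (v x) = 1"
    and eq: "\<And>x. x \<in> A \<Longrightarrow> w x = (\<lambda>gs. a x * v x gs)"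
  shows "continuous_map (subtopology M A) euclidean a"
  unfolding mtopology_is_euclidean[symmetric] Met_TC.continuous_map_to_metric
proof (intro ballI allI impI)
  fix x and e :: real assume "x \<in> topspace (subtopology M A)" and e: "0 < e"
  then have x: "x \<in> A" by simp
  \<comment> \<open>Chosen so that the final bound, twice the square of (|a x| + 1) d, equals half
    the square of \<open>e\<close>.\<close>
  define d where "d = e / (2 * (cmod (a x) + 1))"
  have pos: "0 < cmod (a x) + 1" by (simp add: add_nonneg_pos)
  then have d: "0 < d" using e by (simp add: d_def)
  obtain V1 where V1: "openin M V1" "x \<in> V1"
    "\<And>y. y \<in> V1 \<inter> A \<Longrightarrow> fock_norm (\<lambda>gs. w y gs - w x gs) < d"
    using w x d unfolding fock_continuous_def by metis
  obtain V2 where V2: "openin M V2" "x \<in> V2"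
    "\<And>y. y \<in> V2 \<inter> A \<Longrightarrow> fock_norm (\<lambda>gs. v y gs - v x gs) < d"
    using v x d unfolding fock_continuous_def by metis
  have "cmod (a y - a x) < e" if y: "y \<in> V1 \<inter> V2 \<inter> A" for y
  proof -
    have yA: "y \<in> A" using y by simp
    let ?w = "\<lambda>gs. w y gs - w x gs" and ?v = "\<lambda>gs. v y gs - v x gs"
    have wm: "w z \<in> fock_space scaleC (\<lambda>x. x)" if "z \<in> A" for z
      using fock_space_linear[OF mem[OF that] mem[OF that], of "a z" 0] eq[OF that] by simp
    have memd: "?w \<in> fock_space scaleC (\<lambda>x. x)" "?v \<in> fock_space scaleC (\<lambda>x. x)"
      using fock_space_linear[OF wm[OF yA] wm[OF x], of 1 "- 1"]
        fock_space_linear[OF mem[OF yA] mem[OF x], of 1 "- 1"] by simp_all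
    have nn: "0 \<le> fock_norm \<phi>" if "\<phi> \<in> fock_space scaleC (\<lambda>x. x)" for \<phi> :: "'b form"
      using fock2_norm_nonneg[of "tensor \<phi> vacuum" "\<lambda>x. x"] that
      by (simp add: tensor_vacuum_in_fock2_iff fock2_norm_tensor_vacuum)
    have "(\<lambda>gs. (a y - a x) * v y gs) = (\<lambda>gs. 1 * ?w gs + (- a x) * ?v gs)"
      by (simp add: fun_eq_iff eq[OF yA] eq[OF x] algebra_simps)
    then have "(cmod (a y - a x))\<^sup>2 = (fock_norm (\<lambda>gs. 1 * ?w gs + (- a x) * ?v gs))\<^sup>2"
      using fock_norm_mult[OF mem[OF yA], of "a y - a x"] norm[OF yA] by simp
    also have "\<dots> \<le> 2 * (cmod 1)\<^sup>2 * (fock_norm ?w)\<^sup>2 + 2 * (cmod (- a x))\<^sup>2 * (fock_norm ?v)\<^sup>2"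
      by (rule fock_norm_linear_le[OF memd])
    also have "\<dots> \<le> 2 * d\<^sup>2 + 2 * (cmod (a x))\<^sup>2 * d\<^sup>2"
      using V1(3)[of y] V2(3)[of y] y nn[OF memd(1)] nn[OF memd(2)]
      by (intro add_mono mult_mono power_mono) auto
    also have "\<dots> \<le> 2 * ((cmod (a x) + 1) * d)\<^sup>2"
    proof -
      have "1 + (cmod (a x))\<^sup>2 \<le> (cmod (a x) + 1)\<^sup>2" by (simp add: power2_sum)
      then have "2 * d\<^sup>2 * (1 + (cmod (a x))\<^sup>2) \<le> 2 * d\<^sup>2 * (cmod (a x) + 1)\<^sup>2"
        by (intro mult_left_mono) auto
      then show ?thesis by (simp only: power_mult_distrib) (simp add: algebra_simps)
    qed
    also have "(cmod (a x) + 1) * d = e / 2"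
    proof -
      have "k * (e / (2 * k)) = e / 2" if "0 < k" for k using that by simp
      then show ?thesis unfolding d_def using pos by blast
    qed
    also have "2 * (e / 2)\<^sup>2 < e\<^sup>2" using e by (simp add: power2_eq_square)
    finally show ?thesis using e by (simp add: power_less_imp_less_base)
  qed
  then show "\<exists>V. openin (subtopology M A) V \<and> x \<in> V \<and> (\<forall>y\<in>V. a y \<in> Met_TC.mball (a x) e)"
    using V1(1,2) V2(1,2) x
    by (intro exI[of _ "V1 \<inter> V2 \<inter> A"])
      (auto simp: openin_subtopology dist_norm norm_minus_commute intro!: exI[of _ "V1 \<inter> V2"])
qed


section \<open>The two cocycles at a point\<close>

lemma prec_cases: "i \<noteq> j \<Longrightarrow> prec lam i j \<or> prec lam j i"
  by (auto simp: prec_def)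

lemma prec_asym: "prec lam i j \<Longrightarrow> \<not> prec lam j i"
  by (auto simp: prec_def)

lemma prec_irrefl [simp]: "\<not> prec lam i i"
  by (simp add: prec_def)

lemma prec_trans: "prec lam i j \<Longrightarrow> prec lam j k \<Longrightarrow> prec lam i k"
  by (auto simp: prec_def)

lemma proj_le_spectral:
  fixes D :: "'m \<Rightarrow> 'h::{complex_inner, complete_space} unb_op"
  assumes "prec lam i j"
  shows "proj_le (spectral_proj (D x) (lam j)) (spectral_proj (D x) (lam i))"
  using assms unfolding proj_le_def prec_def
  by (auto simp: spectral_proj_cprojection spectral_proj_antimono)

lemma top_power_mult:
  "\<phi> \<in> top_power W \<Longrightarrow> (\<lambda>gs. a * \<phi> gs) \<in> top_power W"
  using fock_space_linear[of \<phi> W \<phi> a 0] unfolding top_power_def by auto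

lemma dual_space_mult: "\<phi> \<in> dual_space L \<Longrightarrow> v \<in> L \<Longrightarrow> \<phi> (\<lambda>gs. a * v gs) = a * \<phi> v"
  unfolding dual_space_def by (drule CollectD, elim conjE, drule (1) bspec, drule (1) bspec,
      drule spec[of _ a], drule spec[of _ 0]) simp

text \<open>The algebraic comparison happens at one point \<open>x\<close>, with \<open>I\<close> a
  set of indices whose data are available there. Continuity is treated separately, for the functions
  of \<open>x\<close> that result.\<close>

locale gerbe_point =
  fixes D :: "'m \<Rightarrow> 'h::{complex_inner, complete_space} unb_op" and lam :: "nat \<Rightarrow> real"
    and x :: 'm and I :: "nat set" and \<omega> :: "nat \<Rightarrow> nat \<Rightarrow> 'm \<Rightarrow> 'h form"
    and s :: "nat \<Rightarrow> nat \<Rightarrow> 'm \<Rightarrow> 'h form line_elt"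
  assumes \<omega>: "\<And>a b. a \<in> I \<Longrightarrow> b \<in> I \<Longrightarrow> prec lam a b \<Longrightarrow>
      \<omega> a b x \<in> gap_power D lam a b x \<and> fock_norm (\<omega> a b x) = 1"
    and s: "\<And>a b. a \<in> I \<Longrightarrow> b \<in> I \<Longrightarrow>
      s a b x \<in> index_line D lam a b x \<and> pair (s a b x) (s b a x) = 1"
    and s_norm: "\<And>a b. a \<in> I \<Longrightarrow> b \<in> I \<Longrightarrow> prec lam a b \<Longrightarrow>
      \<exists>v. s b a x = Vec v \<and> fock_norm v = 1"
begin

abbreviation P :: "nat \<Rightarrow> 'h \<Rightarrow> 'h" where "P a \<equiv> spectral_proj (D x) (lam a)"

text \<open>Source first and target second, the reverse of the index order of \<open>qf_S\<close>,
  so that composites can be read as paths.\<close>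

abbreviation F :: "nat \<Rightarrow> nat \<Rightarrow> 'h biform \<Rightarrow> 'h biform" where "F a b \<equiv> qf_S D lam \<omega> b a x"

abbreviation L :: "nat \<Rightarrow> nat \<Rightarrow> 'h form set" where "L a b \<equiv> gap_power D lam a b x"

lemma F_self: "F a a = id"
  by (simp add: qf_S_def)

lemma F_up: "prec lam a b \<Longrightarrow> F a b = vacuum_intertwiner (P a) (P b) (\<omega> a b x)"
  by (simp add: qf_S_def)

lemma F_down: "prec lam a b \<Longrightarrow> F b a = the_inv_into (fock2 (P a)) (F a b)"
  using prec_asym[of lam a b] by (simp add: qf_S_def)

lemma F_up_intertwiner:
  assumes "a \<in> I" "b \<in> I" "prec lam a b"
  shows "fock2_unitary (P a) (P b) (F a b)"
  using gap_intertwiner(1)[OF proj_le_spectral[OF assms(3), of D x]] \<omega>[OF assms]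
  unfolding F_up[OF assms(3)] gap_power_def by blast

lemma F_unitary:
  assumes "a \<in> I" "b \<in> I"
  shows "fock2_unitary (P a) (P b) (F a b)"
proof -
  consider "a = b" | "prec lam a b" | "prec lam b a" using prec_cases by blast
  then show ?thesis
  proof cases
    case 1
    then show ?thesis by (auto simp: F_self fock2_unitary_def)
  next
    case 2
    then show ?thesis by (rule F_up_intertwiner[OF assms])
  next
    case 3
    then show ?thesis
      using fock2_unitary_inverse[OF F_up_intertwiner[OF assms(2,1) 3]] by (simp add: F_down)
  qed
qed

lemma F_mem: "a \<in> I \<Longrightarrow> b \<in> I \<Longrightarrow> \<psi> \<in> fock2 (P a) \<Longrightarrow> F a b \<psi> \<in> fock2 (P b)"
  using fock2_unitaryD(4)[OF F_unitary] by blast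

lemma F_mult: "a \<in> I \<Longrightarrow> b \<in> I \<Longrightarrow> \<psi> \<in> fock2 (P a) \<Longrightarrow>
    F a b (\<lambda>gs hs. z * \<psi> gs hs) = (\<lambda>gs hs. z * F a b \<psi> gs hs)"
  using fock2_unitaryD(5)[OF F_unitary] by blast

lemma F_inverse:
  assumes "a \<in> I" "b \<in> I" "\<psi> \<in> fock2 (P a)"
  shows "F b a (F a b \<psi>) = \<psi>"
proof -
  consider "a = b" | "prec lam a b" | "prec lam b a" using prec_cases by blast
  then show ?thesis
  proof cases
    case 1
    then show ?thesis by (simp add: F_self)
  next
    case 2
    then show ?thesis
      using fock2_unitaryD(1)[OF F_unitary[OF assms(1,2)]] assms(3)
      by (simp add: F_down[OF 2] the_inv_into_f_f bij_betw_def)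
  next
    case 3
    then show ?thesis
      using fock2_unitaryD(1)[OF F_unitary[OF assms(2,1)]] assms(3)
      by (simp add: F_down[OF 3] f_the_inv_into_f bij_betw_def)
  qed
qed

text \<open>The vacuum is a nonzero vector of every Fock space, so the scalar is unique.\<close>

lemma qf_cochain_eqI:
  assumes "\<And>\<psi>. \<psi> \<in> fock2 (P j) \<Longrightarrow> F i j (F k i (F j k \<psi>)) = (\<lambda>gs hs. z * \<psi> gs hs)"
  shows "qf_cochain D lam \<omega> [i, j, k] x = z"
proof -
  have "(THE z. \<forall>\<psi>\<in>fock2 (P j). F i j (F k i (F j k \<psi>)) = (\<lambda>gs hs. z * \<psi> gs hs)) = z"
  proof (rule the_equality)
    fix z' assume "\<forall>\<psi>\<in>fock2 (P j). F i j (F k i (F j k \<psi>)) = (\<lambda>gs hs. z' * \<psi> gs hs)"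
    then have "(\<lambda>gs hs. z' * (fock2_vacuum :: 'h biform) gs hs) = (\<lambda>gs hs. z * fock2_vacuum gs hs)"
      using assms fock2_vacuum_in_fock2[of "P j"] by auto
    from fun_cong[OF fun_cong[OF this, of "[]"], of "[]"] show "z' = z"
      by (simp add: tensor_def vacuum_def)
  qed (use assms in blast)
  then show ?thesis by (simp add: qf_cochain_def)
qed

lemma qf_cochain_degenerate:
  assumes "i \<in> I" "j \<in> I" "k \<in> I" "i = j \<or> j = k \<or> k = i"
  shows "qf_cochain D lam \<omega> [i, j, k] x = 1"
  using assms by (intro qf_cochain_eqI) (auto simp: F_self F_inverse F_mem)

text \<open>Strips the constructor from the section \<open>s b a x\<close> when \<open>a\<close>
  precedes \<open>b\<close>; the indices are in the order of the gap bundle, opposite to that of the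
  section.\<close>

definition vol :: "nat \<Rightarrow> nat \<Rightarrow> 'h form" where
  "vol a b = (THE v. s b a x = Vec v)"

definition cov :: "nat \<Rightarrow> nat \<Rightarrow> 'h form \<Rightarrow> complex" where
  "cov a b = (THE \<phi>. s a b x = Covec \<phi>)"

lemma sections:
  assumes "a \<in> I" "b \<in> I" "prec lam a b"
  shows "s b a x = Vec (vol a b)" "s a b x = Covec (cov a b)" "vol a b \<in> L a b"
    "fock_norm (vol a b) = 1" "cov a b \<in> dual_space (L a b)" "cov a b (vol a b) = 1"
proof -
  obtain v where v: "s b a x = Vec v" "fock_norm v = 1" using s_norm[OF assms] by blast
  have "s a b x \<in> Covec ` dual_space (L a b)"
    using s[OF assms(1,2)] assms(3) by (simp add: index_line_def)
  then obtain \<phi> where \<phi>: "s a b x = Covec \<phi>" "\<phi> \<in> dual_space (L a b)" by blast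
  have "s b a x \<in> Vec ` L a b"
    using s[OF assms(2,1)] assms(3) prec_asym[OF assms(3)] by (simp add: index_line_def)
  then have "v \<in> L a b" using v by auto
  moreover have "\<phi> v = 1" using s[OF assms(1,2)] v \<phi> by simp
  moreover have "vol a b = v" "cov a b = \<phi>" by (simp_all add: vol_def cov_def v \<phi>)
  ultimately show "s b a x = Vec (vol a b)" "s a b x = Covec (cov a b)" "vol a b \<in> L a b"
    "fock_norm (vol a b) = 1" "cov a b \<in> dual_space (L a b)" "cov a b (vol a b) = 1"
    using v \<phi> by simp_all
qed

lemma gap_one_dimensional:
  assumes "prec lam a b" "w \<in> L a b" "w \<noteq> (\<lambda>gs. 0)" "v \<in> L a b"
  shows "\<exists>t. v = (\<lambda>gs. t * w gs)"
  using assms(2-4) unfolding gap_power_def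
  by (intro top_power_one_dimensional[OF cprojection_gap[OF proj_le_spectral[OF assms(1)]]])

definition transition :: "nat \<Rightarrow> nat \<Rightarrow> complex" where
  "transition a b = (SOME t. \<omega> a b x = (\<lambda>gs. t * vol a b gs))"

lemma transition_props:
  assumes "a \<in> I" "b \<in> I" "prec lam a b"
  shows "\<omega> a b x = (\<lambda>gs. transition a b * vol a b gs)" "cmod (transition a b) = 1"
proof -
  note v = sections[OF assms]
  show eq: "\<omega> a b x = (\<lambda>gs. transition a b * vol a b gs)"
    unfolding transition_def
    using someI_ex[OF gap_one_dimensional[OF assms(3) v(3) fock_norm_nonzero[OF v(4)]]] \<omega>[OF assms] by blast
  have "vol a b \<in> fock_space scaleC (\<lambda>v. P a v - P b v)"
    using v(3) by (simp add: gap_power_def top_power_def)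
  from fock_norm_mult[OF this, of "transition a b"] show "cmod (transition a b) = 1"
    using \<omega>[OF assms] v(4) by (simp flip: eq)
qed

lemma wedge_L:
  assumes "prec lam a b" "prec lam b c" "v \<in> L a b" "w \<in> L b c"
  shows "wedge w v \<in> L a c"
  using wedge_gap(1)[OF proj_le_spectral[OF assms(1), of D x] proj_le_spectral[OF assms(2), of D x]]
    assms(3,4) unfolding gap_power_def .

text \<open>The value of both cocycles on an increasing triple is the ratio of the unit element of
  \<open>\<Lambda> W\<^sub>a\<^sub>c\<close> to the product of those of \<open>\<Lambda> W\<^sub>b\<^sub>c\<close> and \<open>\<Lambda> W\<^sub>a\<^sub>b\<close>.\<close>

lemma ratio_exists:
  assumes "a \<in> I" "b \<in> I" "c \<in> I" "prec lam a b" "prec lam b c"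
  shows "\<exists>h. h \<noteq> 0 \<and> vol a c = (\<lambda>gs. h * wedge (vol b c) (vol a b) gs)"
proof -
  have ac: "prec lam a c" using assms(4,5) by (rule prec_trans)
  note ab = sections[OF assms(1,2,4)] and bc = sections[OF assms(2,3,5)] and ac' = sections[OF assms(1,3) ac]
  let ?w = "wedge (vol b c) (vol a b)"
  have le: "proj_le (P b) (P a)" "proj_le (P c) (P b)" using assms(4,5) by (auto intro: proj_le_spectral)
  have w: "?w \<in> L a c" by (rule wedge_L[OF assms(4,5) ab(3) bc(3)])
  have w0: "?w \<noteq> (\<lambda>gs. 0)"
    using wedge_gap(3)[OF le] ab(3,4) bc(3) fock_norm_nonzero[OF bc(4)] unfolding gap_power_def by blast
  obtain h where h: "vol a c = (\<lambda>gs. h * ?w gs)"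
    using gap_one_dimensional[OF ac w w0 ac'(3)] by blast
  then have "h \<noteq> 0" using fock_norm_nonzero[OF ac'(4)] by auto
  with h show ?thesis by blast
qed

text \<open>All six values come from the single relation \<open>comp\<close> between the composite
  through \<open>b\<close> and the direct map from \<open>a\<close> to \<open>c\<close>. Even orders
  run around the triangle in the direction that yields \<open>g\<close>, odd orders in the opposite
  one.\<close>

lemma qf_cochain_sorted:
  assumes abc: "a \<in> I" "b \<in> I" "c \<in> I" "prec lam a b" "prec lam b c"
    and h: "vol a c = (\<lambda>gs. h * wedge (vol b c) (vol a b) gs)" "h \<noteq> 0"
  defines "g \<equiv> h * (inverse (transition b c) * transition a c * inverse (transition a b))"
  shows "qf_cochain D lam \<omega> [a, b, c] x = g" "qf_cochain D lam \<omega> [c, a, b] x = g"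
    "qf_cochain D lam \<omega> [b, c, a] x = g" "qf_cochain D lam \<omega> [c, b, a] x = inverse g"
    "qf_cochain D lam \<omega> [a, c, b] x = inverse g" "qf_cochain D lam \<omega> [b, a, c] x = inverse g"
proof -
  have ac: "prec lam a c" using abc(4,5) by (rule prec_trans)
  note t = transition_props[OF abc(1,2,4)] transition_props[OF abc(2,3,5)] transition_props[OF abc(1,3) ac]
  have nz: "transition a b \<noteq> 0" "transition b c \<noteq> 0" "transition a c \<noteq> 0"
    using t by auto
  then have "g \<noteq> 0" using h(2) by (simp add: g_def)
  \<comment> \<open>Inserting the transition factors into the relation between the sections gives
    the relation between the chosen volume elements.\<close>
  have \<omega>_eq: "\<omega> a c x = (\<lambda>gs. g * wedge (\<omega> b c x) (\<omega> a b x) gs)"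
    using nz by (simp add: t(1,3,5) wedge_scale h(1) g_def fun_eq_iff field_simps)
  have comp: "F b c (F a b \<psi>) = (\<lambda>gs hs. g * F a c \<psi> gs hs)" if "\<psi> \<in> fock2 (P a)" for \<psi>
    unfolding F_up[OF abc(4)] F_up[OF abc(5)] F_up[OF ac]
    using \<omega>[OF abc(1,2,4)] \<omega>[OF abc(2,3,5)] \<omega>[OF abc(1,3) ac] unfolding gap_power_def
    by (intro gap_intertwiner_compose proj_le_spectral abc(4,5) \<omega>_eq that) auto
  have comp': "F a c \<psi> = (\<lambda>gs hs. inverse g * F b c (F a b \<psi>) gs hs)" if "\<psi> \<in> fock2 (P a)" for \<psi>
    using \<open>g \<noteq> 0\<close> by (simp add: comp[OF that] mult.assoc[symmetric])
  note mem = F_mem[OF abc(1,2)] F_mem[OF abc(2,1)] F_mem[OF abc(1,3)] F_mem[OF abc(3,1)]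
    F_mem[OF abc(2,3)] F_mem[OF abc(3,2)]
  note inv = F_inverse[OF abc(1,2)] F_inverse[OF abc(2,1)] F_inverse[OF abc(1,3)]
    F_inverse[OF abc(3,1)] F_inverse[OF abc(2,3)] F_inverse[OF abc(3,2)]
  note mult = F_mult[OF abc(1,2)] F_mult[OF abc(2,1)] F_mult[OF abc(1,3)]
    F_mult[OF abc(3,1)] F_mult[OF abc(2,3)] F_mult[OF abc(3,2)]
  have up_b: "F b c \<psi> = (\<lambda>gs hs. g * F a c (F b a \<psi>) gs hs)" if "\<psi> \<in> fock2 (P b)" for \<psi>
    using comp[OF mem(2)[OF that]] by (simp add: inv that)
  show "qf_cochain D lam \<omega> [a, b, c] x = g"
    by (rule qf_cochain_eqI) (simp add: up_b mult mem inv)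
  show "qf_cochain D lam \<omega> [c, a, b] x = g"
    by (rule qf_cochain_eqI) (simp add: comp mult mem inv)
  show "qf_cochain D lam \<omega> [b, c, a] x = g"
    by (rule qf_cochain_eqI) (simp add: comp mem inv)
  show "qf_cochain D lam \<omega> [c, b, a] x = inverse g"
    by (rule qf_cochain_eqI) (simp add: comp' mult mem inv)
  show "qf_cochain D lam \<omega> [b, a, c] x = inverse g"
  proof (rule qf_cochain_eqI)
    fix \<psi> assume \<psi>: "\<psi> \<in> fock2 (P a)"
    have "F b a (F c b (F a c \<psi>)) = F b a (F c b (\<lambda>gs hs. inverse g * F b c (F a b \<psi>) gs hs))"
      by (simp only: comp'[OF \<psi>])
    also have "\<dots> = (\<lambda>gs hs. inverse g * \<psi> gs hs)" by (simp add: mult mem inv \<psi>)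
    finally show "F b a (F c b (F a c \<psi>)) = (\<lambda>gs hs. inverse g * \<psi> gs hs)" .
  qed
  show "qf_cochain D lam \<omega> [a, c, b] x = inverse g"
  proof (rule qf_cochain_eqI)
    fix \<psi> assume \<psi>: "\<psi> \<in> fock2 (P c)"
    have "F a c (F b a (F c b \<psi>)) = (\<lambda>gs hs. inverse g * F b c (F a b (F b a (F c b \<psi>))) gs hs)"
      by (rule comp') (intro mem \<psi>)
    also have "\<dots> = (\<lambda>gs hs. inverse g * \<psi> gs hs)" by (simp add: mem inv \<psi>)
    finally show "F a c (F b a (F c b \<psi>)) = (\<lambda>gs hs. inverse g * \<psi> gs hs)" .
  qed
qed

section \<open>The index cocycle at a point\<close>

text \<open>Evaluated at the dual sections the tensor is 1, so \<open>theta\<close> is nonzero there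
  and the factor is unique.\<close>

lemma index_cochain_eqI:
  assumes ijk: "i \<in> I" "j \<in> I" "k \<in> I"
    and eq: "\<And>p q r. p \<in> index_line D lam j i x \<Longrightarrow> q \<in> index_line D lam k j x \<Longrightarrow>
      r \<in> index_line D lam i k x \<Longrightarrow>
      pair (s i j x) p * pair (s j k x) q * pair (s k i x) r = z * theta D lam i j k x p q r"
  shows "index_cochain D lam s [i, j, k] x = z"
proof -
  let ?t = "theta D lam i j k x"
  have "(THE z. \<forall>p\<in>index_line D lam j i x. \<forall>q\<in>index_line D lam k j x. \<forall>r\<in>index_line D lam i k x.
        tensor3 (s i j x) (s j k x) (s k i x) p q r = z * ?t p q r) = z"
  proof (rule the_equality)
    fix z' assume z': "\<forall>p\<in>index_line D lam j i x. \<forall>q\<in>index_line D lam k j x. \<forall>r\<in>index_line D lam i k x.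
        tensor3 (s i j x) (s j k x) (s k i x) p q r = z' * ?t p q r"
    let ?p = "s j i x" and ?q = "s k j x" and ?r = "s i k x"
    have one: "tensor3 (s i j x) (s j k x) (s k i x) ?p ?q ?r = 1"
      using s ijk by (simp add: tensor3_def)
    have "z' * ?t ?p ?q ?r = 1" using z' s ijk one by auto
    moreover have "z * ?t ?p ?q ?r = 1"
      using eq[of ?p ?q ?r] s ijk one by (simp add: tensor3_def)
    ultimately show "z' = z" by (metis mult_cancel_right mult_zero_right zero_neq_one)
  qed (use eq in \<open>simp add: tensor3_def\<close>)
  then show ?thesis by (simp add: index_cochain_def)
qed

text \<open>On a line, a vector and a covector with pairing 1 are dual bases; their tensor product
  is then the canonical pairing.\<close>

lemma pair_dual:
  assumes ab: "a \<in> I" "b \<in> I" and p: "p \<in> index_line D lam b a x" and q: "q \<in> index_line D lam a b x"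
  shows "pair (s a b x) p * pair (s b a x) q = pair p q"
proof -
  have *: "cov a b e * \<phi> (vol a b) = \<phi> e"
    if *: "a \<in> I" "b \<in> I" "prec lam a b" "e \<in> L a b" "\<phi> \<in> dual_space (L a b)" for a b e \<phi>
  proof -
    note v = sections[OF *(1-3)]
    obtain t where "e = (\<lambda>gs. t * vol a b gs)"
      using gap_one_dimensional[OF *(3) v(3) fock_norm_nonzero[OF v(4)] *(4)] by blast
    then show ?thesis
      using dual_space_mult[OF *(5) v(3), of t] dual_space_mult[OF v(5,3), of t] v(6) by simp
  qed
  consider "a = b" | "prec lam a b" | "prec lam b a" using prec_cases by blast
  then show ?thesis
  proof cases
    case 1
    \<comment> \<open>On the diagonal the section is paired with itself, so its square is 1.\<close>
    then obtain \<sigma> where "s a a x = Scal \<sigma>" "\<sigma> * \<sigma> = 1"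
      using s[OF ab(1) ab(1)] by (auto simp: index_line_def)
    moreover from 1 p q obtain y z where "p = Scal y" "q = Scal z" by (auto simp: index_line_def)
    ultimately show ?thesis using 1 by (simp add: algebra_simps)
  next
    case 2
    then obtain e \<phi> where "p = Vec e" "e \<in> L a b" "q = Covec \<phi>" "\<phi> \<in> dual_space (L a b)"
      using p q prec_asym[OF 2] by (auto simp: index_line_def)
    then show ?thesis using *[OF ab 2] by (simp add: sections[OF ab 2])
  next
    case 3
    then obtain e \<phi> where "q = Vec e" "e \<in> L b a" "p = Covec \<phi>" "\<phi> \<in> dual_space (L b a)"
      using p q prec_asym[OF 3] by (auto simp: index_line_def)
    then show ?thesis using *[OF ab(2,1) 3, of e \<phi>] by (simp add: sections[OF ab(2,1) 3] mult.commute)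
  qed
qed

lemma scalar_section:
  assumes "a \<in> I"
  shows "s a a x = Scal (scalar_of (s a a x))" "scalar_of (s a a x) * scalar_of (s a a x) = 1"
  using s[OF assms assms] by (auto simp: index_line_def)

lemma pair_scalar:
  assumes "a \<in> I" "p \<in> index_line D lam a a x"
  shows "pair (s a a x) p = scalar_of (s a a x) * scalar_of p"
  using assms(2) by (subst scalar_section(1)[OF assms(1)]) (auto simp: index_line_def)

text \<open>Two of the three sections are dual to each other and cancel by \<open>pair_dual\<close>
  against the pairing in \<open>theta\<close>; the diagonal sign of the third remains.\<close>

lemma index_cochain_degenerate:
  assumes ijk: "i \<in> I" "j \<in> I" "k \<in> I"
  shows "i = j \<Longrightarrow> index_cochain D lam s [i, j, k] x = scalar_of (s i i x)"
    and "j = k \<Longrightarrow> index_cochain D lam s [i, j, k] x = scalar_of (s j j x)"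
    and "k = i \<Longrightarrow> index_cochain D lam s [i, j, k] x = scalar_of (s i i x)"
proof -
  show ij: "index_cochain D lam s [i, j, k] x = scalar_of (s i i x)" if "i = j"
  proof (rule index_cochain_eqI[OF ijk])
    fix p q r assume "p \<in> index_line D lam j i x" "q \<in> index_line D lam k j x" "r \<in> index_line D lam i k x"
    then show "pair (s i j x) p * pair (s j k x) q * pair (s k i x) r =
        scalar_of (s i i x) * theta D lam i j k x p q r"
      using that pair_dual[OF ijk(1,3), of q r] by (simp add: theta_def pair_scalar[OF ijk(2)] mult.assoc)
  qed
  have jk: "index_cochain D lam s [i, j, k] x = scalar_of (s j j x)" if "j = k" "i \<noteq> j"
  proof (rule index_cochain_eqI[OF ijk])
    fix p q r assume "p \<in> index_line D lam j i x" "q \<in> index_line D lam k j x" "r \<in> index_line D lam i k x"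
    then show "pair (s i j x) p * pair (s j k x) q * pair (s k i x) r =
        scalar_of (s j j x) * theta D lam i j k x p q r"
      using that pair_dual[OF ijk(1,2), of p r]
      by (simp add: theta_def pair_scalar[OF ijk(3)] algebra_simps)
  qed
  have ki: "index_cochain D lam s [i, j, k] x = scalar_of (s i i x)" if "k = i" "i \<noteq> j"
  proof (rule index_cochain_eqI[OF ijk])
    fix p q r assume "p \<in> index_line D lam j i x" "q \<in> index_line D lam k j x" "r \<in> index_line D lam i k x"
    then show "pair (s i j x) p * pair (s j k x) q * pair (s k i x) r =
        scalar_of (s i i x) * theta D lam i j k x p q r"
      using that pair_dual[OF ijk(1,2), of p q]
      by (simp add: theta_def pair_scalar[OF ijk(1)] algebra_simps)
  qed
  show "j = k \<Longrightarrow> index_cochain D lam s [i, j, k] x = scalar_of (s j j x)"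
    using ij jk by (cases "i = j") simp_all
  show "k = i \<Longrightarrow> index_cochain D lam s [i, j, k] x = scalar_of (s i i x)"
    using ij ki by (cases "i = j") simp_all
qed

text \<open>Trilinear functionals on lines need only be compared on generators, and on those
  exterior multiplication differs from the sections by the ratio \<open>h\<close>.\<close>

lemma theta_up_value:
  assumes abc: "a \<in> I" "b \<in> I" "c \<in> I" "prec lam a b" "prec lam b c"
    and h: "vol a c = (\<lambda>gs. h * wedge (vol b c) (vol a b) gs)"
    and pqr: "p \<in> index_line D lam b a x" "q \<in> index_line D lam c b x" "r \<in> index_line D lam a c x"
  shows "pair (s a b x) p * pair (s b c x) q * pair (s c a x) r = h * theta_up p q r"
proof -
  have ac: "prec lam a c" using abc(4,5) by (rule prec_trans)
  note ab = sections[OF abc(1,2,4)] and bc = sections[OF abc(2,3,5)] and ca = sections[OF abc(1,3) ac]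
  let ?w = "wedge (vol b c) (vol a b)"
  have w: "?w \<in> L a c" by (rule wedge_L[OF abc(4,5) ab(3) bc(3)])
  obtain e f \<phi> where pqr': "p = Vec e" "e \<in> L a b" "q = Vec f" "f \<in> L b c" "r = Covec \<phi>"
      "\<phi> \<in> dual_space (L a c)"
    using pqr prec_asym[OF abc(4)] prec_asym[OF abc(5)] abc(4,5) ac by (auto simp: index_line_def)
  obtain t where t: "e = (\<lambda>gs. t * vol a b gs)"
    using gap_one_dimensional[OF abc(4) ab(3) fock_norm_nonzero[OF ab(4)] pqr'(2)] by blast
  obtain u where u: "f = (\<lambda>gs. u * vol b c gs)"
    using gap_one_dimensional[OF abc(5) bc(3) fock_norm_nonzero[OF bc(4)] pqr'(4)] by blast
  have "wedge f e = (\<lambda>gs. (u * t) * ?w gs)" unfolding t u by (rule ext) (rule wedge_scale)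
  then have "\<phi> (wedge f e) = u * t * \<phi> ?w" using dual_space_mult[OF pqr'(6) w] by simp
  moreover have "\<phi> (vol a c) = h * \<phi> ?w" unfolding h by (rule dual_space_mult[OF pqr'(6) w])
  moreover have "cov a b e = t" "cov b c f = u"
    unfolding t u using dual_space_mult[OF ab(5,3)] dual_space_mult[OF bc(5,3)] ab(6) bc(6) by simp_all
  ultimately show ?thesis by (simp add: ab bc ca pqr')
qed

text \<open>The inverse of exterior multiplication produces the inverse ratio. A factorisation of
  \<open>v\<close> is unique up to moving a scalar between its factors, which leaves \<beta>(f)
  \<alpha>(e) unchanged; so the description in \<open>theta_down\<close> is well defined.\<close>

lemma theta_down_value:
  assumes abc: "a \<in> I" "b \<in> I" "c \<in> I" "prec lam a b" "prec lam b c"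
    and h: "vol a c = (\<lambda>gs. h * wedge (vol b c) (vol a b) gs)" "h \<noteq> 0"
    and pqr: "p \<in> index_line D lam c a x" "q \<in> index_line D lam b c x" "r \<in> index_line D lam a b x"
  shows "pair (s a c x) p * pair (s c b x) q * pair (s b a x) r =
    inverse h * theta_down (L a b) (L b c) p q r"
proof -
  have ac: "prec lam a c" using abc(4,5) by (rule prec_trans)
  note ab = sections[OF abc(1,2,4)] and bc = sections[OF abc(2,3,5)] and ca = sections[OF abc(1,3) ac]
  let ?w = "wedge (vol b c) (vol a b)"
  obtain v \<beta> \<alpha> where pqr': "p = Vec v" "v \<in> L a c" "q = Covec \<beta>" "\<beta> \<in> dual_space (L b c)"
      "r = Covec \<alpha>" "\<alpha> \<in> dual_space (L a b)"
    using pqr prec_asym[OF abc(4)] prec_asym[OF abc(5)] prec_asym[OF ac] abc(4,5) ac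
    by (auto simp: index_line_def)
  obtain t where t: "v = (\<lambda>gs. t * vol a c gs)"
    using gap_one_dimensional[OF ac ca(3) fock_norm_nonzero[OF ca(4)] pqr'(2)] by blast
  have v: "v = (\<lambda>gs. (t * h) * ?w gs)" unfolding t h(1) by (simp add: mult.assoc)
  have "?w \<noteq> (\<lambda>gs. 0)" using fock_norm_nonzero[OF ca(4)] h by auto
  then obtain gs where gs: "?w gs \<noteq> 0" by auto
  have "(THE z. \<exists>e\<in>L a b. \<exists>f\<in>L b c. v = wedge f e \<and> z = \<beta> f * \<alpha> e) = t * h * \<beta> (vol b c) * \<alpha> (vol a b)"
  proof (rule the_equality)
    \<comment> \<open>A factorisation of \<open>v\<close> in which the whole coefficient is placed
      on the first factor.\<close>
    have "(\<lambda>gs. (t * h) * vol b c gs) \<in> L b c"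
      using bc(3) unfolding gap_power_def by (rule top_power_mult)
    moreover have "v = wedge (\<lambda>gs. (t * h) * vol b c gs) (vol a b)"
      using wedge_scale[of "t * h" "vol b c" 1 "vol a b"] by (simp add: v fun_eq_iff)
    moreover have "\<beta> (\<lambda>gs. (t * h) * vol b c gs) = t * h * \<beta> (vol b c)"
      by (rule dual_space_mult[OF pqr'(4) bc(3)])
    ultimately show "\<exists>e\<in>L a b. \<exists>f\<in>L b c. v = wedge f e \<and> t * h * \<beta> (vol b c) * \<alpha> (vol a b) = \<beta> f * \<alpha> e"
      using ab(3) by (intro bexI[of _ "vol a b"] bexI[of _ "\<lambda>gs. (t * h) * vol b c gs"]) auto
  next
    fix z assume "\<exists>e\<in>L a b. \<exists>f\<in>L b c. v = wedge f e \<and> z = \<beta> f * \<alpha> e"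
    then obtain e f where ef: "e \<in> L a b" "f \<in> L b c" "v = wedge f e" "z = \<beta> f * \<alpha> e" by blast
    obtain y where y: "e = (\<lambda>gs. y * vol a b gs)"
      using gap_one_dimensional[OF abc(4) ab(3) fock_norm_nonzero[OF ab(4)] ef(1)] by blast
    obtain u where u: "f = (\<lambda>gs. u * vol b c gs)"
      using gap_one_dimensional[OF abc(5) bc(3) fock_norm_nonzero[OF bc(4)] ef(2)] by blast
    \<comment> \<open>Comparison at a list where the product does not vanish fixes the product of
      the two coefficients.\<close>
    have "v gs = u * y * ?w gs" unfolding ef(3) u y by (rule wedge_scale)
    then have "u * y = t * h" using gs v by simp
    moreover have "z = u * \<beta> (vol b c) * (y * \<alpha> (vol a b))"
      unfolding ef(4) u y dual_space_mult[OF pqr'(4) bc(3)] dual_space_mult[OF pqr'(6) ab(3)] ..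
    then have "z = u * y * \<beta> (vol b c) * \<alpha> (vol a b)" by simp
    ultimately show "z = t * h * \<beta> (vol b c) * \<alpha> (vol a b)" by simp
  qed
  moreover have "cov a c v = t" unfolding t dual_space_mult[OF ca(5,3)] ca(6) by simp
  ultimately show ?thesis using h(2) by (simp add: ab bc ca pqr')
qed

lemma index_cochain_sorted:
  assumes abc: "a \<in> I" "b \<in> I" "c \<in> I" "prec lam a b" "prec lam b c"
    and h: "vol a c = (\<lambda>gs. h * wedge (vol b c) (vol a b) gs)" "h \<noteq> 0"
  shows "index_cochain D lam s [a, b, c] x = h" "index_cochain D lam s [c, a, b] x = h"
    "index_cochain D lam s [b, c, a] x = h" "index_cochain D lam s [c, b, a] x = inverse h"
    "index_cochain D lam s [a, c, b] x = inverse h" "index_cochain D lam s [b, a, c] x = inverse h"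
proof -
  have ac: "prec lam a c" using abc(4,5) by (rule prec_trans)
  have ord: "prec lam a b" "prec lam b c" "prec lam a c" "\<not> prec lam b a" "\<not> prec lam c b" "\<not> prec lam c a"
    "a \<noteq> b" "b \<noteq> c" "a \<noteq> c" "b \<noteq> a" "c \<noteq> b" "c \<noteq> a"
    using abc(4,5) ac prec_asym[of lam] prec_irrefl[of lam] by metis+
  note up = theta_up_value[OF abc h(1)] and down = theta_down_value[OF abc h]
  show "index_cochain D lam s [a, b, c] x = h"
    by (rule index_cochain_eqI[OF abc(1,2,3)]) (simp add: theta_def ord up)
  show "index_cochain D lam s [c, a, b] x = h"
  proof (rule index_cochain_eqI[OF abc(3,1,2)])
    fix p q r assume "p \<in> index_line D lam a c x" "q \<in> index_line D lam b a x" "r \<in> index_line D lam c b x"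
    then show "pair (s c a x) p * pair (s a b x) q * pair (s b c x) r = h * theta D lam c a b x p q r"
      using up[of q r p] by (simp add: theta_def ord mult_ac)
  qed
  show "index_cochain D lam s [b, c, a] x = h"
  proof (rule index_cochain_eqI[OF abc(2,3,1)])
    fix p q r assume "p \<in> index_line D lam c b x" "q \<in> index_line D lam a c x" "r \<in> index_line D lam b a x"
    then show "pair (s b c x) p * pair (s c a x) q * pair (s a b x) r = h * theta D lam b c a x p q r"
      using up[of r p q] by (simp add: theta_def ord mult_ac)
  qed
  show "index_cochain D lam s [c, b, a] x = inverse h"
  proof (rule index_cochain_eqI[OF abc(3,2,1)])
    fix p q r assume "p \<in> index_line D lam b c x" "q \<in> index_line D lam a b x" "r \<in> index_line D lam c a x"
    then show "pair (s c b x) p * pair (s b a x) q * pair (s a c x) r = inverse h * theta D lam c b a x p q r"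
      using down[of r p q] by (simp add: theta_def ord mult_ac)
  qed
  show "index_cochain D lam s [a, c, b] x = inverse h"
    by (rule index_cochain_eqI[OF abc(1,3,2)]) (simp add: theta_def ord down)
  show "index_cochain D lam s [b, a, c] x = inverse h"
  proof (rule index_cochain_eqI[OF abc(2,1,3)])
    fix p q r assume "p \<in> index_line D lam a b x" "q \<in> index_line D lam c a x" "r \<in> index_line D lam b c x"
    then show "pair (s b a x) p * pair (s a c x) q * pair (s c b x) r = inverse h * theta D lam b a c x p q r"
      using down[of q r p] by (simp add: theta_def ord mult_ac)
  qed
qed

text \<open>The cochain relating \<open>g\<close> to \<open>h\<close>. Since the volume element of
  the gap belongs to the section with exchanged indices, the transition factor is inverted for
  \<open>i\<close> before \<open>j\<close>. The diagonal entry compensates the sign by which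
  \<open>h\<close> differs from 1 on degenerate triples.\<close>

definition gauge :: "nat \<Rightarrow> nat \<Rightarrow> complex" where
  "gauge i j = (if i = j then scalar_of (s i i x)
     else if prec lam i j then inverse (transition i j) else transition j i)"

lemma gauge_norm:
  assumes "i \<in> I" "j \<in> I" "i \<noteq> j" shows "cmod (gauge i j) = 1"
  using assms prec_cases[of i j lam] transition_props(2)
  by (auto simp: gauge_def norm_inverse)

lemma cochains_cohomologous:
  assumes ijk: "i \<in> I" "j \<in> I" "k \<in> I"
  shows "qf_cochain D lam \<omega> [i, j, k] x =
    index_cochain D lam s [i, j, k] x * (gauge j k * inverse (gauge i k) * gauge i j)"
proof (cases "i = j \<or> j = k \<or> k = i")
  case True
  have nz: "gauge a b \<noteq> 0" if "a \<in> I" "b \<in> I" for a b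
    using that gauge_norm[of a b] scalar_section(2)[of a] by (cases "a = b") (auto simp: gauge_def)
  have sq: "gauge a a = scalar_of (s a a x)" "inverse (scalar_of (s a a x)) = scalar_of (s a a x)"
    "scalar_of (s a a x) * scalar_of (s a a x) = 1" if "a \<in> I" for a
    using scalar_section(2)[OF that] by (auto simp: gauge_def inverse_unique)
  have inv: "gauge j i * gauge i j = 1" if "i \<noteq> j"
    using prec_cases[OF that, of lam]
  proof
    assume "prec lam i j"
    moreover from this have "transition i j \<noteq> 0" using transition_props(2)[OF ijk(1,2)] by force
    ultimately show ?thesis using that prec_asym[of lam i j] by (simp add: gauge_def)
  next
    assume "prec lam j i"
    moreover from this have "transition j i \<noteq> 0" using transition_props(2)[OF ijk(2,1)] by force
    ultimately show ?thesis using that prec_asym[of lam j i] by (simp add: gauge_def)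
  qed
  have q: "qf_cochain D lam \<omega> [i, j, k] x = 1" by (rule qf_cochain_degenerate[OF ijk True])
  consider "i = j" | "j = k" | "k = i" "i \<noteq> j" using True by blast
  then show ?thesis
  proof cases
    case 1
    then show ?thesis
      using q index_cochain_degenerate(1)[OF ijk 1] nz[OF ijk(2,3)] sq[OF ijk(2)] by simp
  next
    case 2
    then show ?thesis
      using q index_cochain_degenerate(2)[OF ijk 2] nz[OF ijk(1,3)] sq[OF ijk(2)]
      by (simp add: field_simps)
  next
    case 3
    have "index_cochain D lam s [i, j, k] x * (gauge j k * inverse (gauge i k) * gauge i j) =
        (scalar_of (s i i x) * scalar_of (s i i x)) * (gauge j i * gauge i j)"
      using 3 index_cochain_degenerate(3)[OF ijk 3(1)] sq[OF ijk(1)] by simp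
    then show ?thesis using q inv[OF 3(2)] sq[OF ijk(1)] by simp
  qed
next
  case False
  \<comment> \<open>Quantifying over the list \<open>t\<close> lets one increasing triple serve all
    six orders of its indices.\<close>
  have sorted: "qf_cochain D lam \<omega> t x =
      index_cochain D lam s t x * (gauge (t ! 1) (t ! 2) * inverse (gauge (t ! 0) (t ! 2)) * gauge (t ! 0) (t ! 1))"
    if abc: "a \<in> I" "b \<in> I" "c \<in> I" "prec lam a b" "prec lam b c"
      and t: "t \<in> {[a, b, c], [c, a, b], [b, c, a], [c, b, a], [a, c, b], [b, a, c]}" for a b c t
  proof -
    have ac: "prec lam a c" using abc(4,5) by (rule prec_trans)
    have ord: "\<not> prec lam b a" "\<not> prec lam c b" "\<not> prec lam c a"
      "a \<noteq> b" "b \<noteq> c" "a \<noteq> c" "b \<noteq> a" "c \<noteq> b" "c \<noteq> a"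
      using abc(4,5) ac prec_asym[of lam] prec_irrefl[of lam] by metis+
    obtain h where h: "vol a c = (\<lambda>gs. h * wedge (vol b c) (vol a b) gs)" "h \<noteq> 0"
      using ratio_exists[OF abc] by blast
    have g: "gauge a b = inverse (transition a b)" "gauge b c = inverse (transition b c)"
      "gauge a c = inverse (transition a c)" "gauge b a = transition a b" "gauge c b = transition b c"
      "gauge c a = transition a c"
      using abc(4,5) ac ord by (auto simp: gauge_def)
    show ?thesis
      using t by (elim insertE emptyE)
        (simp_all add: qf_cochain_sorted[OF abc h] index_cochain_sorted[OF abc h] g mult_ac)
  qed
  have "\<exists>a\<in>I. \<exists>b\<in>I. \<exists>c\<in>I. prec lam a b \<and> prec lam b c \<and>
      [i, j, k] \<in> {[a, b, c], [c, a, b], [b, c, a], [c, b, a], [a, c, b], [b, a, c]}"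
  proof -
    consider "prec lam i j" "prec lam j k" | "prec lam i k" "prec lam k j" | "prec lam k i" "prec lam i j"
      | "prec lam j i" "prec lam i k" | "prec lam j k" "prec lam k i" | "prec lam k j" "prec lam j i"
      using prec_cases[of i j lam] prec_cases[of j k lam] prec_cases[of i k lam] False by blast
    then show ?thesis
      by cases (use ijk in \<open>blast+\<close>)
  qed
  then obtain a b c where abc: "a \<in> I" "b \<in> I" "c \<in> I" "prec lam a b" "prec lam b c"
    and t: "[i, j, k] \<in> {[a, b, c], [c, a, b], [b, c, a], [c, b, a], [a, c, b], [b, a, c]}" by blast
  show ?thesis using sorted[OF abc t] by simp
qed

end

section \<open>From single points to the cover\<close>

lemma gerbe_pointI:
  fixes D :: "'m \<Rightarrow> 'h::{complex_inner, complete_space} unb_op"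
  assumes \<omega>: "volume_elements M N U D lam \<omega>" and s: "unit_sections M N U D lam s"
  shows "gerbe_point D lam x {i. i < N \<and> x \<in> U i} \<omega> s"
proof
  fix a b assume ab: "a \<in> {i. i < N \<and> x \<in> U i}" "b \<in> {i. i < N \<and> x \<in> U i}"
  show "s a b x \<in> index_line D lam a b x \<and> pair (s a b x) (s b a x) = 1"
    using s ab unfolding unit_sections_def by blast
  assume prec: "prec lam a b"
  show "\<omega> a b x \<in> gap_power D lam a b x \<and> fock_norm (\<omega> a b x) = 1"
    using \<omega> ab prec unfolding volume_elements_def by blast
  have "\<exists>v. (\<forall>x\<in>U a \<inter> U b. s b a x = Vec (v x) \<and> fock_norm (v x) = 1)"
    using s[unfolded unit_sections_def, THEN conjunct2, THEN conjunct1, rule_format, of a b] ab prec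
    by blast
  then show "\<exists>v. s b a x = Vec v \<and> fock_norm v = 1" using ab by blast
qed

text \<open>The factor is chosen separately at each point, but it satisfies the equation between two
  continuous families, and this determines its continuity.\<close>

lemma transition_continuous_map:
  fixes D :: "'m \<Rightarrow> 'h::{complex_inner, complete_space} unb_op"
  assumes \<omega>: "volume_elements M N U D lam \<omega>" and s: "unit_sections M N U D lam s"
    and ij: "i < N" "j < N" "prec lam i j"
  shows "continuous_map (subtopology M (U i \<inter> U j)) euclidean (\<lambda>x. gerbe_point.transition x \<omega> s i j)"
proof -
  obtain v where v: "\<And>x. x \<in> U i \<inter> U j \<Longrightarrow> s j i x = Vec (v x) \<and> fock_norm (v x) = 1"
    and cont: "fock_continuous M (U i \<inter> U j) v"
    using s[unfolded unit_sections_def, THEN conjunct2, THEN conjunct1, rule_format, OF ij] by blast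
  have pt: "\<omega> i j x = (\<lambda>gs. gerbe_point.transition x \<omega> s i j * v x gs) \<and>
      v x \<in> fock_space scaleC (\<lambda>x. x)" if x: "x \<in> U i \<inter> U j" for x
  proof -
    interpret gerbe_point D lam x "{i. i < N \<and> x \<in> U i}" \<omega> s by (rule gerbe_pointI[OF \<omega> s])
    have ij': "i \<in> {i. i < N \<and> x \<in> U i}" "j \<in> {i. i < N \<and> x \<in> U i}" using x ij by auto
    have "vol i j = v x" using sections(1)[OF ij' ij(3)] v[OF x] by simp
    moreover have "vol i j \<in> fock_space scaleC (\<lambda>x. x)"
      using sections(3)[OF ij' ij(3)] unfolding gap_power_def top_power_def
      by (auto intro: fock_space_whole)
    ultimately show ?thesis using transition_props(1)[OF ij' ij(3)] by simp
  qed
  show ?thesis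
  proof (rule transition_continuous)
    show "fock_continuous M (U i \<inter> U j) (\<omega> i j)"
      using \<omega> ij unfolding volume_elements_def by blast
    show "fock_continuous M (U i \<inter> U j) v" by (rule cont)
  qed (use v pt in auto)
qed

theorem theorem2p3:
  fixes n :: nat
    and M :: "'m topology"
    and \<A> :: "('m set \<times> ('m \<Rightarrow> nat \<Rightarrow> real)) set"
    and D :: "'m \<Rightarrow> ('h::{complex_inner, complete_space, second_countable_topology}) unb_op"
    and N :: nat
    and U :: "nat \<Rightarrow> 'm set"
    and lam :: "nat \<Rightarrow> real"
    and \<omega> :: "nat \<Rightarrow> nat \<Rightarrow> 'm \<Rightarrow> 'h form"
    and s :: "nat \<Rightarrow> nat \<Rightarrow> 'm \<Rightarrow> 'h form line_elt"
  assumes "closed_smooth_manifold n M \<A>"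
    and "\<not> finite_cdim (UNIV :: 'h set)"
    and "fredholm_family M D"
    and "good_cover M N U"
    and "\<And>i x. i < N \<Longrightarrow> x \<in> U i \<Longrightarrow> complex_of_real (lam i) \<notin> spectrum (D x)"
    and "volume_elements M N U D lam \<omega>"
    and "unit_sections M N U D lam s"
  shows "quasifree_gerbe M N U D lam \<omega> = dixmier_douady M N U D lam s"
proof -
  note \<omega> = assms(6) and s = assms(7)
  \<comment> \<open>The gauge at a point does not refer to the index set of the locale, so the
    pointwise values assemble to one cochain on all intersections.\<close>
  define u where "u t x = gerbe_point.gauge lam x \<omega> s (t ! 0) (t ! 1)" for t x
  note pt = gerbe_pointI[OF \<omega> s]
  have u_self: "u [i, i] x = scalar_of (s i i x)" for i x
    by (simp add: u_def gerbe_point.gauge_def[OF pt])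
  have u_up: "u [i, j] x = inverse (gerbe_point.transition x \<omega> s i j)" if "prec lam i j" for i j x
    using that by (auto simp: u_def gerbe_point.gauge_def[OF pt])
  have u_down: "u [i, j] x = gerbe_point.transition x \<omega> s j i" if "prec lam j i" for i j x
    using that prec_asym[OF that] by (auto simp: u_def gerbe_point.gauge_def[OF pt])
  have trans_norm: "cmod (gerbe_point.transition x \<omega> s i j) = 1"
    if "i < N" "j < N" "prec lam i j" "x \<in> U i" "x \<in> U j" for i j x
    using that by (intro gerbe_point.transition_props(2)[OF pt]) auto
  have "S1_cochain M N U 1 u"
    unfolding S1_cochain_def
  proof
    fix t assume "t \<in> simplices N 1"
    then obtain i j where t: "t = [i, j]" and ij: "i < N" "j < N" using simplices_1 by blast
    have cap: "cap U t = U i \<inter> U j" by (auto simp: t cap_def)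
    consider "i = j" | "prec lam i j" | "prec lam j i" using prec_cases by blast
    then show "continuous_map (subtopology M (cap U t)) euclidean (u t) \<and>
        (\<forall>x\<in>cap U t. cmod (u t x) = 1)"
    proof cases
      case 1
      then show ?thesis
        using s ij unfolding unit_sections_def cap unfolding t by (simp add: u_self[abs_def] Int_absorb)
    next
      case 2
      have "continuous_map (subtopology M (cap U t)) euclidean
          (\<lambda>x. inverse (gerbe_point.transition x \<omega> s i j))"
        unfolding cap using trans_norm[OF ij 2]
        by (intro continuous_map_complex_inverse transition_continuous_map[OF \<omega> s ij 2]) force
      then show ?thesis
        using trans_norm[OF ij 2] unfolding cap unfolding t by (simp add: u_up[OF 2, abs_def] norm_inverse)
    next
      case 3
      have "continuous_map (subtopology M (cap U t)) euclidean
          (\<lambda>x. gerbe_point.transition x \<omega> s j i)"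
        using transition_continuous_map[OF \<omega> s ij(2,1) 3] unfolding cap by (simp add: Int_commute)
      then show ?thesis
        using trans_norm[OF ij(2,1) 3] unfolding cap unfolding t by (simp add: u_down[OF 3, abs_def])
    qed
  qed
  moreover have "qf_cochain D lam \<omega> [i, j, k] x =
      index_cochain D lam s [i, j, k] x * (u [j, k] x * inverse (u [i, k] x) * u [i, j] x)"
    if "i < N" "j < N" "k < N" "x \<in> U i" "x \<in> U j" "x \<in> U k" for i j k x
    using gerbe_point.cochains_cohomologous[OF pt, of i x j k] that by (simp add: u_def)
  ultimately have "S1_class M N U 1 (qf_cochain D lam \<omega>) = S1_class M N U 1 (index_cochain D lam s)"
    by (rule S1_class_eqI)
  then show ?thesis by (simp add: quasifree_gerbe_def dixmier_douady_def)
qed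

end
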